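(* Let $\mathcal{P}$ be the globularization of a classical PRO $P$, and let $\mathfrak{P}$ be the initial weakening of $\mathcal{P}$. Let $A$ be an algebra for $\mathfrak{P}$. If a pair of cells in $\mathfrak{P}(m,n)$ which sit over the same cell in $U(\mathcal{P})$ (i.e. have the same image under the structure map $\mathfrak{P}(m,n)\to U(\mathcal{P})(m,n)$) act on the same globular word in $A^m$, then the two resulting cells in $A^n$ are weakly equivalent in $A^n$. In particular, lifts of operations in the original theory that gave equal results now give weakly equivalent results.
   Context: **Collections.** $\mathbf{Glob}$ is the category of globular sets (sets $X_k$, $k\ge0$, with $s,t:X_{k+1}\to X_k$, $ss=st$, $ts=tt$), $\mathbf{1}$ its terminal object, $(\mathcal{T},\mu,\eta)$ the free strict $\omega$-category monad on $\mathbf{Glob}$. $\mathbf{Col}=\mathbf{Glob}/\mathcal{T}(\mathbf{1})$ is the category of collections (structure maps are called arity maps). $\times$ is the cartesian product in $\mathbf{Col}$ (fibre product over $\mathcal{T}(\mathbf{1})$), with unit the terminal collection $\mathcal{T}(\mathbf{1})$. $X\square Y$ is the pullback of $x:X\to\mathcal{T}(\mathbf{1})$ and $\mathcal{T}(!_Y):\mathcal{T}(Y)\to\mathcal{T}(\mathbf{1})$, with arity map $X\square Y\to\mathcal{T}(Y)\xrightarrow{\mathcal{T}(y)}\mathcal{T}^2(\mathbf{1})\xrightarrow{\mu_{\mathbf{1}}}\mathcal{T}(\mathbf{1})$; so a cell of $X\square Y$ is a pair $(a,w)$ of a cell $a$ of $X$ and a "globular word" $w\in\mathcal{T}(Y)$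 of shape $x(a)$. It is monoidal with unit $I=(\eta_{\mathbf{1}}:\mathbf{1}\to\mathcal{T}(\mathbf{1}))$. $\boxtimes:(A\times B)\square(C\times D)\to(A\square C)\times(B\square D)$ is the canonical interchange map. A collection $a:A\to\mathcal{T}(\mathbf{1})$ is degenerate if $a=[id]\circ{!_A}$ where $[id]:\mathbf{1}\to\mathcal{T}(\mathbf{1})$ picks out the iterated identities on the unique $0$-cell. **Globularization.** A PRO $P$ is a strict monoidal category with object set $\mathbb{N}$ and monoidal product $+$ given by addition on objects. Its globularization $\mathcal{P}$ has $\mathcal{P}(n,m)=\coprod_{P(n,m)}\mathcal{T}(\mathbf{1})$ in $\mathbf{Col}$; composition $\mathcal{P}(m,p)\square\mathcal{P}(n,m)\cong\coprod_{P(m,p)\times P(n,m)}\mathcal{T}(\mathbf{1})\square\mathcal{T}(\mathbf{1})\to\mathcal{P}(n,p)$ and sum $\mathcal{P}(n,m)\times\mathcal{P}(l,k)\cong\coprod_{P(n,m)\times P(l,k)}\mathcal{T}(\mathbf{1})\times\mathcal{T}(\mathbf{1})\to\mathcal{P}(n+l,m+k)$ are given by composition and $+$ of $P$ on indices and by the unique maps to the terminal collection $\mathcal{T}(\mathbf{1})$; identities $I\to\mathcal{P}(n,n)$ and the unit $\mathcal{T}(\mathbf{1})\to\mathcal{P}(0,0)$ land in the summands indexed by identities of $P$. It is a category enriched over $(\mathbf{Col},\square,I)$, and its underlying family $U(\mathcal{P})=(\mathcal{P}(n,m))_{n,m}$ is also a monoid via the sum. **Weakenings.** $\mathbb{N}\mathbf{Col}\mathbf{Graph}$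 is the category of families $(\mathbf{G}(n,m))_{n,m\in\mathbb{N}}$ of collections and families of collection maps, monoidal under $(X\oplus Y)(n,m)=\coprod_{n=i+j,\,m=l+k}X(i,l)\times Y(j,k)$, with unit $\mathfrak{I}$ equal to $\mathcal{T}(\mathbf{1})$ in degree $(0,0)$ and empty otherwise. For $f:X\to Y$ in $\mathbf{Glob}$ and $\nu\in Y_k$, $k\ge1$, let $\mathrm{Par}_f(\nu)$ be the set of pairs $(\rho^-,\rho^+)$ of parallel $(k-1)$-cells of $X$ (same source and same target; all $0$-cells are parallel) with $f(\rho^-)=s(\nu)$, $f(\rho^+)=t(\nu)$; a contraction on $f$ is a family $\kappa_\nu:\mathrm{Par}_f(\nu)\to X_k$ with $s\kappa_\nu(\rho^-,\rho^+)=\rho^-$, $t\kappa_\nu(\rho^-,\rho^+)=\rho^+$, $f\kappa_\nu(\rho^-,\rho^+)=\nu$. A weakening of $\mathcal{P}$ is an object $\mathcal{E}\to U(\mathcal{P})$ of $\mathbb{N}\mathbf{Col}\mathbf{Graph}/U(\mathcal{P})$ equipped with (a) a contraction on each component $\mathcal{E}(n,m)\to\mathcal{P}(n,m)$; (b) a monoid structure for $\oplus$ (giving maps $+:\mathcal{E}(n,m)\times\mathcal{E}(l,k)\to\mathcal{E}(n+l,m+k)$ and a unit) such that the structure map is a monoid map; (c) a $\mathbf{Col}$-category structure (for $\square$) with object set $\mathbb{N}$ such that the structure map is an identity-on-objects $\mathbf{Col}$-functor. No compatibility between (a), (b), (c) is required. Morphisms are maps over $U(\mathcal{P})$ preserving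 all three structures; $\mathfrak{P}$ is the initial weakening (the free weakening on the initial object of $\mathbb{N}\mathbf{Col}\mathbf{Graph}/U(\mathcal{P})$). **Algebra for a weakening** $\mathcal{E}$: a degenerate collection $A$ with collection maps $\Omega_{n,m}:\mathcal{E}(n,m)\square A^n\to A^m$ ($n,m\in\mathbb{N}$; cartesian powers in $\mathbf{Col}$) such that, suppressing associators: $\Omega_{m,r}(\mathrm{id}\square\Omega_{n,m})=\Omega_{n,r}(\circ\square\mathrm{id})$; $\Omega_{n+r,m+s}(+\square\mathrm{id})=(\Omega_{n,m}\times\Omega_{r,s})\boxtimes$ on $[\mathcal{E}(n,m)\times\mathcal{E}(r,s)]\square[A^n\times A^r]$; and $\Omega_{n,n}(j_n\square\mathrm{id})$ is the left unitor $I\square A^n\to A^n$, $j_n$ denoting the identities of $\mathcal{E}$. The cell resulting from $x\in\mathfrak{P}(m,n)$ acting on a globular word $w\in\mathcal{T}(A^m)$ is $\Omega_{m,n}(x,w)$. **Composites and identities in $A$.** An algebra $A$ for $\mathfrak{P}$ carries a weak $\omega$-category structure: the part of $\mathfrak{P}(1,1)$ lying over the summand $\mathcal{T}(\mathbf{1})$ of $\mathcal{P}(1,1)$ indexed by the identity of $1\in P$ is a globular operad with contraction acting on $A$. In particular, for $k\ge1$, let $e_{k-1}\in\mathfrak{P}(1,1)$ be the $(k-1)$-cell picked out by $j_1$. For $k$-cells $g:X\to Y$, $h:Y\to Z$, the composite $hg$ is obtained by letting $\kappa_\pi(e_{k-1},e_{k-1})$ act, where $\pi$ is the pasting shape (in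 the identity summand) of two $k$-cells glued along a $(k-1)$-cell; the identity $k$-cell $\mathrm{id}_X$ on a $(k-1)$-cell $X$ is obtained by letting $\kappa_\pi(e_{k-1},e_{k-1})$ act on $X$, where $\pi$ is the identity $k$-cell on the generating $(k-1)$-cell. On $A^n$ these operations are taken componentwise. **Weak equivalence.** Let $\mathcal{C}$ be an $\omega$-category (here in the weak sense just described) with set of $k$-cells $\mathcal{C}(k)$. A $k$-cell $f$ is pseudo-invertible if there is a set of witnesses $W=\coprod_{j\ge0}W(j)$ with $W(j)\subset\mathcal{C}(k+j)$, $f\in W(0)$, and such that for every $g\in W(j)$ with source and target $(k+j-1)$-cells $X$ and $Y$ there is $g'\in W(j)$ with source $Y$ and target $X$, together with $(k+j+1)$-cells $i_g:\mathrm{id}_X\Rightarrow g'g$ and $e_g:gg'\Rightarrow\mathrm{id}_Y$ in $W(j+1)$. Two $k$-cells are weakly equivalent if there exists a pseudo-invertible ($(k+1)$-)cell between them.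
   Formalization: The pair of cells in 𝔓(m,n) is additionally assumed parallel (same source and target; no condition on 0-cells); without this the two resulting cells need not be parallel, so no cell between them need exist and the claim fails. *)

theory Defs
  imports Main
begin

section \<open>Globular sets\<close>

text \<open>The maps \<open>src X k\<close> and \<open>tgt X k\<close> go from \<open>(k+1)\<close>-cells to \<open>k\<close>-cells. Maps between
  globular sets are families of functions indexed by the dimension; only their values on cells
  matter.\<close>

record 'a glob =
  cells :: "nat \<Rightarrow> 'a set"
  src :: "nat \<Rightarrow> 'a \<Rightarrow> 'a"
  tgt :: "nat \<Rightarrow> 'a \<Rightarrow> 'a"

definition globular_set :: "('a, 'z) glob_scheme \<Rightarrow> bool" where
  "globular_set X \<longleftrightarrow>
     (\<forall>k. \<forall>x \<in> cells X (Suc k). src X k x \<in> cells X k \<and> tgt X k x \<in> cells X k) \<and>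
     (\<forall>k. \<forall>x \<in> cells X (Suc (Suc k)).
        src X k (src X (Suc k) x) = src X k (tgt X (Suc k) x) \<and>
        tgt X k (src X (Suc k) x) = tgt X k (tgt X (Suc k) x))"

definition glob_map ::
  "('a, 'y) glob_scheme \<Rightarrow> ('b, 'z) glob_scheme \<Rightarrow> (nat \<Rightarrow> 'a \<Rightarrow> 'b) \<Rightarrow> bool" where
  "glob_map X Y f \<longleftrightarrow>
     (\<forall>k. \<forall>x \<in> cells X k. f k x \<in> cells Y k) \<and>
     (\<forall>k. \<forall>x \<in> cells X (Suc k).
        f k (src X k x) = src Y k (f (Suc k) x) \<and> f k (tgt X k x) = tgt Y k (f (Suc k) x))"

definition parallel :: "('a, 'z) glob_scheme \<Rightarrow> nat \<Rightarrow> 'a \<Rightarrow> 'a \<Rightarrow> bool" where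
  "parallel X k x y \<longleftrightarrow> x \<in> cells X k \<and> y \<in> cells X k \<and>
     (case k of 0 \<Rightarrow> True | Suc j \<Rightarrow> src X j x = src X j y \<and> tgt X j x = tgt X j y)"

definition one :: "unit glob" where
  "one = \<lparr>cells = \<lambda>_. UNIV, src = \<lambda>_ _. (), tgt = \<lambda>_ _. ()\<rparr>"

section \<open>The free strict omega-category monad\<close>

text \<open>The free strict \<open>\<omega>\<close>-category on a globular set \<open>X\<close> is presented by generators and relations.
  A term of dimension \<open>k\<close> is a generator (a \<open>k\<close>-cell of \<open>X\<close>), the identity \<open>TId t\<close> on a term
  \<open>t\<close> of dimension \<open>k - 1\<close>, or a composite \<open>TComp p g f\<close> (first \<open>f\<close>, then \<open>g\<close>) of terms of
  dimension \<open>k\<close> glued along a \<open>p\<close>-cell, \<open>p < k\<close>. The dimension is not recorded in a term but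
  passed as a separate argument.\<close>

datatype 'a sterm = TGen 'a | TId "'a sterm" | TComp nat "'a sterm" "'a sterm"

text \<open>Source and target, from dimension \<open>k + 1\<close> to dimension \<open>k\<close>.\<close>

primrec tsrc :: "('a, 'z) glob_scheme \<Rightarrow> nat \<Rightarrow> 'a sterm \<Rightarrow> 'a sterm" where
  "tsrc X k (TGen x) = TGen (src X k x)"
| "tsrc X k (TId t) = t"
| "tsrc X k (TComp p g f) = (if p = k then tsrc X k f else TComp p (tsrc X k g) (tsrc X k f))"

primrec ttgt :: "('a, 'z) glob_scheme \<Rightarrow> nat \<Rightarrow> 'a sterm \<Rightarrow> 'a sterm" where
  "ttgt X k (TGen x) = TGen (tgt X k x)"
| "ttgt X k (TId t) = t"
| "ttgt X k (TComp p g f) = (if p = k then ttgt X k g else TComp p (ttgt X k g) (ttgt X k f))"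

text \<open>\<open>down s p d\<close> applies \<open>d\<close> successive boundary maps, from dimension \<open>p + d\<close> to dimension \<open>p\<close>.\<close>

primrec down :: "(nat \<Rightarrow> 'a \<Rightarrow> 'a) \<Rightarrow> nat \<Rightarrow> nat \<Rightarrow> 'a \<Rightarrow> 'a" where
  "down s p 0 x = x"
| "down s p (Suc d) x = down s p d (s (p + d) x)"

text \<open>\<open>term_eq X k t u\<close>: both \<open>t\<close> and \<open>u\<close> are well-formed terms of dimension \<open>k\<close>, and they are
  identified by the laws of strict \<open>\<omega>\<close>-categories. Well-formedness (composability up to the
  laws) and equality depend on each other, so they are generated together, as a partial
  equivalence relation; \<open>t\<close> is well-formed iff \<open>term_eq X k t t\<close>.\<close>

inductive term_eq :: "('a, 'z) glob_scheme \<Rightarrow> nat \<Rightarrow> 'a sterm \<Rightarrow> 'a sterm \<Rightarrow> bool"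
  for X :: "('a, 'z) glob_scheme" where
  gen: "x \<in> cells X k \<Longrightarrow> term_eq X k (TGen x) (TGen x)"
| ident: "term_eq X k t u \<Longrightarrow> term_eq X (Suc k) (TId t) (TId u)"
| comp: "\<lbrakk>p < k; term_eq X k g g'; term_eq X k f f';
     term_eq X p (down (tsrc X) p (k - p) g) (down (ttgt X) p (k - p) f)\<rbrakk>
   \<Longrightarrow> term_eq X k (TComp p g f) (TComp p g' f')"
| sym: "term_eq X k t u \<Longrightarrow> term_eq X k u t"
| trans: "\<lbrakk>term_eq X k t u; term_eq X k u v\<rbrakk> \<Longrightarrow> term_eq X k t v"
| assoc: "\<lbrakk>term_eq X k (TComp p h (TComp p g f)) (TComp p h (TComp p g f));
     term_eq X k (TComp p (TComp p h g) f) (TComp p (TComp p h g) f)\<rbrakk>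
   \<Longrightarrow> term_eq X k (TComp p h (TComp p g f)) (TComp p (TComp p h g) f)"
| unit_left: "\<lbrakk>p < k; term_eq X k f f\<rbrakk>
   \<Longrightarrow> term_eq X k (TComp p ((TId ^^ (k - p)) (down (ttgt X) p (k - p) f)) f) f"
| unit_right: "\<lbrakk>p < k; term_eq X k f f\<rbrakk>
   \<Longrightarrow> term_eq X k (TComp p f ((TId ^^ (k - p)) (down (tsrc X) p (k - p) f))) f"
| interchange: "\<lbrakk>p < q; q < k;
     term_eq X k (TComp p (TComp q g' g) (TComp q f' f)) (TComp p (TComp q g' g) (TComp q f' f));
     term_eq X k (TComp q (TComp p g' f') (TComp p g f)) (TComp q (TComp p g' f') (TComp p g f))\<rbrakk>
   \<Longrightarrow> term_eq X k (TComp p (TComp q g' g) (TComp q f' f)) (TComp q (TComp p g' f') (TComp p g f))"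
| ident_comp: "term_eq X k (TComp p g f) (TComp p g f)
   \<Longrightarrow> term_eq X (Suc k) (TId (TComp p g f)) (TComp p (TId g) (TId f))"

definition tclass :: "('a, 'z) glob_scheme \<Rightarrow> nat \<Rightarrow> 'a sterm \<Rightarrow> 'a sterm set" where
  "tclass X k t = {u. term_eq X k t u}"

definition Tfree :: "('a, 'z) glob_scheme \<Rightarrow> 'a sterm set glob" where
  "Tfree X = \<lparr>
     cells = \<lambda>k. {tclass X k t | t. term_eq X k t t},
     src = \<lambda>k c. \<Union>t\<in>c. tclass X k (tsrc X k t),
     tgt = \<lambda>k c. \<Union>t\<in>c. tclass X k (ttgt X k t)\<rparr>"

text \<open>The operations of the strict \<open>\<omega>\<close>-category \<open>Tfree X\<close>: \<open>tid X k\<close> sends a \<open>k\<close>-cell to its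
  identity \<open>(k+1)\<close>-cell, \<open>tcomp X k p d c\<close> is the composite of the \<open>k\<close>-cells \<open>c\<close> and then \<open>d\<close>
  along a \<open>p\<close>-cell.\<close>

definition tid :: "('a, 'z) glob_scheme \<Rightarrow> nat \<Rightarrow> 'a sterm set \<Rightarrow> 'a sterm set" where
  "tid X k c = (\<Union>t\<in>c. tclass X (Suc k) (TId t))"

definition tcomp ::
  "('a, 'z) glob_scheme \<Rightarrow> nat \<Rightarrow> nat \<Rightarrow> 'a sterm set \<Rightarrow> 'a sterm set \<Rightarrow> 'a sterm set" where
  "tcomp X k p d c = (\<Union>g\<in>d. \<Union>f\<in>c. tclass X k (TComp p g f))"

definition tunit :: "('a, 'z) glob_scheme \<Rightarrow> nat \<Rightarrow> 'a \<Rightarrow> 'a sterm set" where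
  "tunit X k x = tclass X k (TGen x)"

primrec term_map :: "(nat \<Rightarrow> 'a \<Rightarrow> 'b) \<Rightarrow> nat \<Rightarrow> 'a sterm \<Rightarrow> 'b sterm" where
  "term_map f k (TGen x) = TGen (f k x)"
| "term_map f k (TId t) = TId (term_map f (k - 1) t)"
| "term_map f k (TComp p u v) = TComp p (term_map f k u) (term_map f k v)"

text \<open>Action of the monad on a map \<open>f\<close> with codomain \<open>Y\<close>.\<close>

definition tmap ::
  "('b, 'z) glob_scheme \<Rightarrow> (nat \<Rightarrow> 'a \<Rightarrow> 'b) \<Rightarrow> nat \<Rightarrow> 'a sterm set \<Rightarrow> 'b sterm set" where
  "tmap Y f k c = (\<Union>t\<in>c. tclass Y k (term_map f k t))"

text \<open>The multiplication evaluates a term whose generators are cells of \<open>Tfree X\<close> with the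
  operations of \<open>Tfree X\<close>.\<close>

primrec term_eval :: "('a, 'z) glob_scheme \<Rightarrow> nat \<Rightarrow> 'a sterm set sterm \<Rightarrow> 'a sterm set" where
  "term_eval X k (TGen c) = c"
| "term_eval X k (TId t) = tid X (k - 1) (term_eval X (k - 1) t)"
| "term_eval X k (TComp p g f) = tcomp X k p (term_eval X k g) (term_eval X k f)"

definition tmult :: "('a, 'z) glob_scheme \<Rightarrow> nat \<Rightarrow> 'a sterm set sterm set \<Rightarrow> 'a sterm set" where
  "tmult X k c = (\<Union>t\<in>c. term_eval X k t)"

section \<open>Collections\<close>

type_synonym pshape = "unit sterm set"

record 'a coll = "'a glob" +
  ar :: "nat \<Rightarrow> 'a \<Rightarrow> pshape"

definition collection :: "'a coll \<Rightarrow> bool" where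
  "collection X \<longleftrightarrow> globular_set X \<and> glob_map X (Tfree one) (ar X)"

definition coll_map :: "'a coll \<Rightarrow> 'b coll \<Rightarrow> (nat \<Rightarrow> 'a \<Rightarrow> 'b) \<Rightarrow> bool" where
  "coll_map X Y f \<longleftrightarrow> glob_map X Y f \<and> (\<forall>k. \<forall>x \<in> cells X k. ar Y k (f k x) = ar X k x)"

definition terminal_coll :: "pshape coll" where
  "terminal_coll = \<lparr>cells = cells (Tfree one), src = src (Tfree one), tgt = tgt (Tfree one),
     ar = \<lambda>k \<theta>. \<theta>\<rparr>"

definition unit_coll :: "unit coll" where
  "unit_coll = \<lparr>cells = cells one, src = src one, tgt = tgt one, ar = tunit one\<rparr>"

definition prod_coll :: "'a coll \<Rightarrow> 'b coll \<Rightarrow> ('a \<times> 'b) coll" where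
  "prod_coll X Y = \<lparr>
     cells = \<lambda>k. {(x, y). x \<in> cells X k \<and> y \<in> cells Y k \<and> ar X k x = ar Y k y},
     src = \<lambda>k (x, y). (src X k x, src Y k y),
     tgt = \<lambda>k (x, y). (tgt X k x, tgt Y k y),
     ar = \<lambda>k (x, y). ar X k x\<rparr>"

text \<open>A cell of the \<open>n\<close>-fold fibre product of \<open>A\<close> over \<open>Tfree one\<close> is a shape together with a
  list of \<open>n\<close> cells of that arity; keeping the shape makes the \<open>0\<close>-th power the terminal
  collection.\<close>

definition pow_coll :: "'a coll \<Rightarrow> nat \<Rightarrow> (pshape \<times> 'a list) coll" where
  "pow_coll A n = \<lparr>
     cells = \<lambda>k. {(\<theta>, xs). \<theta> \<in> cells (Tfree one) k \<and> length xs = n \<and>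
                    (\<forall>x \<in> set xs. x \<in> cells A k \<and> ar A k x = \<theta>)},
     src = \<lambda>k (\<theta>, xs). (src (Tfree one) k \<theta>, map (src A k) xs),
     tgt = \<lambda>k (\<theta>, xs). (tgt (Tfree one) k \<theta>, map (tgt A k) xs),
     ar = \<lambda>k (\<theta>, xs). \<theta>\<rparr>"

text \<open>The isomorphism from \<open>A\<^sup>n \<times> A\<^sup>r\<close> to \<open>A\<^sup>n\<^sup>+\<^sup>r\<close>.\<close>

definition pow_append ::
  "nat \<Rightarrow> (pshape \<times> 'a list) \<times> (pshape \<times> 'a list) \<Rightarrow> pshape \<times> 'a list" where
  "pow_append k = (\<lambda>((\<theta>, xs), (\<theta>', ys)). (\<theta>, xs @ ys))"

text \<open>The shape of a globular word is its image under the free functor on the map to \<open>one\<close>.\<close>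

definition shape :: "nat \<Rightarrow> 'a sterm set \<Rightarrow> pshape" where
  "shape k w = tmap one (\<lambda>_ _. ()) k w"

definition box :: "'a coll \<Rightarrow> 'b coll \<Rightarrow> ('a \<times> 'b sterm set) coll" where
  "box X Y = \<lparr>
     cells = \<lambda>k. {(a, w). a \<in> cells X k \<and> w \<in> cells (Tfree Y) k \<and> ar X k a = shape k w},
     src = \<lambda>k (a, w). (src X k a, src (Tfree Y) k w),
     tgt = \<lambda>k (a, w). (tgt X k a, tgt (Tfree Y) k w),
     ar = \<lambda>k (a, w). tmult one k (tmap (Tfree one) (ar Y) k w)\<rparr>"

text \<open>\<open>f \<box> g\<close>, where \<open>Y'\<close> is the codomain of \<open>g\<close>.\<close>

definition box_map ::
  "'d coll \<Rightarrow> (nat \<Rightarrow> 'a \<Rightarrow> 'c) \<Rightarrow> (nat \<Rightarrow> 'b \<Rightarrow> 'd) \<Rightarrow>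
     nat \<Rightarrow> 'a \<times> 'b sterm set \<Rightarrow> 'c \<times> 'd sterm set" where
  "box_map Y' f g k = (\<lambda>(a, w). (f k a, tmap Y' g k w))"

text \<open>The associator from \<open>X \<box> (Y \<box> Z)\<close> to \<open>(X \<box> Y) \<box> Z\<close>, and the inverses of the left and
  right unitors \<open>I \<box> X \<rightarrow> X\<close> and \<open>X \<box> I \<rightarrow> X\<close>. All three are isomorphisms, so that the
  coherence diagrams below may be read in these directions.\<close>

definition box_assoc ::
  "'b coll \<Rightarrow> 'c coll \<Rightarrow> nat \<Rightarrow>
     'a \<times> ('b \<times> 'c sterm set) sterm set \<Rightarrow> ('a \<times> 'b sterm set) \<times> 'c sterm set" where
  "box_assoc Y Z k = (\<lambda>(a, W). ((a, tmap Y (\<lambda>_. fst) k W),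
     tmult Z k (tmap (Tfree Z) (\<lambda>_. snd) k W)))"

definition box_lunit_inv :: "'a coll \<Rightarrow> nat \<Rightarrow> 'a \<Rightarrow> unit \<times> 'a sterm set" where
  "box_lunit_inv X k x = ((), tunit X k x)"

definition box_runit_inv :: "'a coll \<Rightarrow> nat \<Rightarrow> 'a \<Rightarrow> 'a \<times> unit sterm set" where
  "box_runit_inv X k x = (x, ar X k x)"

definition box_interchange ::
  "'c coll \<Rightarrow> 'd coll \<Rightarrow> nat \<Rightarrow>
     ('a \<times> 'b) \<times> ('c \<times> 'd) sterm set \<Rightarrow> ('a \<times> 'c sterm set) \<times> ('b \<times> 'd sterm set)" where
  "box_interchange C D k = (\<lambda>((a, b), w). ((a, tmap C (\<lambda>_. fst) k w), (b, tmap D (\<lambda>_. snd) k w)))"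

text \<open>The cell of \<open>Tfree one\<close> given by the \<open>k\<close>-fold iterated identity on the unique \<open>0\<close>-cell.\<close>

primrec id_shape :: "nat \<Rightarrow> pshape" where
  "id_shape 0 = tunit one 0 ()"
| "id_shape (Suc k) = tid one k (id_shape k)"

definition degenerate :: "'a coll \<Rightarrow> bool" where
  "degenerate A \<longleftrightarrow> (\<forall>k. \<forall>x \<in> cells A k. ar A k x = id_shape k)"

section \<open>PROs and their globularization\<close>

record 'p pro =
  hom :: "nat \<Rightarrow> nat \<Rightarrow> 'p set"
  pcomp :: "nat \<Rightarrow> nat \<Rightarrow> nat \<Rightarrow> 'p \<Rightarrow> 'p \<Rightarrow> 'p"
  pid :: "nat \<Rightarrow> 'p"
  padd :: "nat \<Rightarrow> nat \<Rightarrow> nat \<Rightarrow> nat \<Rightarrow> 'p \<Rightarrow> 'p \<Rightarrow> 'p"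

text \<open>\<open>pcomp P n m r g f\<close> is \<open>g \<circ> f\<close> for \<open>f : n \<rightarrow> m\<close> and \<open>g : m \<rightarrow> r\<close>; \<open>padd P n m l k f g\<close> is
  \<open>f + g\<close> for \<open>f : n \<rightarrow> m\<close> and \<open>g : l \<rightarrow> k\<close>.\<close>

locale PRO =
  fixes P :: "'p pro"
  assumes comp_closed: "\<lbrakk>f \<in> hom P n m; g \<in> hom P m r\<rbrakk> \<Longrightarrow> pcomp P n m r g f \<in> hom P n r"
    and id_closed: "pid P n \<in> hom P n n"
    and comp_assoc: "\<lbrakk>f \<in> hom P n m; g \<in> hom P m r; h \<in> hom P r q\<rbrakk> \<Longrightarrow>
      pcomp P n r q h (pcomp P n m r g f) = pcomp P n m q (pcomp P m r q h g) f"
    and comp_id_left: "f \<in> hom P n m \<Longrightarrow> pcomp P n m m (pid P m) f = f"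
    and comp_id_right: "f \<in> hom P n m \<Longrightarrow> pcomp P n n m f (pid P n) = f"
    and add_closed: "\<lbrakk>f \<in> hom P n m; g \<in> hom P l k\<rbrakk> \<Longrightarrow>
      padd P n m l k f g \<in> hom P (n + l) (m + k)"
    and add_id: "padd P n n l l (pid P n) (pid P l) = pid P (n + l)"
    and add_comp: "\<lbrakk>f \<in> hom P n m; g \<in> hom P m r; f' \<in> hom P n' m'; g' \<in> hom P m' r'\<rbrakk> \<Longrightarrow>
      padd P n r n' r' (pcomp P n m r g f) (pcomp P n' m' r' g' f') =
      pcomp P (n + n') (m + m') (r + r') (padd P m r m' r' g g') (padd P n m n' m' f f')"
    and add_assoc: "\<lbrakk>f \<in> hom P n m; g \<in> hom P n' m'; h \<in> hom P n'' m''\<rbrakk> \<Longrightarrow>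
      padd P (n + n') (m + m') n'' m'' (padd P n m n' m' f g) h =
      padd P n m (n' + n'') (m' + m'') f (padd P n' m' n'' m'' g h)"
    and add_zero_left: "f \<in> hom P n m \<Longrightarrow> padd P 0 0 n m (pid P 0) f = f"
    and add_zero_right: "f \<in> hom P n m \<Longrightarrow> padd P n m 0 0 f (pid P 0) = f"

text \<open>The data of a family of collections indexed by pairs of natural numbers with a composition
  \<open>G(m,r) \<box> G(n,m) \<rightarrow> G(n,r)\<close>, identities \<open>I \<rightarrow> G(n,n)\<close>, a sum
  \<open>G(n,m) \<times> G(l,r) \<rightarrow> G(n+l,m+r)\<close> and a unit for the sum \<open>Tfree one \<rightarrow> G(0,0)\<close>. The last
  numerical argument of each operation is the dimension.\<close>

record 'e gpro =
  gcol :: "nat \<Rightarrow> nat \<Rightarrow> 'e coll"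
  gcomp :: "nat \<Rightarrow> nat \<Rightarrow> nat \<Rightarrow> nat \<Rightarrow> 'e \<times> 'e sterm set \<Rightarrow> 'e"
  gid :: "nat \<Rightarrow> nat \<Rightarrow> unit \<Rightarrow> 'e"
  gadd :: "nat \<Rightarrow> nat \<Rightarrow> nat \<Rightarrow> nat \<Rightarrow> nat \<Rightarrow> 'e \<times> 'e \<Rightarrow> 'e"
  gzero :: "nat \<Rightarrow> pshape \<Rightarrow> 'e"

definition coll_category :: "('e, 'z) gpro_scheme \<Rightarrow> bool" where
  "coll_category G \<longleftrightarrow>
     (\<forall>n m. collection (gcol G n m)) \<and>
     (\<forall>n m r. coll_map (box (gcol G m r) (gcol G n m)) (gcol G n r) (gcomp G n m r)) \<and>
     (\<forall>n. coll_map unit_coll (gcol G n n) (gid G n)) \<and>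
     (\<forall>n m r q k. \<forall>c \<in> cells (box (gcol G r q) (box (gcol G m r) (gcol G n m))) k.
        gcomp G n r q k (box_map (gcol G n r) (\<lambda>_ x. x) (gcomp G n m r) k c) =
        gcomp G n m q k (box_map (gcol G n m) (gcomp G m r q) (\<lambda>_ x. x) k
          (box_assoc (gcol G m r) (gcol G n m) k c))) \<and>
     (\<forall>n m k. \<forall>x \<in> cells (gcol G n m) k.
        gcomp G n m m k (box_map (gcol G n m) (gid G m) (\<lambda>_ x. x) k
          (box_lunit_inv (gcol G n m) k x)) = x \<and>
        gcomp G n n m k (box_map (gcol G n n) (\<lambda>_ x. x) (gid G n) k
          (box_runit_inv (gcol G n m) k x)) = x)"

text \<open>A monoid for \<open>\<oplus>\<close>, written out on the summands \<open>G(n,m) \<times> G(l,r)\<close> of \<open>G \<oplus> G\<close>. The unit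
  object is \<open>Tfree one\<close> in degree \<open>(0,0)\<close>; the unit isomorphism sends a cell \<open>x\<close> of arity \<open>\<theta>\<close> to
  the pair of \<open>\<theta>\<close> and \<open>x\<close>.\<close>

definition sum_monoid :: "('e, 'z) gpro_scheme \<Rightarrow> bool" where
  "sum_monoid G \<longleftrightarrow>
     (\<forall>n m. collection (gcol G n m)) \<and>
     (\<forall>n m l r. coll_map (prod_coll (gcol G n m) (gcol G l r)) (gcol G (n + l) (m + r))
        (gadd G n m l r)) \<and>
     coll_map terminal_coll (gcol G 0 0) (gzero G) \<and>
     (\<forall>n m n' m' n'' m'' k x y z.
        x \<in> cells (gcol G n m) k \<and> y \<in> cells (gcol G n' m') k \<and> z \<in> cells (gcol G n'' m'') k \<and>
        ar (gcol G n m) k x = ar (gcol G n' m') k y \<and>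
        ar (gcol G n' m') k y = ar (gcol G n'' m'') k z \<longrightarrow>
        gadd G (n + n') (m + m') n'' m'' k (gadd G n m n' m' k (x, y), z) =
        gadd G n m (n' + n'') (m' + m'') k (x, gadd G n' m' n'' m'' k (y, z))) \<and>
     (\<forall>n m k. \<forall>x \<in> cells (gcol G n m) k.
        gadd G 0 0 n m k (gzero G k (ar (gcol G n m) k x), x) = x \<and>
        gadd G n m 0 0 k (x, gzero G k (ar (gcol G n m) k x)) = x)"

definition coll_functor ::
  "('e, 'y) gpro_scheme \<Rightarrow> ('f, 'z) gpro_scheme \<Rightarrow> (nat \<Rightarrow> nat \<Rightarrow> nat \<Rightarrow> 'e \<Rightarrow> 'f) \<Rightarrow> bool" where
  "coll_functor G H \<phi> \<longleftrightarrow>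
     (\<forall>n m. coll_map (gcol G n m) (gcol H n m) (\<phi> n m)) \<and>
     (\<forall>n m r k. \<forall>c \<in> cells (box (gcol G m r) (gcol G n m)) k.
        \<phi> n r k (gcomp G n m r k c) =
        gcomp H n m r k (box_map (gcol H n m) (\<phi> m r) (\<phi> n m) k c)) \<and>
     (\<forall>n k. \<phi> n n k (gid G n k ()) = gid H n k ())"

definition sum_monoid_map ::
  "('e, 'y) gpro_scheme \<Rightarrow> ('f, 'z) gpro_scheme \<Rightarrow> (nat \<Rightarrow> nat \<Rightarrow> nat \<Rightarrow> 'e \<Rightarrow> 'f) \<Rightarrow> bool" where
  "sum_monoid_map G H \<phi> \<longleftrightarrow>
     (\<forall>n m. coll_map (gcol G n m) (gcol H n m) (\<phi> n m)) \<and>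
     (\<forall>n m l r k. \<forall>(x, y) \<in> cells (prod_coll (gcol G n m) (gcol G l r)) k.
        \<phi> (n + l) (m + r) k (gadd G n m l r k (x, y)) =
        gadd H n m l r k (\<phi> n m k x, \<phi> l r k y)) \<and>
     (\<forall>k. \<forall>\<theta> \<in> cells (Tfree one) k. \<phi> 0 0 k (gzero G k \<theta>) = gzero H k \<theta>)"

text \<open>The collection \<open>\<Coprod>\<^bsub>P(n,m)\<^esub> Tfree one\<close>.\<close>

definition copies :: "'p set \<Rightarrow> ('p \<times> pshape) coll" where
  "copies S = \<lparr>
     cells = \<lambda>k. S \<times> cells (Tfree one) k,
     src = \<lambda>k (f, \<theta>). (f, src (Tfree one) k \<theta>),
     tgt = \<lambda>k (f, \<theta>). (f, tgt (Tfree one) k \<theta>),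
     ar = \<lambda>k (f, \<theta>). \<theta>\<rparr>"

text \<open>The free functor preserves coproducts, so a globular word in \<open>copies S\<close> comes from exactly
  one summand; this is the isomorphism
  \<open>\<P>(m,r) \<box> \<P>(n,m) \<cong> \<Coprod> Tfree one \<box> Tfree one\<close>.\<close>

definition word_index :: "'p set \<Rightarrow> nat \<Rightarrow> ('p \<times> pshape) sterm set \<Rightarrow> 'p" where
  "word_index S k W =
     (THE f. f \<in> S \<and> W \<in> tmap (copies S) (\<lambda>_ \<theta>. (f, \<theta>)) k ` cells (Tfree (Tfree one)) k)"

text \<open>A map to the terminal collection is given by the arity, hence the second component of
  composites.\<close>

definition globularization :: "'p pro \<Rightarrow> ('p \<times> pshape) gpro" where
  "globularization P = \<lparr>
     gcol = \<lambda>n m. copies (hom P n m),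
     gcomp = \<lambda>n m r k (x, W). (pcomp P n m r (fst x) (word_index (hom P n m) k W),
               ar (box (copies (hom P m r)) (copies (hom P n m))) k (x, W)),
     gid = \<lambda>n k u. (pid P n, ar unit_coll k u),
     gadd = \<lambda>n m l r k ((f, \<theta>), (g, \<theta>')). (padd P n m l r f g, \<theta>),
     gzero = \<lambda>k \<theta>. (pid P 0, \<theta>)\<rparr>"

section \<open>Weakenings\<close>

text \<open>\<open>\<kappa> k \<nu> a b\<close> is the chosen lift of the \<open>(k+1)\<close>-cell \<open>\<nu>\<close> with source \<open>a\<close> and target \<open>b\<close>.\<close>

definition Par ::
  "('a, 'y) glob_scheme \<Rightarrow> ('b, 'z) glob_scheme \<Rightarrow> (nat \<Rightarrow> 'a \<Rightarrow> 'b) \<Rightarrow> nat \<Rightarrow> 'b \<Rightarrow> ('a \<times> 'a) set" where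
  "Par X Y f k \<nu> = {(a, b). parallel X k a b \<and> f k a = src Y k \<nu> \<and> f k b = tgt Y k \<nu>}"

definition contraction ::
  "('a, 'y) glob_scheme \<Rightarrow> ('b, 'z) glob_scheme \<Rightarrow> (nat \<Rightarrow> 'a \<Rightarrow> 'b) \<Rightarrow>
     (nat \<Rightarrow> 'b \<Rightarrow> 'a \<Rightarrow> 'a \<Rightarrow> 'a) \<Rightarrow> bool" where
  "contraction X Y f \<kappa> \<longleftrightarrow>
     (\<forall>k. \<forall>\<nu> \<in> cells Y (Suc k). \<forall>(a, b) \<in> Par X Y f k \<nu>.
        \<kappa> k \<nu> a b \<in> cells X (Suc k) \<and>
        src X k (\<kappa> k \<nu> a b) = a \<and> tgt X k (\<kappa> k \<nu> a b) = b \<and> f (Suc k) (\<kappa> k \<nu> a b) = \<nu>)"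

record ('p, 'e) weak_gpro = "'e gpro" +
  proj :: "nat \<Rightarrow> nat \<Rightarrow> nat \<Rightarrow> 'e \<Rightarrow> 'p \<times> pshape"
  contr :: "nat \<Rightarrow> nat \<Rightarrow> nat \<Rightarrow> 'p \<times> pshape \<Rightarrow> 'e \<Rightarrow> 'e \<Rightarrow> 'e"

definition weakening :: "'p pro \<Rightarrow> ('p, 'e) weak_gpro \<Rightarrow> bool" where
  "weakening P E \<longleftrightarrow>
     (\<forall>n m. contraction (gcol E n m) (gcol (globularization P) n m) (proj E n m) (contr E n m)) \<and>
     sum_monoid E \<and> sum_monoid_map E (globularization P) (proj E) \<and>
     coll_category E \<and> coll_functor E (globularization P) (proj E)"

definition weakening_map ::
  "'p pro \<Rightarrow> ('p, 'e) weak_gpro \<Rightarrow> ('p, 'f) weak_gpro \<Rightarrow>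
     (nat \<Rightarrow> nat \<Rightarrow> nat \<Rightarrow> 'e \<Rightarrow> 'f) \<Rightarrow> bool" where
  "weakening_map P E F \<phi> \<longleftrightarrow>
     (\<forall>n m k. \<forall>x \<in> cells (gcol E n m) k. proj F n m k (\<phi> n m k x) = proj E n m k x) \<and>
     (\<forall>n m k. \<forall>\<nu> \<in> cells (gcol (globularization P) n m) (Suc k).
        \<forall>(a, b) \<in> Par (gcol E n m) (gcol (globularization P) n m) (proj E n m) k \<nu>.
        \<phi> n m (Suc k) (contr E n m k \<nu> a b) = contr F n m k \<nu> (\<phi> n m k a) (\<phi> n m k b)) \<and>
     sum_monoid_map E F \<phi> \<and> coll_functor E F \<phi>"

text \<open>HOL cannot quantify over types inside a formula, so the universal property is stated for
  weakenings \<open>F\<close> with cells in the same type as those of \<open>E\<close>.\<close>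

definition initial_weakening :: "'p pro \<Rightarrow> ('p, 'e) weak_gpro \<Rightarrow> bool" where
  "initial_weakening P E \<longleftrightarrow> weakening P E \<and>
     (\<forall>F :: ('p, 'e) weak_gpro. weakening P F \<longrightarrow>
        (\<exists>\<phi>. weakening_map P E F \<phi> \<and>
          (\<forall>\<psi>. weakening_map P E F \<psi> \<longrightarrow>
            (\<forall>n m k. \<forall>x \<in> cells (gcol E n m) k. \<psi> n m k x = \<phi> n m k x))))"

section \<open>Algebras\<close>

locale weakening_algebra =
  fixes E :: "('p, 'e) weak_gpro"
    and A :: "'a coll"
    and \<Omega> :: "nat \<Rightarrow> nat \<Rightarrow> nat \<Rightarrow> 'e \<times> (pshape \<times> 'a list) sterm set \<Rightarrow> pshape \<times> 'a list"
  assumes carrier: "collection A" "degenerate A"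
    and action_map: "coll_map (box (gcol E n m) (pow_coll A n)) (pow_coll A m) (\<Omega> n m)"
    and action_comp: "c \<in> cells (box (gcol E m r) (box (gcol E n m) (pow_coll A n))) k \<Longrightarrow>
      \<Omega> m r k (box_map (pow_coll A m) (\<lambda>_ x. x) (\<Omega> n m) k c) =
      \<Omega> n r k (box_map (pow_coll A n) (gcomp E n m r) (\<lambda>_ x. x) k
        (box_assoc (gcol E n m) (pow_coll A n) k c))"
    and action_sum: "d \<in> cells (box (prod_coll (gcol E n m) (gcol E r s))
        (prod_coll (pow_coll A n) (pow_coll A r))) k \<Longrightarrow>
      \<Omega> (n + r) (m + s) k (box_map (pow_coll A (n + r)) (gadd E n m r s) pow_append k d) =
      pow_append k (map_prod (\<Omega> n m k) (\<Omega> r s k)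
        (box_interchange (pow_coll A n) (pow_coll A r) k d))"
    and action_id: "x \<in> cells (pow_coll A n) k \<Longrightarrow>
      \<Omega> n n k (box_map (pow_coll A n) (gid E n) (\<lambda>_ x. x) k
        (box_lunit_inv (pow_coll A n) k x)) = x"

section \<open>Composites, identities and weak equivalence\<close>

text \<open>\<open>wcomp C k h g\<close> is the composite \<open>hg\<close> of \<open>(k+1)\<close>-cells along a \<open>k\<close>-cell, and \<open>wid C k x\<close>
  the identity \<open>(k+1)\<close>-cell on the \<open>k\<close>-cell \<open>x\<close>.\<close>

record 'c wcat = "'c glob" +
  wcomp :: "nat \<Rightarrow> 'c \<Rightarrow> 'c \<Rightarrow> 'c"
  wid :: "nat \<Rightarrow> 'c \<Rightarrow> 'c"

definition comp_op :: "'p pro \<Rightarrow> ('p, 'e) weak_gpro \<Rightarrow> nat \<Rightarrow> 'e" where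
  "comp_op P E k = contr E 1 1 k
     (pid P 1, tcomp one (Suc k) k (tunit one (Suc k) ()) (tunit one (Suc k) ()))
     (gid E 1 k ()) (gid E 1 k ())"

definition id_op :: "'p pro \<Rightarrow> ('p, 'e) weak_gpro \<Rightarrow> nat \<Rightarrow> 'e" where
  "id_op P E k = contr E 1 1 k (pid P 1, tid one k (tunit one k ())) (gid E 1 k ()) (gid E 1 k ())"

text \<open>A cell of \<open>A\<close> as a generating word in the first power of \<open>A\<close>.\<close>

definition cell_word :: "'a coll \<Rightarrow> nat \<Rightarrow> 'a \<Rightarrow> (pshape \<times> 'a list) sterm set" where
  "cell_word A k x = tunit (pow_coll A 1) k (ar A k x, [x])"

definition alg_comp ::
  "'p pro \<Rightarrow> ('p, 'e) weak_gpro \<Rightarrow> 'a coll \<Rightarrow>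
     (nat \<Rightarrow> nat \<Rightarrow> nat \<Rightarrow> 'e \<times> (pshape \<times> 'a list) sterm set \<Rightarrow> pshape \<times> 'a list) \<Rightarrow>
     nat \<Rightarrow> 'a \<Rightarrow> 'a \<Rightarrow> 'a" where
  "alg_comp P E A \<Omega> k h g = hd (snd (\<Omega> 1 1 (Suc k) (comp_op P E k,
     tcomp (pow_coll A 1) (Suc k) k (cell_word A (Suc k) h) (cell_word A (Suc k) g))))"

definition alg_id ::
  "'p pro \<Rightarrow> ('p, 'e) weak_gpro \<Rightarrow> 'a coll \<Rightarrow>
     (nat \<Rightarrow> nat \<Rightarrow> nat \<Rightarrow> 'e \<times> (pshape \<times> 'a list) sterm set \<Rightarrow> pshape \<times> 'a list) \<Rightarrow>
     nat \<Rightarrow> 'a \<Rightarrow> 'a" where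
  "alg_id P E A \<Omega> k x = hd (snd (\<Omega> 1 1 (Suc k) (id_op P E k,
     tid (pow_coll A 1) k (cell_word A k x))))"

text \<open>The componentwise structure on the \<open>n\<close>-th power. Shapes are composed in \<open>Tfree one\<close>, which
  is the effect on arities of the actions above.\<close>

definition pow_wcat ::
  "'p pro \<Rightarrow> ('p, 'e) weak_gpro \<Rightarrow> 'a coll \<Rightarrow>
     (nat \<Rightarrow> nat \<Rightarrow> nat \<Rightarrow> 'e \<times> (pshape \<times> 'a list) sterm set \<Rightarrow> pshape \<times> 'a list) \<Rightarrow>
     nat \<Rightarrow> (pshape \<times> 'a list) wcat" where
  "pow_wcat P E A \<Omega> n = \<lparr>
     cells = cells (pow_coll A n), src = src (pow_coll A n), tgt = tgt (pow_coll A n),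
     wcomp = \<lambda>k (\<theta>, hs) (\<theta>', gs).
       (tcomp one (Suc k) k \<theta> \<theta>', map2 (alg_comp P E A \<Omega> k) hs gs),
     wid = \<lambda>k (\<theta>, xs). (tid one k \<theta>, map (alg_id P E A \<Omega> k) xs)\<rparr>"

text \<open>Pseudo-invertibility of a \<open>k\<close>-cell makes sense for \<open>k \<ge> 1\<close> only; \<open>k + j - 1\<close> is the dimension
  of the source and target of the elements of \<open>W j\<close>.\<close>

definition pseudo_invertible :: "'c wcat \<Rightarrow> nat \<Rightarrow> 'c \<Rightarrow> bool" where
  "pseudo_invertible C k f \<longleftrightarrow> 1 \<le> k \<and>
     (\<exists>W. (\<forall>j. W j \<subseteq> cells C (k + j)) \<and> f \<in> W 0 \<and>
        (\<forall>j. \<forall>g \<in> W j. \<exists>g' \<in> W j. \<exists>i \<in> W (j + 1). \<exists>e \<in> W (j + 1).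
           src C (k + j - 1) g' = tgt C (k + j - 1) g \<and>
           tgt C (k + j - 1) g' = src C (k + j - 1) g \<and>
           src C (k + j) i = wid C (k + j - 1) (src C (k + j - 1) g) \<and>
           tgt C (k + j) i = wcomp C (k + j - 1) g' g \<and>
           src C (k + j) e = wcomp C (k + j - 1) g g' \<and>
           tgt C (k + j) e = wid C (k + j - 1) (tgt C (k + j - 1) g)))"

definition weakly_equivalent :: "'c wcat \<Rightarrow> nat \<Rightarrow> 'c \<Rightarrow> 'c \<Rightarrow> bool" where
  "weakly_equivalent C k x y \<longleftrightarrow> x \<in> cells C k \<and> y \<in> cells C k \<and>
     (\<exists>f \<in> cells C (k + 1). src C k f = x \<and> tgt C k f = y \<and> pseudo_invertible C (k + 1) f)"

end

theory Submission
  imports Defs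
begin

text \<open>Let \<open>x\<close> and \<open>y\<close> be parallel cells over the same cell \<open>\<nu>\<close>, acting on a word \<open>w\<close>. The contraction
  over the identity on \<open>\<nu>\<close> yields a cell \<open>x \<rightarrow> y\<close>, whose action on the identity of \<open>w\<close> connects the
  two results. It is pseudo-invertible: as witnesses take all actions of cells over iterated
  identities of \<open>\<nu>\<close> on the corresponding iterated identities of \<open>w\<close>. Inverses again come from the
  contraction. For the unit and counit, the identity and composite cells of \<open>A\<^sup>n\<close> must be exhibited
  as actions of parallel cells over the same cell. Such cells arise by summing \<open>n\<close> copies of
  the operation defining identities or composites in \<open>A\<close> and composing this sum with the given
  cells; strictness of the base makes both lie over the same identity.

  The technical groundwork is that the presentation of the free strict \<open>\<omega>\<close>-category by terms is
  sound for boundaries and for substitution. Since well-formedness and equality of terms are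
  mutually dependent, both are shown by induction on the dimension with an inner rule induction.\<close>

text \<open>A weak equivalence is a cell from one result to the other, so the two results must share
  their boundary. Two lifts of one cell may have different boundaries, which is why the cells are
  taken parallel; in dimension \<open>0\<close> this is automatic, and the statement about lifts of
  operations follows. The witnesses have to be described by a condition that units and counits
  inherit one dimension up. Lying over an identity is such a condition: in the free strict category
  an identity composed with itself is that same identity. The obstacle is that \<open>wid\<close>
  and \<open>wcomp\<close> work entry by entry through unary operations in
  \<open>gcol E 1 1\<close>, while the contraction that must supply units and counits lives on
  \<open>gcol E m n\<close>. The axioms \<open>action_sum\<close> and \<open>action_comp\<close>
  bridge this gap.\<close>

section \<open>Boundary maps on terms\<close>

definition bd :: "('a, 'z) glob_scheme \<Rightarrow> bool \<Rightarrow> nat \<Rightarrow> 'a sterm \<Rightarrow> 'a sterm" where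
  "bd X b = (if b then ttgt X else tsrc X)"

lemma bd_simps [simp]:
  "bd X b k (TGen x) = TGen ((if b then tgt X else src X) k x)"
  "bd X b k (TId t) = t"
  "bd X b k (TComp p g f) =
     (if p = k then bd X b k (if b then g else f) else TComp p (bd X b k g) (bd X b k f))"
  by (auto simp: bd_def)

text \<open>With source and target as two values of one Boolean, each argument below is made once
  for both. These equations translate back wherever the rules of \<open>term_eq\<close> mention
  \<open>tsrc\<close> and \<open>ttgt\<close>.\<close>

lemma tsrc_bd: "tsrc X = bd X False" and ttgt_bd: "ttgt X = bd X True"
  by (auto simp: bd_def)

lemma down_TId_funpow [simp]: "down (bd X b) p d ((TId ^^ d) t) = t"
  by (induction d) simp_all

lemma term_eq_refl_left: "term_eq X k t u \<Longrightarrow> term_eq X k t t"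
  and term_eq_refl_right: "term_eq X k t u \<Longrightarrow> term_eq X k u u"
  by (meson term_eq.sym term_eq.trans)+

text \<open>Rules such as \<open>assoc\<close> and \<open>ident_comp\<close> only assume that
  composites are well-formed, so \<open>p < k\<close> has to be recovered. A plain rule induction
  does this before anything is known about boundaries.\<close>

lemma term_eq_comp_less:
  assumes "term_eq X k t u"
  shows "(\<forall>p g f. t = TComp p g f \<longrightarrow> p < k) \<and> (\<forall>p g f. u = TComp p g f \<longrightarrow> p < k)"
  using assms by (induction rule: term_eq.induct) auto

lemma term_eq_TId_funpow: "term_eq X p t u \<Longrightarrow> term_eq X (p + d) ((TId ^^ d) t) ((TId ^^ d) u)"
  by (induction d) (auto intro: term_eq.ident)

section \<open>Boundaries of terms\<close>

definition glob_term :: "('a, 'z) glob_scheme \<Rightarrow> nat \<Rightarrow> 'a sterm \<Rightarrow> bool" where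
  "glob_term X k t \<longleftrightarrow> (\<forall>i b. k = Suc (Suc i) \<longrightarrow>
     term_eq X i (bd X b i (bd X False (Suc i) t)) (bd X b i (bd X True (Suc i) t)))"

text \<open>Globularity is carried along because boundaries of a composable pair are composable only
  if an iterated boundary does not depend on the signs of its first steps. The guards
  \<open>k = Suc j\<close> and \<open>k = Suc (Suc i)\<close> make the conditions vacuous in low
  dimensions.\<close>

definition bd_eq :: "('a, 'z) glob_scheme \<Rightarrow> nat \<Rightarrow> 'a sterm \<Rightarrow> 'a sterm \<Rightarrow> bool" where
  "bd_eq X k t u \<longleftrightarrow> (\<forall>j b. k = Suc j \<longrightarrow> term_eq X j (bd X b j t) (bd X b j u)) \<and>
     glob_term X k t \<and> glob_term X k u"

text \<open>The hypothesis of the outer induction on the dimension. The boundaries of a term need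
  not occur in its derivation, so a rule induction alone would not reach them; they do have smaller
  dimension.\<close>

definition bd_sound :: "('a, 'z) glob_scheme \<Rightarrow> nat \<Rightarrow> bool" where
  "bd_sound X k \<longleftrightarrow> (\<forall>t u. term_eq X k t u \<longrightarrow> bd_eq X k t u)"

lemma bd_soundD: "bd_sound X (Suc k) \<Longrightarrow> term_eq X (Suc k) t u \<Longrightarrow> term_eq X k (bd X b k t) (bd X b k u)"
  by (auto simp: bd_sound_def bd_eq_def)

lemma bd_sound_glob: "bd_sound X (Suc (Suc i)) \<Longrightarrow> term_eq X (Suc (Suc i)) t t \<Longrightarrow>
    term_eq X i (bd X b i (bd X c (Suc i) t)) (bd X b i (bd X c' (Suc i) t))"
  unfolding bd_sound_def bd_eq_def glob_term_def
  by (cases c; cases c') (auto intro: term_eq.sym term_eq_refl_left term_eq_refl_right)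

lemma down_bd_cong:
  assumes "\<And>k'. k' \<le> p + d \<Longrightarrow> bd_sound X k'" "term_eq X (p + d) t u"
  shows "term_eq X p (down (bd X b) p d t) (down (bd X b) p d u)"
  using assms by (induction d arbitrary: t u) (auto intro!: bd_soundD)

text \<open>The hard case of the rule induction. Composability along \<open>p\<close> has to be
  carried over to the boundaries, which succeeds because the \<open>p\<close>-dimensional source of
  a boundary of \<open>g\<close> is that of \<open>g\<close> up to \<open>term_eq\<close>, and
  likewise for the target of \<open>f\<close>.\<close>

lemma bd_eq_comp:
  assumes sound: "\<And>k'. k' < K \<Longrightarrow> bd_sound X k'"
    and p: "p < K"
    and g: "bd_eq X K g g'" and f: "bd_eq X K f f'"
    and gf: "term_eq X p (down (bd X False) p (K - p) g) (down (bd X True) p (K - p) f)"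
  shows "bd_eq X K (TComp p g f) (TComp p g' f')"
proof -
  have glob: "term_eq X i (bd X b i (bd X c (Suc i) t)) (bd X b i (bd X c' (Suc i) t))"
    if "bd_eq X K t u" "K = Suc (Suc i)" for i b c c' t u
    using that unfolding bd_eq_def glob_term_def
    by (cases c; cases c') (auto intro: term_eq.sym term_eq_refl_left term_eq_refl_right)
  have refl: "bd_eq X K t t" "bd_eq X K u u" "bd_eq X K u t" if "bd_eq X K t u" for t u
    using that by (auto simp: bd_eq_def intro: term_eq.sym term_eq_refl_left term_eq_refl_right)
  \<comment> \<open>Globularity exchanges the sign of the first step, and soundness in smaller
    dimensions lets the remaining steps follow.\<close>
  have move: "term_eq X p (down (bd X b) p (Suc d) (bd X c (p + Suc d) t))
      (down (bd X b) p (Suc d) (bd X c' (p + Suc d) t))"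
    if "bd_eq X K t t" "K = p + Suc (Suc d)" for t b c c' d
    using glob[OF that(1), of "p + d" b c c'] sound that(2) by (auto intro!: down_bd_cong)
  have down_cong: "term_eq X p (down (bd X b) p (K - p) t) (down (bd X b) p (K - p) u)"
    if "bd_eq X K t u" for t u b
  proof -
    obtain d where d: "K = p + Suc d"
      using p less_iff_Suc_add by auto
    have "term_eq X (p + d) (bd X b (p + d) t) (bd X b (p + d) u)"
      using that d by (auto simp: bd_eq_def)
    then show ?thesis
      using d sound by (auto intro!: down_bd_cong)
  qed
  have gf': "term_eq X p (down (bd X False) p (K - p) g') (down (bd X True) p (K - p) f')"
    using down_cong[OF refl(3)[OF g], of False] gf down_cong[OF f, of True]
    by (blast intro: term_eq.trans)
  have globc: "glob_term X K (TComp p g f)"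
    if g: "bd_eq X K g g" and f: "bd_eq X K f f"
      and gf: "term_eq X p (down (bd X False) p (K - p) g) (down (bd X True) p (K - p) f)" for g f
    unfolding glob_term_def
  proof (intro allI impI)
    fix i b assume K: "K = Suc (Suc i)"
    \<comment> \<open>If \<open>p = Suc i\<close>, the first boundary leaves only \<open>f\<close>
      or \<open>g\<close>, and composability links the two. If \<open>p = i\<close>, the second
      boundary does so with the same factor on both sides. If \<open>p < i\<close>, the composite
      survives both, and composability must be shown.\<close>
    consider "p = Suc i" | "p = i" | "p < i" using p K by linarith
    then show "term_eq X i (bd X b i (bd X False (Suc i) (TComp p g f)))
      (bd X b i (bd X True (Suc i) (TComp p g f)))"
    proof cases
      case 1
      have "term_eq X (Suc i) (bd X False (Suc i) g) (bd X True (Suc i) f)"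
        using gf K 1 by simp
      then have "term_eq X i (bd X b i (bd X False (Suc i) g)) (bd X b i (bd X True (Suc i) f))"
        using sound K by (auto intro: bd_soundD)
      then show ?thesis
        using 1 glob[OF g K, of b False True] glob[OF f K, of b False True]
        by simp (metis term_eq.sym term_eq.trans)
    next
      case 2
      then show ?thesis
        using glob[OF g K, of b False True] glob[OF f K, of b False True] by auto
    next
      case 3
      then obtain e where e: "i = p + Suc e" using less_iff_Suc_add by auto
      have wf: "term_eq X (Suc i) (bd X c (Suc i) t) (bd X c (Suc i) t)"
        if "bd_eq X K t t" for t c
        using that K by (auto simp: bd_eq_def)
      \<comment> \<open>The first two steps carry arbitrary signs \<open>a\<close> and
        \<open>b\<close>. Both are turned into \<open>c\<close>, by globularity of \<open>t\<close>
        and then of its boundary.\<close>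
      have all: "term_eq X p (down (bd X c) p (Suc e) (bd X b i (bd X a (Suc i) t)))
          (down (bd X c) p (K - p) t)" if t: "bd_eq X K t t" for t a c
      proof -
        have "term_eq X p (down (bd X c) p (Suc e) (bd X b i (bd X a (Suc i) t)))
            (down (bd X c) p (Suc e) (bd X b i (bd X c (Suc i) t)))"
          using glob[OF t K, of b a c] sound K e by (intro down_bd_cong) auto
        moreover have "term_eq X p (down (bd X c) p (Suc e) (bd X b i (bd X c (Suc i) t)))
            (down (bd X c) p (Suc e) (bd X c i (bd X c (Suc i) t)))"
        proof -
          have "term_eq X (p + e) (bd X c (p + e) (bd X b i (bd X c (Suc i) t)))
             (bd X c (p + e) (bd X c i (bd X c (Suc i) t)))"
            using bd_sound_glob[of X "p + e"] sound K e wf[OF t] by auto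
          then show ?thesis using sound K e by (auto intro!: down_bd_cong)
        qed
        moreover have "K - p = Suc (Suc (Suc e))" using K e by simp
        ultimately show ?thesis by (simp add: e) (meson term_eq.trans)
      qed
      have "term_eq X p (down (bd X False) p (Suc e) (bd X b i (bd X False (Suc i) g)))
         (down (bd X True) p (Suc e) (bd X b i (bd X False (Suc i) f)))"
        using all[OF g] all[OF f] gf by (blast intro: term_eq.trans term_eq.sym)
      then show ?thesis
        using 3 glob[OF g K, of b False True] glob[OF f K, of b False True] e
        by (auto intro!: term_eq.comp simp: tsrc_bd ttgt_bd)
    qed
  qed
  have "term_eq X j (bd X b j (TComp p g f)) (bd X b j (TComp p g' f'))" if K: "K = Suc j" for j b
  proof (cases "p = j")
    case True
    then show ?thesis using g f K by (auto simp: bd_eq_def)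
  next
    case False
    then obtain d where d: "j = p + Suc d" using p K less_iff_Suc_add less_SucE by auto
    have "term_eq X p (down (bd X False) p (Suc d) (bd X b j g))
        (down (bd X True) p (Suc d) (bd X b j f))"
      using move[OF refl(1)[OF g], of d False b False] move[OF refl(1)[OF f], of d True b True] gf K d
      by (auto intro: term_eq.trans term_eq.sym)
    then show ?thesis
      using g f K d by (auto intro!: term_eq.comp simp: bd_eq_def tsrc_bd ttgt_bd)
  qed
  then show ?thesis
    using globc[OF refl(1)[OF g] refl(1)[OF f] gf] globc[OF refl(2)[OF g] refl(2)[OF f] gf']
    by (auto simp: bd_eq_def)
qed

lemma bd_eq_TId_funpow:
  assumes "\<And>k'. k' < p + Suc d \<Longrightarrow> bd_sound X k'" "term_eq X p x x"
  shows "bd_eq X (p + Suc d) ((TId ^^ Suc d) x) ((TId ^^ Suc d) x)"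
proof -
  have wf: "term_eq X (p + d) ((TId ^^ d) x) ((TId ^^ d) x)"
    using assms(2) by (rule term_eq_TId_funpow)
  have "term_eq X i (bd X b i ((TId ^^ d) x)) (bd X b i ((TId ^^ d) x))"
    if "p + d = Suc i" for i b
    using assms(1)[of "Suc i"] wf that by (auto intro!: bd_soundD)
  then show ?thesis
    using wf by (auto simp: bd_eq_def glob_term_def)
qed

text \<open>The two unit laws are treated together: \<open>b\<close> says on which side the identity stands.\<close>

lemma bd_eq_unit:
  fixes b :: bool
  assumes sound: "\<And>k'. k' < K \<Longrightarrow> bd_sound X k'" and p: "p < K"
    and wf: "term_eq X K f f" and f: "bd_eq X K f f"
  defines "e \<equiv> (TId ^^ (K - p)) (down (bd X b) p (K - p) f)"
  shows "bd_eq X K (if b then TComp p e f else TComp p f e) f"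
proof -
  obtain d where d: "K = p + Suc d" using p less_iff_Suc_add by auto
  have x: "term_eq X p (down (bd X b) p (K - p) f) (down (bd X b) p (K - p) f)"
  proof -
    have "term_eq X (p + d) (bd X b (p + d) f) (bd X b (p + d) f)"
      using f d by (auto simp: bd_eq_def)
    then show ?thesis using sound d by (auto intro!: down_bd_cong)
  qed
  have e: "bd_eq X K e e"
    using bd_eq_TId_funpow[of p d X] sound x d by (simp add: e_def)
  have down_e: "down (bd X c) p (K - p) e = down (bd X b) p (K - p) f" for c
    by (simp add: e_def)
  have lhs: "bd_eq X K (if b then TComp p e f else TComp p f e) (if b then TComp p e f else TComp p f e)"
    using x by (auto intro!: bd_eq_comp[OF sound p] e f simp: down_e)
  have "term_eq X j (bd X c j (if b then TComp p e f else TComp p f e)) (bd X c j f)"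
    if K: "K = Suc j" for j c
  proof (cases "p = j")
    case True
    then have "term_eq X j (bd X c j f) (bd X c j f)" using f K by (auto simp: bd_eq_def)
    then show ?thesis using True K by (cases b; cases c) (auto simp: e_def)
  next
    case False
    then obtain d' where d': "j = p + Suc d'" using d K by (cases d) auto
    have fj: "term_eq X j (bd X c j f) (bd X c j f)" using f K by (auto simp: bd_eq_def)
    \<comment> \<open>The boundary of \<open>e\<close> is an identity on \<open>?x\<close>, reached
      through the \<open>b\<close>-boundary of \<open>f\<close>, whereas the unit law for the
      \<open>c\<close>-boundary of \<open>f\<close> asks for the identity on \<open>?y\<close>.
      Globularity identifies \<open>?x\<close> and \<open>?y\<close>.\<close>
    let ?x = "down (bd X b) p (Suc d') (bd X b j f)"
    let ?y = "down (bd X b) p (Suc d') (bd X c j f)"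
    have xy: "term_eq X p ?x ?y"
    proof -
      have "term_eq X (p + d') (bd X b (p + d') (bd X b j f)) (bd X b (p + d') (bd X c j f))"
        using f K d' unfolding bd_eq_def glob_term_def
        by (cases b; cases c) (auto intro: term_eq.sym term_eq_refl_left term_eq_refl_right)
      then show ?thesis using sound K d' by (auto intro!: down_bd_cong)
    qed
    have cong: "term_eq X j ((TId ^^ Suc d') ?x) ((TId ^^ Suc d') ?y)"
      using term_eq_TId_funpow[OF xy, of "Suc d'"] d' by simp
    have e': "bd X c j e = (TId ^^ Suc d') ?x"
      using d' K by (simp add: e_def)
    show ?thesis
    proof (cases b)
      case True
      have "term_eq X j (TComp p ((TId ^^ Suc d') ?x) (bd X c j f))
          (TComp p ((TId ^^ Suc d') ?y) (bd X c j f))"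
        using cong fj xy d' True
        by (auto intro!: term_eq.comp simp: tsrc_bd ttgt_bd simp del: funpow.simps down.simps)
      moreover have "term_eq X j (TComp p ((TId ^^ Suc d') ?y) (bd X c j f)) (bd X c j f)"
        using term_eq.unit_left[of p j X, OF _ fj] d' True by (simp add: ttgt_bd)
      ultimately show ?thesis
        using True False by (simp add: e' del: funpow.simps down.simps) (meson term_eq.trans)
    next
      case bF: False
      have "term_eq X j (TComp p (bd X c j f) ((TId ^^ Suc d') ?x))
          (TComp p (bd X c j f) ((TId ^^ Suc d') ?y))"
        using cong fj term_eq.sym[OF xy] d' bF
        by (auto intro!: term_eq.comp simp: tsrc_bd ttgt_bd simp del: funpow.simps down.simps)
      moreover have "term_eq X j (TComp p (bd X c j f) ((TId ^^ Suc d') ?y)) (bd X c j f)"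
        using term_eq.unit_right[of p j X, OF _ fj] d' bF by (simp add: tsrc_bd)
      ultimately show ?thesis
        using bF False by (simp add: e' del: funpow.simps down.simps) (meson term_eq.trans)
    qed
  qed
  then show ?thesis
    using lhs f by (auto simp: bd_eq_def)
qed

lemma term_eq_bd_eq:
  assumes X: "globular_set X" and "term_eq X k t u" and "\<And>k'. k' < k \<Longrightarrow> bd_sound X k'"
  shows "bd_eq X k t u"
  using assms(2,3)
proof (induction rule: term_eq.induct)
  case (gen x k)
  have bd: "bd_eq X k (TGen x) (TGen x)" if "x \<in> cells X k"
  proof -
    have "src X j x \<in> cells X j" "tgt X j x \<in> cells X j" if "x \<in> cells X (Suc j)" for j x
      using X that by (auto simp: globular_set_def)
    then show ?thesis
      using X that by (auto simp: bd_eq_def glob_term_def globular_set_def intro!: term_eq.gen)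
  qed
  then show ?case using gen by blast
next
  case (ident k t u)
  then have "term_eq X k t t" "term_eq X k u u"
    using term_eq_refl_left term_eq_refl_right by blast+
  with ident show ?case
    by (auto simp: bd_eq_def glob_term_def intro: bd_soundD)
next
  case (comp p k g g' f f')
  then show ?case by (auto intro!: bd_eq_comp simp: tsrc_bd ttgt_bd)
next
  case (sym k t u)
  then show ?case by (auto simp: bd_eq_def intro: term_eq.sym)
next
  case (trans k t u v)
  have "bd_eq X k t u" "bd_eq X k u v"
    using trans.IH trans.prems by blast+
  then show ?case unfolding bd_eq_def using term_eq.trans by blast
next
  case (assoc k p h g f)
  then have "p < k" using term_eq_comp_less by blast
  note ih = assoc.IH(1)[OF assoc.prems] assoc.IH(2)[OF assoc.prems]
  have "term_eq X j (bd X b j (TComp p h (TComp p g f))) (bd X b j (TComp p (TComp p h g) f))"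
    if "k = Suc j" for j b
  proof -
    have w: "term_eq X j (bd X b j (TComp p h (TComp p g f))) (bd X b j (TComp p h (TComp p g f)))"
      "term_eq X j (bd X b j (TComp p (TComp p h g) f)) (bd X b j (TComp p (TComp p h g) f))"
      using ih that by (auto simp: bd_eq_def)
    \<comment> \<open>At \<open>p = j\<close> both bracketings reduce to the boundary of the same
      outer factor; otherwise the composites survive and the law is applied one dimension
      down.\<close>
    then show ?thesis
      by (cases "p = j"; cases b) (auto intro: term_eq.assoc)
  qed
  then show ?case using ih by (auto simp: bd_eq_def)
next
  case (unit_left p k f)
  then show ?case using bd_eq_unit[of k X p f True] by (simp add: ttgt_bd)
next
  case (unit_right p k f)
  then show ?case using bd_eq_unit[of k X p f False] by (simp add: tsrc_bd)
next
  case (interchange p q k g' g f' f)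
  note ih = interchange.IH(1)[OF interchange.prems] interchange.IH(2)[OF interchange.prems]
  have "term_eq X j (bd X b j (TComp p (TComp q g' g) (TComp q f' f)))
      (bd X b j (TComp q (TComp p g' f') (TComp p g f)))"
    if "k = Suc j" for j b
  proof -
    have w: "term_eq X j (bd X b j (TComp p (TComp q g' g) (TComp q f' f)))
        (bd X b j (TComp p (TComp q g' g) (TComp q f' f)))"
      "term_eq X j (bd X b j (TComp q (TComp p g' f') (TComp p g f)))
        (bd X b j (TComp q (TComp p g' f') (TComp p g f)))"
      using ih that by (auto simp: bd_eq_def)
    \<comment> \<open>At \<open>q = j\<close> the boundary selects one pair out of the square, and
      both sides become the same composite along \<open>p\<close>. Otherwise the whole square
      survives.\<close>
    show ?thesis
    proof (cases "q = j")
      case True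
      then show ?thesis using w interchange.hyps by (cases b) auto
    next
      case False
      then have "q < j" using interchange.hyps that by auto
      then show ?thesis using w interchange.hyps by (auto intro: term_eq.interchange)
    qed
  qed
  then show ?case using ih by (auto simp: bd_eq_def)
next
  case (ident_comp k p g f)
  then have p: "p < k" using term_eq_comp_less by blast
  have "term_eq X i (bd X b i (TComp p g f)) (bd X b i (TComp p g f))" if "k = Suc i" for i b
    using ident_comp.prems[of k] ident_comp.hyps that bd_soundD by blast
  then show ?case
    using ident_comp.hyps p by (auto simp: bd_eq_def glob_term_def)
qed

lemma bd_sound: "globular_set X \<Longrightarrow> bd_sound X k"
  by (induction k rule: less_induct) (auto simp: bd_sound_def[of X] intro: term_eq_bd_eq)

lemma term_eq_bd: "globular_set X \<Longrightarrow> term_eq X (Suc k) t u \<Longrightarrow> term_eq X k (bd X b k t) (bd X b k u)"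
  by (rule bd_soundD[OF bd_sound])

lemma term_eq_bd_bd: "globular_set X \<Longrightarrow> term_eq X (Suc (Suc i)) t t \<Longrightarrow>
    term_eq X i (bd X b i (bd X c (Suc i) t)) (bd X b i (bd X c' (Suc i) t))"
  by (rule bd_sound_glob[OF bd_sound])

lemma term_eq_down: "globular_set X \<Longrightarrow> term_eq X (p + d) t u \<Longrightarrow>
    term_eq X p (down (bd X b) p d t) (down (bd X b) p d u)"
  by (rule down_bd_cong[OF bd_sound])

section \<open>Inversion of well-formedness\<close>

primrec term_wf :: "('a, 'z) glob_scheme \<Rightarrow> nat \<Rightarrow> 'a sterm \<Rightarrow> bool" where
  "term_wf X k (TGen x) \<longleftrightarrow> x \<in> cells X k"
| "term_wf X k (TId t) \<longleftrightarrow> (\<exists>j. k = Suc j \<and> term_eq X j t t)"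
| "term_wf X k (TComp p g f) \<longleftrightarrow> p < k \<and> term_eq X k g g \<and> term_eq X k f f \<and>
     term_eq X p (down (bd X False) p (k - p) g) (down (bd X True) p (k - p) f)"

lemma term_wf_refl: "term_wf X k t \<Longrightarrow> term_eq X k t t"
  by (cases t) (auto intro: term_eq.gen term_eq.ident term_eq.comp simp: tsrc_bd ttgt_bd)

text \<open>A derivation of \<open>term_eq X k t t\<close> may pass through \<open>sym\<close>,
  \<open>trans\<close> and the laws, so rule inversion tells nothing about the outermost constructor
  of \<open>t\<close>. Instead every rule is checked to make both of its sides satisfy
  \<open>term_wf\<close>.\<close>

lemma term_eq_term_wf:
  assumes X: "globular_set X" and "term_eq X k t u"
  shows "term_wf X k t \<and> term_wf X k u"
  using assms(2)
proof (induction rule: term_eq.induct)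
  case (ident k t u)
  then show ?case using term_eq_refl_left[OF ident.hyps] term_eq_refl_right[OF ident.hyps] by simp
next
  case (comp p k g g' f f')
  then obtain d where d: "k = p + d" using less_imp_add_positive by blast
  \<comment> \<open>The rule records composability for \<open>g\<close> and \<open>f\<close> only.
    Its transfer to \<open>g'\<close> and \<open>f'\<close> needs congruence of iterated
    boundaries.\<close>
  have "term_eq X p (down (bd X False) p (k - p) g') (down (bd X True) p (k - p) f')"
  proof (rule term_eq.trans[OF _ term_eq.trans])
    show "term_eq X p (down (bd X False) p (k - p) g') (down (bd X False) p (k - p) g)"
      using term_eq.sym[OF term_eq_down[OF X, of p d g g' False]] comp.hyps d by simp
    show "term_eq X p (down (bd X False) p (k - p) g) (down (bd X True) p (k - p) f)"
      using comp.hyps by (simp add: tsrc_bd ttgt_bd)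
    show "term_eq X p (down (bd X True) p (k - p) f) (down (bd X True) p (k - p) f')"
      using term_eq_down[OF X, of p d f f' True] comp.hyps d by simp
  qed
  then show ?case
    using comp.hyps term_eq_refl_left[OF comp.hyps(2)] term_eq_refl_right[OF comp.hyps(2)]
      term_eq_refl_left[OF comp.hyps(3)] term_eq_refl_right[OF comp.hyps(3)]
    by (simp add: tsrc_bd ttgt_bd)
next
  case (unit_left p k f)
  then obtain d where d: "k = p + d" using less_imp_add_positive by blast
  have x: "term_eq X p (down (bd X True) p d f) (down (bd X True) p d f)"
    using unit_left.hyps d term_eq_down[OF X, of p d f f] by simp
  then show ?case using unit_left.hyps unit_left.IH d term_eq_TId_funpow[OF x, of d] by (simp add: ttgt_bd)
next
  case (unit_right p k f)
  then obtain d where d: "k = p + d" using less_imp_add_positive by blast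
  have x: "term_eq X p (down (bd X False) p d f) (down (bd X False) p d f)"
    using unit_right.hyps d term_eq_down[OF X, of p d f f] by simp
  then show ?case using unit_right.hyps unit_right.IH d term_eq_TId_funpow[OF x, of d] by (simp add: tsrc_bd)
next
  case (ident_comp k p g f)
  have "term_eq X (Suc k) (TId t) (TId t)" if "term_eq X k t t" for t
    using that by (rule term_eq.ident)
  with ident_comp.IH ident_comp.hyps show ?case by (simp add: Suc_diff_le)
next
  case (gen x k)
  then show ?case by simp
next
  case (sym k t u)
  from sym.IH show ?case by (rule conj_commute[THEN iffD1])
next
  case (trans k t u v)
  show ?case by (rule conjI[OF conjunct1[OF trans.IH(1)] conjunct2[OF trans.IH(2)]])
next
  case (assoc k p h g f)
  show ?case by (rule conjI[OF conjunct1[OF assoc.IH(1)] conjunct1[OF assoc.IH(2)]])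
next
  case (interchange p q k g' g f' f)
  show ?case by (rule conjI[OF conjunct1[OF interchange.IH(1)] conjunct1[OF interchange.IH(2)]])
qed

lemma term_eq_TComp_iff:
  assumes "globular_set X"
  shows "term_eq X k (TComp p g f) (TComp p g f) \<longleftrightarrow> p < k \<and> term_eq X k g g \<and> term_eq X k f f \<and>
     term_eq X p (down (bd X False) p (k - p) g) (down (bd X True) p (k - p) f)"
proof
  assume "term_eq X k (TComp p g f) (TComp p g f)"
  from conjunct1[OF term_eq_term_wf[OF assms this]]
  show "p < k \<and> term_eq X k g g \<and> term_eq X k f f \<and>
     term_eq X p (down (bd X False) p (k - p) g) (down (bd X True) p (k - p) f)"
    by (simp only: term_wf.simps)
qed (simp add: term_wf_refl)

section \<open>Substitution\<close>

text \<open>Generators are replaced by terms, not merely by generators, so that the functor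
  (\<open>term_map_subst\<close>) and the multiplication (\<open>term_eval_subst\<close>) are both
  instances and soundness is proved once.\<close>

primrec term_subst :: "(nat \<Rightarrow> 'a \<Rightarrow> 'b sterm) \<Rightarrow> nat \<Rightarrow> 'a sterm \<Rightarrow> 'b sterm" where
  "term_subst \<psi> k (TGen x) = \<psi> k x"
| "term_subst \<psi> k (TId t) = TId (term_subst \<psi> (k - 1) t)"
| "term_subst \<psi> k (TComp p u v) = TComp p (term_subst \<psi> k u) (term_subst \<psi> k v)"

lemma term_map_subst: "term_map f k t = term_subst (\<lambda>k x. TGen (f k x)) k t"
  by (induction t arbitrary: k) auto

lemma term_subst_TId_funpow:
  "term_subst \<psi> (p + d) ((TId ^^ d) t) = (TId ^^ d) (term_subst \<psi> p t)"
  by (induction d) auto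

text \<open>Boundaries are respected only up to \<open>term_eq\<close>: in the application to
  \<open>rep\<close>, representatives in neighbouring dimensions are chosen independently of each
  other.\<close>

definition subst_ok ::
  "('a, 'y) glob_scheme \<Rightarrow> ('b, 'z) glob_scheme \<Rightarrow> (nat \<Rightarrow> 'a \<Rightarrow> 'b sterm) \<Rightarrow> bool" where
  "subst_ok X Y \<psi> \<longleftrightarrow>
     (\<forall>k. \<forall>x \<in> cells X k. term_eq Y k (\<psi> k x) (\<psi> k x)) \<and>
     (\<forall>k b. \<forall>x \<in> cells X (Suc k).
        term_eq Y k (bd Y b k (\<psi> (Suc k) x)) (\<psi> k ((if b then tgt X else src X) k x)))"

locale substitution =
  fixes X :: "('a, 'y) glob_scheme" and Y :: "('b, 'z) glob_scheme" and \<psi> :: "nat \<Rightarrow> 'a \<Rightarrow> 'b sterm"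
  assumes X: "globular_set X" and Y: "globular_set Y" and \<psi>: "subst_ok X Y \<psi>"
begin

abbreviation "S \<equiv> term_subst \<psi>"

definition bd_comm :: "nat \<Rightarrow> 'a sterm \<Rightarrow> bool" where
  "bd_comm k t \<longleftrightarrow> (\<forall>j b. k = Suc j \<longrightarrow> term_eq Y j (bd Y b j (S k t)) (S j (bd X b j t)))"

text \<open>As in \<open>bd_eq\<close>, compatibility with boundaries belongs to the induction
  statement, because composability of substituted terms speaks about their iterated
  boundaries.\<close>

definition subst_eq :: "nat \<Rightarrow> 'a sterm \<Rightarrow> 'a sterm \<Rightarrow> bool" where
  "subst_eq k t u \<longleftrightarrow> term_eq Y k (S k t) (S k u) \<and> bd_comm k t \<and> bd_comm k u"

definition sound :: "nat \<Rightarrow> bool" where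
  "sound k \<longleftrightarrow> (\<forall>t u. term_eq X k t u \<longrightarrow> subst_eq k t u)"

lemma subst_eq_refl: "subst_eq k t u \<Longrightarrow> subst_eq k t t" "subst_eq k t u \<Longrightarrow> subst_eq k u u"
  by (auto simp: subst_eq_def intro: term_eq_refl_left term_eq_refl_right)

text \<open>Only the first step uses \<open>bd_comm\<close> for \<open>t\<close> itself; the later
  ones concern boundaries of \<open>t\<close>, for which soundness in smaller dimensions provides
  it.\<close>

lemma down_subst:
  assumes "\<And>k'. k' < p + d \<Longrightarrow> sound k'" "bd_comm (p + d) t" "term_eq X (p + d) t t"
    "term_eq Y (p + d) (S (p + d) t) (S (p + d) t)"
  shows "term_eq Y p (down (bd Y b) p d (S (p + d) t)) (S p (down (bd X b) p d t))"
  using assms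
proof (induction d arbitrary: t)
  case 0
  then show ?case by simp
next
  case (Suc d)
  have w: "term_eq X (p + d) (bd X b (p + d) t) (bd X b (p + d) t)"
    using Suc.prems by (auto intro: term_eq_bd[OF X])
  then have s: "subst_eq (p + d) (bd X b (p + d) t) (bd X b (p + d) t)"
    using Suc.prems(1)[of "p + d"] by (simp add: sound_def)
  then have ih: "term_eq Y p (down (bd Y b) p d (S (p + d) (bd X b (p + d) t)))
      (S p (down (bd X b) p d (bd X b (p + d) t)))"
    using Suc.IH[of "bd X b (p + d) t"] Suc.prems(1) w by (auto simp: subst_eq_def)
  have "term_eq Y (p + d) (bd Y b (p + d) (S (p + Suc d) t)) (S (p + d) (bd X b (p + d) t))"
    using Suc.prems(2) by (auto simp: bd_comm_def)
  then have "term_eq Y p (down (bd Y b) p d (bd Y b (p + d) (S (p + Suc d) t)))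
      (down (bd Y b) p d (S (p + d) (bd X b (p + d) t)))"
    by (rule term_eq_down[OF Y])
  then show ?case using ih by (simp, meson term_eq.trans)
qed

lemma subst_eq_comp:
  assumes sound: "\<And>k'. k' < K \<Longrightarrow> sound k'" and p: "p < K"
    and wf: "term_eq X K (TComp p g f) (TComp p g f)"
      "term_eq X K (TComp p g' f') (TComp p g' f')"
    and g: "subst_eq K g g'" and f: "subst_eq K f f'"
  shows "subst_eq K (TComp p g f) (TComp p g' f')"
proof -
  obtain d where d: "K = p + Suc d" using p less_iff_Suc_add by auto
  have composable: "term_eq Y p (down (bd Y False) p (K - p) (S K g)) (down (bd Y True) p (K - p) (S K f))"
    if "subst_eq K g g" "subst_eq K f f" "term_eq X K (TComp p g f) (TComp p g f)" for g f
  proof -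
    have h: "term_eq X K g g" "term_eq X K f f"
      "term_eq X p (down (bd X False) p (K - p) g) (down (bd X True) p (K - p) f)"
      using that(3) unfolding term_eq_TComp_iff[OF X] by auto
    \<comment> \<open>Soundness in dimension \<open>p < K\<close> applies the substitution to
      composability itself; \<open>down_subst\<close> then moves it inside the boundaries.\<close>
    have "term_eq Y p (S p (down (bd X False) p (K - p) g)) (S p (down (bd X True) p (K - p) f))"
      using h(3) sound[OF p] by (auto simp: sound_def subst_eq_def)
    then show ?thesis
      using down_subst[of p "Suc d" g False] down_subst[of p "Suc d" f True] sound d that h(1,2)
      by (auto simp: subst_eq_def simp del: down.simps) (meson term_eq.trans term_eq.sym)
  qed
  have main: "term_eq Y K (TComp p (S K g) (S K f)) (TComp p (S K g') (S K f'))"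
    using p g f composable[OF subst_eq_refl(1)[OF g] subst_eq_refl(1)[OF f] wf(1)]
    by (auto intro!: term_eq.comp simp: subst_eq_def tsrc_bd ttgt_bd)
  have comm: "bd_comm K (TComp p g f)"
    if g: "subst_eq K g g" and f: "subst_eq K f f"
      and wf: "term_eq Y K (TComp p (S K g) (S K f)) (TComp p (S K g) (S K f))" for g f
    unfolding bd_comm_def
  proof (intro allI impI)
    fix j b assume K: "K = Suc j"
    show "term_eq Y j (bd Y b j (S K (TComp p g f))) (S j (bd X b j (TComp p g f)))"
    proof (cases "p = j")
      case True
      then show ?thesis using g f K by (auto simp: subst_eq_def bd_comm_def)
    next
      case False
      \<comment> \<open>The substituted composite is already well-formed in \<open>Y\<close>, so
        composability of its boundaries is read off from its boundary instead of being
        computed.\<close>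
      have "term_eq Y j (TComp p (bd Y b j (S K g)) (bd Y b j (S K f)))
         (TComp p (bd Y b j (S K g)) (bd Y b j (S K f)))"
        using term_eq_bd[OF Y wf[unfolded K], of b] False K by simp
      then have "term_eq Y j (TComp p (bd Y b j (S K g)) (bd Y b j (S K f)))
         (TComp p (S j (bd X b j g)) (S j (bd X b j f)))"
        using g f K unfolding term_eq_TComp_iff[OF Y]
        by (auto intro!: term_eq.comp simp: subst_eq_def bd_comm_def tsrc_bd ttgt_bd)
      then show ?thesis using False by simp
    qed
  qed
  show ?thesis
    unfolding subst_eq_def
    using main comm[OF subst_eq_refl(1)[OF g] subst_eq_refl(1)[OF f] term_eq_refl_left[OF main]]
      comm[OF subst_eq_refl(2)[OF g] subst_eq_refl(2)[OF f] term_eq_refl_right[OF main]]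
    by simp
qed

lemma subst_eq_unit:
  fixes b :: bool
  assumes sound: "\<And>k'. k' < K \<Longrightarrow> sound k'" and p: "p < K"
    and wf: "term_eq X K f f" and f: "subst_eq K f f"
  defines "e \<equiv> (TId ^^ (K - p)) (down (bd X b) p (K - p) f)"
  shows "subst_eq K (if b then TComp p e f else TComp p f e) f"
proof -
  obtain d where d: "K = p + Suc d" using p less_iff_Suc_add by auto
  let ?x = "down (bd X b) p (K - p) f"
  let ?y = "down (bd Y b) p (K - p) (S K f)"
  let ?u = "if b then TComp p e f else TComp p f e"
  have x: "term_eq X p ?x ?x"
    using term_eq_down[OF X, of p "Suc d" f f b] wf d by simp
  have Sx: "term_eq Y p (S p ?x) (S p ?x)"
    using x sound[OF p] by (auto simp: sound_def subst_eq_def)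
  \<comment> \<open>After substitution the identity stands on \<open>S p ?x\<close>, but the unit
    law in \<open>Y\<close> wants it on \<open>?y\<close>, the boundary of the substituted
    term.\<close>
  have yx: "term_eq Y p ?y (S p ?x)"
    using down_subst[of p "Suc d" f b] sound d wf f by (auto simp: subst_eq_def)
  have SKf: "term_eq Y K (S K f) (S K f)" using f by (simp add: subst_eq_def)
  have Se: "S K e = (TId ^^ (K - p)) (S p ?x)"
    using term_subst_TId_funpow[of \<psi> p "K - p"] p by (simp add: e_def)
  have "bd_comm K e"
  proof -
    have "term_eq Y (p + d) (S (p + d) ((TId ^^ d) ?x)) (S (p + d) ((TId ^^ d) ?x))"
      unfolding term_subst_TId_funpow using Sx by (rule term_eq_TId_funpow)
    then show ?thesis using d by (auto simp: bd_comm_def e_def)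
  qed
  then have e: "subst_eq K e e"
    using term_eq_TId_funpow[OF Sx, of "K - p"] p by (simp add: subst_eq_def Se)
  have u: "term_eq X K ?u ?u"
    using term_eq_refl_left[OF term_eq.unit_left[OF p wf]] term_eq_refl_left[OF term_eq.unit_right[OF p wf]]
    by (simp add: e_def tsrc_bd ttgt_bd)
  have uu: "subst_eq K ?u ?u"
    using u subst_eq_comp[OF sound p _ _ e f] subst_eq_comp[OF sound p _ _ f e] by (cases b) simp_all
  have cong: "term_eq Y K ((TId ^^ (K - p)) (S p ?x)) ((TId ^^ (K - p)) ?y)"
    using term_eq_TId_funpow[OF term_eq.sym[OF yx], of "K - p"] p by simp
  have "term_eq Y K (S K ?u) (S K f)"
  proof (cases b)
    case True
    have "term_eq Y K (TComp p ((TId ^^ (K - p)) (S p ?x)) (S K f))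
        (TComp p ((TId ^^ (K - p)) ?y) (S K f))"
      using term_eq.sym[OF yx] True
      by (intro term_eq.comp[OF p cong SKf]) (simp add: tsrc_bd ttgt_bd)
    moreover have "term_eq Y K (TComp p ((TId ^^ (K - p)) ?y) (S K f)) (S K f)"
      using term_eq.unit_left[OF p SKf] True by (simp add: ttgt_bd)
    ultimately show ?thesis using True by (simp add: Se) (meson term_eq.trans)
  next
    case False
    have "term_eq Y K (TComp p (S K f) ((TId ^^ (K - p)) (S p ?x)))
        (TComp p (S K f) ((TId ^^ (K - p)) ?y))"
      using yx False
      by (intro term_eq.comp[OF p SKf cong]) (simp add: tsrc_bd ttgt_bd)
    moreover have "term_eq Y K (TComp p (S K f) ((TId ^^ (K - p)) ?y)) (S K f)"
      using term_eq.unit_right[OF p SKf] False by (simp add: tsrc_bd)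
    ultimately show ?thesis using False by (simp add: Se) (meson term_eq.trans)
  qed
  then show ?thesis using uu f by (simp add: subst_eq_def)
qed

lemma term_eq_subst_eq:
  assumes "term_eq X k t u" and "\<And>k'. k' < k \<Longrightarrow> sound k'"
  shows "subst_eq k t u"
  using assms
proof (induction rule: term_eq.induct)
  case (gen x k)
  then have "term_eq Y k (\<psi> k x) (\<psi> k x)" using \<psi> by (simp add: subst_ok_def)
  moreover have "term_eq Y j (bd Y b j (\<psi> (Suc j) x)) (\<psi> j ((if b then tgt X else src X) j x))"
    if "k = Suc j" for j b
    using \<psi> gen that unfolding subst_ok_def by blast
  ultimately show ?case by (simp add: subst_eq_def bd_comm_def)
next
  case (ident k t u)
  then have s: "subst_eq k t u" by simp
  then show ?case using subst_eq_refl[OF s]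
    by (simp add: subst_eq_def bd_comm_def term_eq.ident)
next
  case (comp p k g g' f f')
  have w: "term_eq X k (TComp p g f) (TComp p g' f')" by (rule term_eq.comp) (use comp in simp_all)
  have "subst_eq k g g'" "subst_eq k f f'" using comp.IH comp.prems by blast+
  then show ?case
    using subst_eq_comp[of k p g f g' f'] comp.prems comp.hyps(1) term_eq_refl_left[OF w]
      term_eq_refl_right[OF w] by blast
next
  case (sym k t u)
  then have "subst_eq k t u" by blast
  then show ?case by (simp add: subst_eq_def term_eq.sym)
next
  case (trans k t u v)
  have "subst_eq k t u" "subst_eq k u v"
    using trans.IH trans.prems by blast+
  then show ?case unfolding subst_eq_def using term_eq.trans by blast
next
  case (assoc k p h g f)
  have "subst_eq k (TComp p h (TComp p g f)) (TComp p h (TComp p g f))"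
    "subst_eq k (TComp p (TComp p h g) f) (TComp p (TComp p h g) f)"
    using assoc.IH assoc.prems by blast+
  then show ?case by (simp add: subst_eq_def term_eq.assoc)
next
  case (unit_left p k f)
  then show ?case using subst_eq_unit[of k p f True] by (simp add: ttgt_bd)
next
  case (unit_right p k f)
  then show ?case using subst_eq_unit[of k p f False] by (simp add: tsrc_bd)
next
  case (interchange p q k g' g f' f)
  have "subst_eq k (TComp p (TComp q g' g) (TComp q f' f)) (TComp p (TComp q g' g) (TComp q f' f))"
    "subst_eq k (TComp q (TComp p g' f') (TComp p g f)) (TComp q (TComp p g' f') (TComp p g f))"
    using interchange.IH interchange.prems by blast+
  then show ?case using interchange.hyps by (simp add: subst_eq_def term_eq.interchange)
next
  case (ident_comp k p g f)
  then have p: "p < k" using term_eq_comp_less by blast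
  have "subst_eq k (TComp p g f) (TComp p g f)" using ident_comp by simp
  then have w: "term_eq Y k (TComp p (S k g) (S k f)) (TComp p (S k g) (S k f))"
    by (simp add: subst_eq_def)
  then show ?case
    using p term_eq.ident_comp[OF w] by (auto simp: subst_eq_def bd_comm_def)
qed

lemma sound: "sound k"
proof (induction k rule: less_induct)
  case (less k)
  then have "subst_eq k t u" if "term_eq X k t u" for t u
    using term_eq_subst_eq that by blast
  then show ?case by (simp add: sound_def)
qed

lemma term_eq_subst: "term_eq X k t u \<Longrightarrow> term_eq Y k (S k t) (S k u)"
  using sound by (auto simp: sound_def subst_eq_def)

lemma bd_subst: "term_eq X (Suc k) t t \<Longrightarrow> term_eq Y k (bd Y b k (S (Suc k) t)) (S k (bd X b k t))"
  using sound by (auto simp: sound_def subst_eq_def bd_comm_def)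

end

section \<open>The free strict omega-category\<close>

lemma tclass_cong: "term_eq X k t u \<Longrightarrow> tclass X k t = tclass X k u"
  unfolding tclass_def using term_eq.sym term_eq.trans by blast

lemma tclass_eqD: "term_eq X k u u \<Longrightarrow> tclass X k t = tclass X k u \<Longrightarrow> term_eq X k t u"
  by (auto simp: tclass_def)

text \<open>Operations on classes are unions over representatives. They take the intended value as
  soon as the class computed from a representative does not depend on the choice.\<close>

lemma UN_tclass:
  assumes "term_eq X k t t" "\<And>u. term_eq X k t u \<Longrightarrow> F u = F t"
  shows "(\<Union>u\<in>tclass X k t. F u) = F t"
proof -
  have "F u = F t" if "u \<in> tclass X k t" for u
    using that by (intro assms(2)) (simp add: tclass_def)
  moreover have "t \<in> tclass X k t" using assms(1) by (simp add: tclass_def)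
  ultimately show ?thesis by blast
qed

lemma Tfree_cells: "cells (Tfree X) k = {tclass X k t | t. term_eq X k t t}"
  by (simp add: Tfree_def)

lemma tclass_in_Tfree: "term_eq X k t t \<Longrightarrow> tclass X k t \<in> cells (Tfree X) k"
  by (auto simp: Tfree_cells)

lemma Tfree_cellE:
  assumes "c \<in> cells (Tfree X) k"
  obtains t where "c = tclass X k t" "term_eq X k t t"
  using assms by (auto simp: Tfree_cells)

lemma bd_tclass:
  assumes "globular_set X" "term_eq X (Suc k) t t"
  shows "(if b then tgt else src) (Tfree X) k (tclass X (Suc k) t) = tclass X k (bd X b k t)"
proof -
  have "tclass X k (bd X b k u) = tclass X k (bd X b k t)" if "term_eq X (Suc k) t u" for u
    by (rule tclass_cong[OF term_eq_bd[OF assms(1) term_eq.sym[OF that]]])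
  then have "(\<Union>u\<in>tclass X (Suc k) t. tclass X k (bd X b k u)) = tclass X k (bd X b k t)"
    by (intro UN_tclass assms(2))
  then show ?thesis by (cases b) (auto simp: Tfree_def tsrc_bd ttgt_bd)
qed

lemma src_tclass: "globular_set X \<Longrightarrow> term_eq X (Suc k) t t \<Longrightarrow>
    src (Tfree X) k (tclass X (Suc k) t) = tclass X k (bd X False k t)"
  and tgt_tclass: "globular_set X \<Longrightarrow> term_eq X (Suc k) t t \<Longrightarrow>
    tgt (Tfree X) k (tclass X (Suc k) t) = tclass X k (bd X True k t)"
  using bd_tclass[of X k t False] bd_tclass[of X k t True] by simp_all

lemma tid_tclass:
  assumes "term_eq X k t t"
  shows "tid X k (tclass X k t) = tclass X (Suc k) (TId t)"
  unfolding tid_def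
  by (intro UN_tclass assms tclass_cong term_eq.ident) (rule term_eq.sym)

lemma tcomp_tclass:
  assumes X: "globular_set X" and wf: "term_eq X k (TComp p g f) (TComp p g f)"
  shows "tcomp X k p (tclass X k g) (tclass X k f) = tclass X k (TComp p g f)"
proof -
  have h: "p < k" "term_eq X k g g" "term_eq X k f f"
     "term_eq X p (down (bd X False) p (k - p) g) (down (bd X True) p (k - p) f)"
    using wf unfolding term_eq_TComp_iff[OF X] by simp_all
  have eq: "tclass X k (TComp p u v) = tclass X k (TComp p g f)"
    if "term_eq X k g u" "term_eq X k f v" for u v
  proof (rule tclass_cong[OF term_eq.sym], rule term_eq.comp[OF h(1) that])
    show "term_eq X p (down (tsrc X) p (k - p) g) (down (ttgt X) p (k - p) f)"
      using h(4) by (simp add: tsrc_bd ttgt_bd)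
  qed
  have "(\<Union>v\<in>tclass X k f. tclass X k (TComp p u v)) = tclass X k (TComp p g f)"
    if "term_eq X k g u" for u
    using UN_tclass[OF h(3), of "\<lambda>v. tclass X k (TComp p u v)"] eq[OF that] h(3) by simp
  then show ?thesis
    unfolding tcomp_def using UN_tclass[OF h(2), of "\<lambda>u. \<Union>v\<in>tclass X k f. tclass X k (TComp p u v)"] h(2)
    by simp
qed

lemma globular_Tfree:
  assumes X: "globular_set X"
  shows "globular_set (Tfree X)"
  unfolding globular_set_def
proof (intro conjI allI ballI)
  fix k c assume "c \<in> cells (Tfree X) (Suc k)"
  then obtain t where t: "c = tclass X (Suc k) t" "term_eq X (Suc k) t t"
    by (rule Tfree_cellE)
  then show "src (Tfree X) k c \<in> cells (Tfree X) k" "tgt (Tfree X) k c \<in> cells (Tfree X) k"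
    using term_eq_bd[OF X t(2)] by (auto simp: src_tclass tgt_tclass X intro!: tclass_in_Tfree)
next
  fix k c assume "c \<in> cells (Tfree X) (Suc (Suc k))"
  then obtain t where t: "c = tclass X (Suc (Suc k)) t" "term_eq X (Suc (Suc k)) t t"
    by (rule Tfree_cellE)
  have wf: "term_eq X (Suc k) (bd X b (Suc k) t) (bd X b (Suc k) t)" for b
    by (rule term_eq_bd[OF X t(2)])
  show "src (Tfree X) k (src (Tfree X) (Suc k) c) = src (Tfree X) k (tgt (Tfree X) (Suc k) c)"
    "tgt (Tfree X) k (src (Tfree X) (Suc k) c) = tgt (Tfree X) k (tgt (Tfree X) (Suc k) c)"
    using t wf by (simp_all add: src_tclass tgt_tclass X tclass_cong[OF term_eq_bd_bd[OF X t(2)]])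
qed

lemma tunit_cell: "x \<in> cells X k \<Longrightarrow> tunit X k x \<in> cells (Tfree X) k"
  by (auto simp: tunit_def intro!: tclass_in_Tfree term_eq.gen)

lemma tunit_bd:
  assumes "globular_set X" "x \<in> cells X (Suc k)"
  shows "src (Tfree X) k (tunit X (Suc k) x) = tunit X k (src X k x)"
    "tgt (Tfree X) k (tunit X (Suc k) x) = tunit X k (tgt X k x)"
  using assms by (simp_all add: tunit_def src_tclass tgt_tclass term_eq.gen)

lemma tid_cell: "c \<in> cells (Tfree X) k \<Longrightarrow> tid X k c \<in> cells (Tfree X) (Suc k)"
  by (erule Tfree_cellE) (simp add: tid_tclass tclass_in_Tfree term_eq.ident)

lemma tid_bd:
  assumes "globular_set X" "c \<in> cells (Tfree X) k"
  shows "src (Tfree X) k (tid X k c) = c" "tgt (Tfree X) k (tid X k c) = c"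
  using assms(2) by (auto elim!: Tfree_cellE simp: tid_tclass src_tclass tgt_tclass assms(1) term_eq.ident)

text \<open>Gluing in codimension one is the case that \<open>wcomp\<close> needs. Here equality of
  boundary classes is exactly composability of the representatives.\<close>

lemma tcomp_wf:
  assumes X: "globular_set X" and "d \<in> cells (Tfree X) (Suc k)" "c \<in> cells (Tfree X) (Suc k)"
    and "src (Tfree X) k d = tgt (Tfree X) k c"
  obtains g f where "d = tclass X (Suc k) g" "c = tclass X (Suc k) f"
    "term_eq X (Suc k) g g" "term_eq X (Suc k) f f"
    "term_eq X (Suc k) (TComp k g f) (TComp k g f)"
    "tcomp X (Suc k) k d c = tclass X (Suc k) (TComp k g f)"
proof -
  obtain g where g: "d = tclass X (Suc k) g" "term_eq X (Suc k) g g"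
    using assms(2) by (rule Tfree_cellE)
  obtain f where f: "c = tclass X (Suc k) f" "term_eq X (Suc k) f f"
    using assms(3) by (rule Tfree_cellE)
  have "term_eq X k (bd X False k g) (bd X True k f)"
  proof (rule tclass_eqD)
    show "term_eq X k (bd X True k f) (bd X True k f)" by (rule term_eq_bd[OF X f(2)])
    show "tclass X k (bd X False k g) = tclass X k (bd X True k f)"
      using assms(4) g f by (simp add: src_tclass tgt_tclass X)
  qed
  then have "term_eq X (Suc k) (TComp k g f) (TComp k g f)"
    using g f term_eq.comp[of k "Suc k" X g g f f] by (simp add: tsrc_bd ttgt_bd)
  then show thesis using that[of g f] g f by (simp add: tcomp_tclass[OF X])
qed

lemma tcomp_cell:
  assumes X: "globular_set X" and "d \<in> cells (Tfree X) (Suc k)" "c \<in> cells (Tfree X) (Suc k)"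
    and "src (Tfree X) k d = tgt (Tfree X) k c"
  shows "tcomp X (Suc k) k d c \<in> cells (Tfree X) (Suc k)"
    "src (Tfree X) k (tcomp X (Suc k) k d c) = src (Tfree X) k c"
    "tgt (Tfree X) k (tcomp X (Suc k) k d c) = tgt (Tfree X) k d"
proof -
  obtain g h where gh: "d = tclass X (Suc k) g" "c = tclass X (Suc k) h"
    "term_eq X (Suc k) g g" "term_eq X (Suc k) h h"
    "term_eq X (Suc k) (TComp k g h) (TComp k g h)"
    "tcomp X (Suc k) k d c = tclass X (Suc k) (TComp k g h)"
    using tcomp_wf[OF assms] .
  show "tcomp X (Suc k) k d c \<in> cells (Tfree X) (Suc k)"
    "src (Tfree X) k (tcomp X (Suc k) k d c) = src (Tfree X) k c"
    "tgt (Tfree X) k (tcomp X (Suc k) k d c) = tgt (Tfree X) k d"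
    unfolding gh(6) unfolding gh(1,2) using gh(3-5)
    by (simp_all add: src_tclass tgt_tclass X tclass_in_Tfree)
qed

text \<open>Needed twice in \<open>weak_inverse\<close>: for shapes, so that a composite of two
  cells over an identity lies over the same identity, and for words, so that this composite acts on
  the same word.\<close>

lemma tcomp_tid_tid:
  assumes X: "globular_set X" and c: "c \<in> cells (Tfree X) k"
  shows "tcomp X (Suc k) k (tid X k c) (tid X k c) = tid X k c"
proof -
  obtain t where t: "c = tclass X k t" "term_eq X k t t" using c by (rule Tfree_cellE)
  have w: "term_eq X (Suc k) (TId t) (TId t)" using t(2) by (rule term_eq.ident)
  \<comment> \<open>The left unit law for an arrow that is itself an identity, with target
    \<open>t\<close>.\<close>
  have e: "term_eq X (Suc k) (TComp k (TId t) (TId t)) (TId t)"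
    using term_eq.unit_left[of k "Suc k", OF _ w] by simp
  show ?thesis
    using tclass_cong[OF e] tcomp_tclass[OF X term_eq_refl_left[OF e]] by (simp add: t tid_tclass)
qed

section \<open>Functoriality of the free strict category\<close>

lemma term_map_funcomp: "term_map g k (term_map f k t) = term_map (\<lambda>k x. g k (f k x)) k t"
  by (induction t arbitrary: k) auto

text \<open>Agreement on cells suffices because every generator occurring in a well-formed term is a
  cell, by inversion.\<close>

lemma term_map_cong:
  assumes X: "globular_set X" and "\<And>k x. x \<in> cells X k \<Longrightarrow> f k x = g k x" "term_eq X k t t"
  shows "term_map f k t = term_map g k t"
  using assms(3)
proof (induction t arbitrary: k rule: sterm.induct)
  case (TGen x)
  then show ?case using conjunct1[OF term_eq_term_wf[OF X TGen]] assms(2) by simp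
next
  case (TId t)
  then show ?case using conjunct1[OF term_eq_term_wf[OF X TId.prems]] by auto
next
  case (TComp p g f)
  then show ?case using TComp.prems[unfolded term_eq_TComp_iff[OF X]] by simp
qed

lemma term_map_id: "term_map (\<lambda>_ x. x) k t = t"
  by (induction t arbitrary: k) auto

lemma subst_ok_glob_map:
  assumes "globular_set X" "glob_map X Y f"
  shows "subst_ok X Y (\<lambda>k x. TGen (f k x))"
proof -
  have "f k x \<in> cells Y k" if "x \<in> cells X k" for k x
    using assms that by (auto simp: glob_map_def)
  moreover have "(if b then tgt Y else src Y) k (f (Suc k) x) = f k ((if b then tgt X else src X) k x)"
    "(if b then tgt X else src X) k x \<in> cells X k"
    if "x \<in> cells X (Suc k)" for k x b
    using assms that by (auto simp: glob_map_def globular_set_def)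
  ultimately show ?thesis
    by (simp add: subst_ok_def term_eq.gen)
qed

context
  fixes X :: "('a, 'y) glob_scheme" and Y :: "('b, 'z) glob_scheme" and f :: "nat \<Rightarrow> 'a \<Rightarrow> 'b"
  assumes X: "globular_set X" and Y: "globular_set Y" and f: "glob_map X Y f"
begin

interpretation substitution X Y "\<lambda>k x. TGen (f k x)"
  by unfold_locales (simp_all add: X Y subst_ok_glob_map[OF X f])

lemma term_eq_term_map: "term_eq X k t u \<Longrightarrow> term_eq Y k (term_map f k t) (term_map f k u)"
  unfolding term_map_subst by (rule term_eq_subst)

lemma tmap_tclass:
  assumes "term_eq X k t t"
  shows "tmap Y f k (tclass X k t) = tclass Y k (term_map f k t)"
  unfolding tmap_def
  by (intro UN_tclass assms tclass_cong term_eq_term_map) (rule term_eq.sym)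

lemma tmap_cell: "c \<in> cells (Tfree X) k \<Longrightarrow> tmap Y f k c \<in> cells (Tfree Y) k"
  by (erule Tfree_cellE) (simp add: tmap_tclass tclass_in_Tfree term_eq_term_map)

lemma tmap_bd:
  assumes "c \<in> cells (Tfree X) (Suc k)"
  shows "tmap Y f k (src (Tfree X) k c) = src (Tfree Y) k (tmap Y f (Suc k) c)"
    "tmap Y f k (tgt (Tfree X) k c) = tgt (Tfree Y) k (tmap Y f (Suc k) c)"
proof -
  obtain t where t: "c = tclass X (Suc k) t" "term_eq X (Suc k) t t" using assms by (rule Tfree_cellE)
  have "term_eq X k (bd X b k t) (bd X b k t)" for b by (rule term_eq_bd[OF X t(2)])
  moreover have "term_eq Y (Suc k) (term_map f (Suc k) t) (term_map f (Suc k) t)"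
    by (rule term_eq_term_map[OF t(2)])
  moreover have "tclass Y k (bd Y b k (term_map f (Suc k) t)) = tclass Y k (term_map f k (bd X b k t))" for b
    unfolding term_map_subst by (rule tclass_cong[OF bd_subst[OF t(2)]])
  ultimately show "tmap Y f k (src (Tfree X) k c) = src (Tfree Y) k (tmap Y f (Suc k) c)"
    "tmap Y f k (tgt (Tfree X) k c) = tgt (Tfree Y) k (tmap Y f (Suc k) c)"
    using t by (simp_all add: tmap_tclass src_tclass tgt_tclass X Y)
qed

lemma tmap_tunit: "x \<in> cells X k \<Longrightarrow> tmap Y f k (tunit X k x) = tunit Y k (f k x)"
  by (simp add: tunit_def tmap_tclass term_eq.gen)

lemma tmap_tid: "c \<in> cells (Tfree X) k \<Longrightarrow> tmap Y f (Suc k) (tid X k c) = tid Y k (tmap Y f k c)"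
  by (erule Tfree_cellE) (simp add: tid_tclass tmap_tclass term_eq.ident term_eq_term_map)

lemma tmap_tcomp:
  assumes "d \<in> cells (Tfree X) (Suc k)" "c \<in> cells (Tfree X) (Suc k)"
    "src (Tfree X) k d = tgt (Tfree X) k c"
  shows "tmap Y f (Suc k) (tcomp X (Suc k) k d c) =
    tcomp Y (Suc k) k (tmap Y f (Suc k) d) (tmap Y f (Suc k) c)"
proof -
  obtain g h where gh: "d = tclass X (Suc k) g" "c = tclass X (Suc k) h"
    "term_eq X (Suc k) g g" "term_eq X (Suc k) h h"
    "term_eq X (Suc k) (TComp k g h) (TComp k g h)"
    "tcomp X (Suc k) k d c = tclass X (Suc k) (TComp k g h)"
    using tcomp_wf[OF X assms] .
  show ?thesis
    using term_eq_term_map[OF gh(5)] gh(3-5) unfolding gh(6) unfolding gh(1,2)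
    by (simp add: tmap_tclass tcomp_tclass[OF Y])
qed

end

lemma glob_map_comp: "glob_map X Y f \<Longrightarrow> glob_map Y Z g \<Longrightarrow> glob_map X Z (\<lambda>k x. g k (f k x))"
  by (simp add: glob_map_def)

lemma tmap_funcomp:
  assumes "globular_set X" "globular_set Y" "globular_set Z" "glob_map X Y f" "glob_map Y Z g"
    and "c \<in> cells (Tfree X) k"
  shows "tmap Z g k (tmap Y f k c) = tmap Z (\<lambda>k x. g k (f k x)) k c"
proof -
  obtain t where t: "c = tclass X k t" "term_eq X k t t" using assms(6) by (rule Tfree_cellE)
  have "tmap Y f k c = tclass Y k (term_map f k t)"
    unfolding t(1) by (rule tmap_tclass[OF assms(1,2,4) t(2)])
  moreover have "tmap Z (\<lambda>k x. g k (f k x)) k c = tclass Z k (term_map (\<lambda>k x. g k (f k x)) k t)"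
    unfolding t(1) by (rule tmap_tclass[OF assms(1,3) glob_map_comp[OF assms(4,5)] t(2)])
  moreover have "tmap Z g k (tclass Y k (term_map f k t)) = tclass Z k (term_map g k (term_map f k t))"
    by (rule tmap_tclass[OF assms(2,3,5) term_eq_term_map[OF assms(1,2,4) t(2)]])
  ultimately show ?thesis by (simp add: term_map_funcomp)
qed

lemma tmap_cong:
  assumes "globular_set X" "globular_set Y" "glob_map X Y f" "glob_map X Y g"
    and "\<And>k x. x \<in> cells X k \<Longrightarrow> f k x = g k x" and "c \<in> cells (Tfree X) k"
  shows "tmap Y f k c = tmap Y g k c"
proof -
  obtain t where t: "c = tclass X k t" "term_eq X k t t" using assms(6) by (rule Tfree_cellE)
  show ?thesis
    unfolding t(1) tmap_tclass[OF assms(1-3) t(2)] tmap_tclass[OF assms(1,2,4) t(2)]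
    using term_map_cong[OF assms(1,5) t(2)] by simp
qed

lemma tmap_ident:
  assumes X: "globular_set X" and c: "c \<in> cells (Tfree X) k" and f: "\<And>k x. x \<in> cells X k \<Longrightarrow> f k x = x"
  shows "tmap X f k c = c"
proof -
  have "glob_map X X f" using f X by (auto simp: glob_map_def globular_set_def)
  moreover obtain t where t: "c = tclass X k t" "term_eq X k t t" using c by (rule Tfree_cellE)
  ultimately show ?thesis
    using tmap_tclass[OF X X _ t(2)] term_map_cong[OF X f t(2)] by (simp add: term_map_id)
qed

text \<open>With representatives chosen for the cells of \<open>Tfree X\<close>, evaluation of a word of words
  becomes a substitution of terms.\<close>

definition rep :: "nat \<Rightarrow> 'a sterm set \<Rightarrow> 'a sterm" where
  "rep k c = (SOME t. t \<in> c)"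

context
  fixes X :: "('a, 'y) glob_scheme"
  assumes X: "globular_set X"
begin

lemma rep:
  assumes "c \<in> cells (Tfree X) k"
  shows "tclass X k (rep k c) = c" "term_eq X k (rep k c) (rep k c)"
proof -
  obtain t where t: "c = tclass X k t" "term_eq X k t t" using assms by (rule Tfree_cellE)
  then have "t \<in> c" by (simp add: tclass_def)
  then have "rep k c \<in> c" unfolding rep_def by (rule someI)
  then have "term_eq X k t (rep k c)" by (simp add: t(1) tclass_def)
  then show "tclass X k (rep k c) = c" "term_eq X k (rep k c) (rep k c)"
    using tclass_cong[of X k t "rep k c"] t(1) term_eq_refl_right[of X k t "rep k c"] by simp_all
qed

lemma subst_ok_rep: "subst_ok (Tfree X) X rep"
proof -
  have "term_eq X k (bd X b k (rep (Suc k) c)) (rep k ((if b then tgt (Tfree X) else src (Tfree X)) k c))"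
    if c: "c \<in> cells (Tfree X) (Suc k)" for k b c
  proof -
    let ?d = "(if b then tgt (Tfree X) else src (Tfree X)) k c"
    have "?d \<in> cells (Tfree X) k"
      using globular_Tfree[OF X] c by (auto simp: globular_set_def)
    moreover have "?d = tclass X k (bd X b k (rep (Suc k) c))"
      using bd_tclass[OF X rep(2)[OF c], of b] by (cases b) (simp_all add: rep(1)[OF c])
    ultimately show ?thesis
      using rep[of ?d k] tclass_eqD[of X k "rep k ?d"] by simp
  qed
  then show ?thesis using rep(2) by (simp add: subst_ok_def)
qed

interpretation evaluation: substitution "Tfree X" X rep
  by unfold_locales (simp_all add: X globular_Tfree subst_ok_rep)

lemma term_eval_subst:
  "term_eq (Tfree X) k t t \<Longrightarrow> term_eval X k t = tclass X k (term_subst rep k t)"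
proof (induction t arbitrary: k rule: sterm.induct)
  case (TGen c)
  then have "c \<in> cells (Tfree X) k"
    using conjunct1[OF term_eq_term_wf[OF globular_Tfree[OF X] TGen]] by simp
  then show ?case by (simp add: rep(1))
next
  case (TId t)
  then obtain j where j: "k = Suc j" "term_eq (Tfree X) j t t"
    using conjunct1[OF term_eq_term_wf[OF globular_Tfree[OF X] TId.prems]] by auto
  then show ?case using TId.IH evaluation.term_eq_subst[OF j(2)] by (simp add: tid_tclass)
next
  case (TComp p g f)
  note wf = TComp.prems[unfolded term_eq_TComp_iff[OF globular_Tfree[OF X]]]
  have "tcomp X k p (tclass X k (term_subst rep k g)) (tclass X k (term_subst rep k f)) =
      tclass X k (TComp p (term_subst rep k g) (term_subst rep k f))"
    using evaluation.term_eq_subst[OF TComp.prems] by (intro tcomp_tclass[OF X]) simp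
  then show ?case using TComp.IH wf by simp
qed

lemma tmult_tclass:
  assumes "term_eq (Tfree X) k t t"
  shows "tmult X k (tclass (Tfree X) k t) = term_eval X k t"
proof -
  have "term_eval X k u = term_eval X k t" if "term_eq (Tfree X) k t u" for u
    using term_eval_subst[OF assms] term_eval_subst[OF term_eq_refl_right[OF that]]
      tclass_cong[OF evaluation.term_eq_subst[OF that]] by simp
  then show ?thesis unfolding tmult_def by (rule UN_tclass[OF assms])
qed

lemma tmult_tunit: "c \<in> cells (Tfree X) k \<Longrightarrow> tmult X k (tunit (Tfree X) k c) = c"
  by (simp add: tunit_def tmult_tclass term_eq.gen)

lemma tmult_cell:
  assumes "W \<in> cells (Tfree (Tfree X)) k"
  shows "tmult X k W \<in> cells (Tfree X) k"
proof -
  obtain t where t: "W = tclass (Tfree X) k t" "term_eq (Tfree X) k t t"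
    using assms by (rule Tfree_cellE)
  then show ?thesis
    using evaluation.term_eq_subst[OF t(2)] by (simp add: tmult_tclass term_eval_subst tclass_in_Tfree)
qed

lemma tmult_tid:
  assumes "W \<in> cells (Tfree (Tfree X)) k"
  shows "tmult X (Suc k) (tid (Tfree X) k W) = tid X k (tmult X k W)"
proof -
  obtain t where t: "W = tclass (Tfree X) k t" "term_eq (Tfree X) k t t"
    using assms by (rule Tfree_cellE)
  then show ?thesis by (simp add: tid_tclass tmult_tclass term_eq.ident)
qed

lemma tmult_tcomp:
  assumes "V \<in> cells (Tfree (Tfree X)) (Suc k)" "W \<in> cells (Tfree (Tfree X)) (Suc k)"
    "src (Tfree (Tfree X)) k V = tgt (Tfree (Tfree X)) k W"
  shows "tmult X (Suc k) (tcomp (Tfree X) (Suc k) k V W) =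
    tcomp X (Suc k) k (tmult X (Suc k) V) (tmult X (Suc k) W)"
proof -
  obtain g h where gh: "V = tclass (Tfree X) (Suc k) g" "W = tclass (Tfree X) (Suc k) h"
    "term_eq (Tfree X) (Suc k) g g" "term_eq (Tfree X) (Suc k) h h"
    "term_eq (Tfree X) (Suc k) (TComp k g h) (TComp k g h)"
    "tcomp (Tfree X) (Suc k) k V W = tclass (Tfree X) (Suc k) (TComp k g h)"
    using tcomp_wf[OF globular_Tfree[OF X] assms] .
  show ?thesis
    unfolding gh(6) unfolding gh(1,2) using gh(3-5) by (simp add: tmult_tclass)
qed

end

section \<open>Words in dimension zero\<close>

text \<open>Identities and composites start in dimension one, so equality of terms is literal here.
  This is the base case for the uniqueness of the index of a word and settles the statement about
  operations.\<close>

lemma term_eq_0: "term_eq X k t u \<Longrightarrow> k = 0 \<Longrightarrow> t = u \<and> (\<exists>x \<in> cells X 0. t = TGen x)"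
  by (induction rule: term_eq.induct) auto

lemma tunit_0: "x \<in> cells X 0 \<Longrightarrow> tunit X 0 x = {TGen x}"
  using term_eq_0[of X 0 "TGen x"] term_eq.gen[of x X 0] by (auto simp: tunit_def tclass_def)

lemma Tfree_cells_0: "c \<in> cells (Tfree X) 0 \<Longrightarrow> \<exists>x \<in> cells X 0. c = tunit X 0 x"
  by (erule Tfree_cellE) (use term_eq_0 in \<open>fastforce simp: tunit_def\<close>)

section \<open>Shapes and arities\<close>

lemma globular_one: "globular_set one"
  by (simp add: globular_set_def one_def)

lemma glob_map_one: "glob_map X one (\<lambda>_ _. ())"
  by (simp add: glob_map_def one_def)

lemma unit_in_one [simp]: "() \<in> cells one k"
  by (simp add: one_def)

lemma bd_one [simp]: "src one k x = ()" "tgt one k x = ()"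
  by (simp_all add: one_def)

context
  fixes X :: "('a, 'z) glob_scheme"
  assumes X: "globular_set X"
begin

lemma shape_cell: "w \<in> cells (Tfree X) k \<Longrightarrow> shape k w \<in> cells (Tfree one) k"
  unfolding shape_def by (rule tmap_cell[OF X globular_one glob_map_one])

lemma shape_bd:
  assumes "w \<in> cells (Tfree X) (Suc k)"
  shows "shape k (src (Tfree X) k w) = src (Tfree one) k (shape (Suc k) w)"
    "shape k (tgt (Tfree X) k w) = tgt (Tfree one) k (shape (Suc k) w)"
  unfolding shape_def using tmap_bd[OF X globular_one glob_map_one assms] .

lemma shape_tunit: "x \<in> cells X k \<Longrightarrow> shape k (tunit X k x) = tunit one k ()"
  unfolding shape_def by (rule tmap_tunit[OF X globular_one glob_map_one])

lemma shape_tid: "w \<in> cells (Tfree X) k \<Longrightarrow> shape (Suc k) (tid X k w) = tid one k (shape k w)"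
  unfolding shape_def by (rule tmap_tid[OF X globular_one glob_map_one])

lemma shape_tcomp: "d \<in> cells (Tfree X) (Suc k) \<Longrightarrow> c \<in> cells (Tfree X) (Suc k) \<Longrightarrow>
    src (Tfree X) k d = tgt (Tfree X) k c \<Longrightarrow>
    shape (Suc k) (tcomp X (Suc k) k d c) = tcomp one (Suc k) k (shape (Suc k) d) (shape (Suc k) c)"
  unfolding shape_def by (rule tmap_tcomp[OF X globular_one glob_map_one])

lemma shape_tmap:
  "globular_set Y \<Longrightarrow> glob_map X Y f \<Longrightarrow> w \<in> cells (Tfree X) k \<Longrightarrow> shape k (tmap Y f k w) = shape k w"
  unfolding shape_def by (rule tmap_funcomp[OF X _ globular_one _ glob_map_one])

end

definition word_arity :: "'a coll \<Rightarrow> nat \<Rightarrow> 'a sterm set \<Rightarrow> pshape" where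
  "word_arity Y k w = tmult one k (tmap (Tfree one) (ar Y) k w)"

context
  fixes Y :: "'a coll"
  assumes Y: "collection Y"
begin

lemma coll_glob: "globular_set Y"
  using Y by (simp add: collection_def)

lemma glob_map_ar: "glob_map Y (Tfree one) (ar Y)"
  using Y by (simp add: collection_def)

lemma ar_cell: "y \<in> cells Y k \<Longrightarrow> ar Y k y \<in> cells (Tfree one) k"
  using glob_map_ar by (simp add: glob_map_def)

lemma ar_bd:
  assumes "y \<in> cells Y (Suc k)"
  shows "ar Y k (src Y k y) = src (Tfree one) k (ar Y (Suc k) y)"
    "ar Y k (tgt Y k y) = tgt (Tfree one) k (ar Y (Suc k) y)"
  using glob_map_ar assms by (simp_all add: glob_map_def)

lemma bd_cell:
  assumes "y \<in> cells Y (Suc k)"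
  shows "src Y k y \<in> cells Y k" "tgt Y k y \<in> cells Y k"
  using coll_glob assms by (simp_all add: globular_set_def)

lemma word_arity_tunit: "y \<in> cells Y k \<Longrightarrow> word_arity Y k (tunit Y k y) = ar Y k y"
  by (simp add: word_arity_def tmap_tunit[OF coll_glob globular_Tfree[OF globular_one] glob_map_ar]
      tmult_tunit[OF globular_one] ar_cell)

lemma word_arity_tid:
  "w \<in> cells (Tfree Y) k \<Longrightarrow> word_arity Y (Suc k) (tid Y k w) = tid one k (word_arity Y k w)"
  by (simp add: word_arity_def tmap_tid[OF coll_glob globular_Tfree[OF globular_one] glob_map_ar]
      tmult_tid[OF globular_one] tmap_cell[OF coll_glob globular_Tfree[OF globular_one] glob_map_ar])

lemma word_arity_tcomp:
  assumes dc: "d \<in> cells (Tfree Y) (Suc k)" "c \<in> cells (Tfree Y) (Suc k)"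
    "src (Tfree Y) k d = tgt (Tfree Y) k c"
  shows "word_arity Y (Suc k) (tcomp Y (Suc k) k d c) =
      tcomp one (Suc k) k (word_arity Y (Suc k) d) (word_arity Y (Suc k) c)"
proof -
  note ar = coll_glob globular_Tfree[OF globular_one] glob_map_ar
  have "src (Tfree (Tfree one)) k (tmap (Tfree one) (ar Y) (Suc k) d) =
      tgt (Tfree (Tfree one)) k (tmap (Tfree one) (ar Y) (Suc k) c)"
    using dc(3) by (simp flip: tmap_bd[OF ar dc(1)] tmap_bd[OF ar dc(2)])
  then show ?thesis
    unfolding word_arity_def tmap_tcomp[OF ar dc]
    by (intro tmult_tcomp[OF globular_one] tmap_cell[OF ar] dc)
qed

end

section \<open>Constructions on collections\<close>

lemma coll_mapD:
  assumes "coll_map X Y f"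
  shows "glob_map X Y f" "\<And>x k. x \<in> cells X k \<Longrightarrow> f k x \<in> cells Y k"
    "\<And>x k. x \<in> cells X k \<Longrightarrow> ar Y k (f k x) = ar X k x"
    "\<And>x k. x \<in> cells X (Suc k) \<Longrightarrow> f k (src X k x) = src Y k (f (Suc k) x)"
    "\<And>x k. x \<in> cells X (Suc k) \<Longrightarrow> f k (tgt X k x) = tgt Y k (f (Suc k) x)"
  using assms by (auto simp: coll_map_def glob_map_def)

lemma Ball_pair: "(\<forall>x\<in>S. Q x) \<longleftrightarrow> (\<forall>a b. (a, b) \<in> S \<longrightarrow> Q (a, b))"
  by auto

lemma box_cells: "(a, w) \<in> cells (box X Y) k \<longleftrightarrow>
    a \<in> cells X k \<and> w \<in> cells (Tfree Y) k \<and> ar X k a = shape k w"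
  by (simp add: box_def)

lemma box_simps [simp]:
  "src (box X Y) k (a, w) = (src X k a, src (Tfree Y) k w)"
  "tgt (box X Y) k (a, w) = (tgt X k a, tgt (Tfree Y) k w)"
  "ar (box X Y) k (a, w) = word_arity Y k w"
  by (simp_all add: box_def word_arity_def)

lemma globular_box:
  assumes X: "collection X" and Y: "globular_set Y"
  shows "globular_set (box X Y)"
proof -
  have TY: "globular_set (Tfree Y)" by (rule globular_Tfree[OF Y])
  have "src X k a \<in> cells X k \<and> tgt X k a \<in> cells X k"
    "src (Tfree Y) k w \<in> cells (Tfree Y) k \<and> tgt (Tfree Y) k w \<in> cells (Tfree Y) k"
    "ar X k (src X k a) = shape k (src (Tfree Y) k w) \<and> ar X k (tgt X k a) = shape k (tgt (Tfree Y) k w)"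
    if "(a, w) \<in> cells (box X Y) (Suc k)" for k a w
    using that coll_glob[OF X] TY
    by (auto simp: box_cells ar_bd[OF X] shape_bd[OF Y] globular_set_def)
  moreover have "src X k (src X (Suc k) a) = src X k (tgt X (Suc k) a) \<and>
      tgt X k (src X (Suc k) a) = tgt X k (tgt X (Suc k) a)"
    "src (Tfree Y) k (src (Tfree Y) (Suc k) w) = src (Tfree Y) k (tgt (Tfree Y) (Suc k) w) \<and>
      tgt (Tfree Y) k (src (Tfree Y) (Suc k) w) = tgt (Tfree Y) k (tgt (Tfree Y) (Suc k) w)"
    if "(a, w) \<in> cells (box X Y) (Suc (Suc k))" for k a w
    using that coll_glob[OF X] TY by (auto simp: box_cells globular_set_def)
  ultimately show ?thesis
    unfolding globular_set_def by (simp add: Ball_pair box_cells) blast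
qed

lemma glob_map_box_fst: "glob_map (box X Y) X (\<lambda>_. fst)"
  and glob_map_box_snd: "glob_map (box X Y) (Tfree Y) (\<lambda>_. snd)"
  by (auto simp: glob_map_def box_cells)

lemma prod_coll_cells: "(x, y) \<in> cells (prod_coll X Y) k \<longleftrightarrow>
    x \<in> cells X k \<and> y \<in> cells Y k \<and> ar X k x = ar Y k y"
  by (simp add: prod_coll_def)

lemma prod_coll_simps [simp]:
  "src (prod_coll X Y) k (x, y) = (src X k x, src Y k y)"
  "tgt (prod_coll X Y) k (x, y) = (tgt X k x, tgt Y k y)"
  "ar (prod_coll X Y) k (x, y) = ar X k x"
  by (simp_all add: prod_coll_def)

lemma globular_prod_coll:
  assumes "collection X" "collection Y"
  shows "globular_set (prod_coll X Y)"
  using coll_glob[OF assms(1)] coll_glob[OF assms(2)]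
  unfolding globular_set_def by (simp add: Ball_pair prod_coll_cells ar_bd assms)

lemma glob_map_prod_fst: "glob_map (prod_coll X Y) X (\<lambda>_. fst)"
  and glob_map_prod_snd: "glob_map (prod_coll X Y) Y (\<lambda>_. snd)"
  by (auto simp: glob_map_def prod_coll_cells)

lemma pow_coll_cells: "(\<theta>, xs) \<in> cells (pow_coll A n) k \<longleftrightarrow>
    \<theta> \<in> cells (Tfree one) k \<and> length xs = n \<and> (\<forall>x \<in> set xs. x \<in> cells A k \<and> ar A k x = \<theta>)"
  by (simp add: pow_coll_def)

lemma pow_coll_simps [simp]:
  "src (pow_coll A n) k (\<theta>, xs) = (src (Tfree one) k \<theta>, map (src A k) xs)"
  "tgt (pow_coll A n) k (\<theta>, xs) = (tgt (Tfree one) k \<theta>, map (tgt A k) xs)"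
  "ar (pow_coll A n) k (\<theta>, xs) = \<theta>"
  by (simp_all add: pow_coll_def)

lemma collection_pow_coll:
  assumes A: "collection A"
  shows "collection (pow_coll A n)"
proof -
  have T: "globular_set (Tfree one)" by (rule globular_Tfree[OF globular_one])
  show ?thesis
    using coll_glob[OF A] T unfolding collection_def globular_set_def glob_map_def
    by (simp add: Ball_pair pow_coll_cells ar_bd[OF A])
qed

lemma copies_cells: "(f, \<theta>) \<in> cells (copies S) k \<longleftrightarrow> f \<in> S \<and> \<theta> \<in> cells (Tfree one) k"
  by (simp add: copies_def)

lemma copies_simps [simp]:
  "src (copies S) k (f, \<theta>) = (f, src (Tfree one) k \<theta>)"
  "tgt (copies S) k (f, \<theta>) = (f, tgt (Tfree one) k \<theta>)"
  "ar (copies S) k (f, \<theta>) = \<theta>"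
  by (simp_all add: copies_def)

lemma globular_copies: "globular_set (copies S)"
  using globular_Tfree[OF globular_one] unfolding globular_set_def
  by (simp add: Ball_pair copies_cells)

lemma glob_map_copies: "f \<in> S \<Longrightarrow> glob_map (Tfree one) (copies S) (\<lambda>_ \<theta>. (f, \<theta>))"
  using globular_Tfree[OF globular_one] by (simp add: glob_map_def copies_cells)

text \<open>Sources in \<open>copies S\<close> keep the index. Taking them repeatedly leads to
  dimension \<open>0\<close>, where a word is a single generator that displays its index.\<close>

lemma copies_word_index_unique:
  fixes V V' :: "pshape sterm set"
  assumes "f \<in> S" "f' \<in> S" "V \<in> cells (Tfree (Tfree one)) k" "V' \<in> cells (Tfree (Tfree one)) k"
    and "tmap (copies S) (\<lambda>_ \<theta>. (f, \<theta>)) k V = tmap (copies S) (\<lambda>_ \<theta>. (f', \<theta>)) k V'"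
  shows "f = f'"
  using assms(3-5)
proof (induction k arbitrary: V V')
  note T = globular_Tfree[OF globular_one] globular_copies
  case 0
  obtain v v' where v: "v \<in> cells (Tfree one) 0" "V = tunit (Tfree one) 0 v"
      "v' \<in> cells (Tfree one) 0" "V' = tunit (Tfree one) 0 v'"
    using Tfree_cells_0 0 by metis
  then have "tunit (copies S) 0 (f, v) = tunit (copies S) 0 (f', v')"
    using 0(3) by (simp add: tmap_tunit[OF T glob_map_copies] assms(1,2))
  then show ?case
    using v by (simp add: tunit_0 copies_cells assms(1,2))
next
  note T = globular_Tfree[OF globular_one] globular_copies
  case (Suc k)
  have "tmap (copies S) (\<lambda>_ \<theta>. (f, \<theta>)) k (src (Tfree (Tfree one)) k V) =
      tmap (copies S) (\<lambda>_ \<theta>. (f', \<theta>)) k (src (Tfree (Tfree one)) k V')"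
    using Suc.prems by (simp add: tmap_bd[OF T glob_map_copies] assms(1,2))
  then show ?case
    using Suc.IH Suc.prems(1,2) globular_Tfree[OF globular_Tfree[OF globular_one]]
    by (metis globular_set_def)
qed

lemma word_index_tmap:
  assumes "f \<in> S" "V \<in> cells (Tfree (Tfree one)) k"
  shows "word_index S k (tmap (copies S) (\<lambda>_ \<theta>. (f, \<theta>)) k V) = f"
  unfolding word_index_def
proof (rule the_equality)
  show "f \<in> S \<and> tmap (copies S) (\<lambda>_ \<theta>. (f, \<theta>)) k V \<in>
    tmap (copies S) (\<lambda>_ \<theta>. (f, \<theta>)) k ` cells (Tfree (Tfree one)) k"
    by (rule conjI[OF assms(1) imageI[OF assms(2)]])
next
  fix f' assume f': "f' \<in> S \<and> tmap (copies S) (\<lambda>_ \<theta>. (f, \<theta>)) k V \<in>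
    tmap (copies S) (\<lambda>_ \<theta>. (f', \<theta>)) k ` cells (Tfree (Tfree one)) k"
  then obtain V' where V': "V' \<in> cells (Tfree (Tfree one)) k"
    "tmap (copies S) (\<lambda>_ \<theta>. (f, \<theta>)) k V = tmap (copies S) (\<lambda>_ \<theta>. (f', \<theta>)) k V'"
    by (elim conjE imageE)
  show "f' = f"
    using copies_word_index_unique[OF assms(1) conjunct1[OF f'] assms(2) V'] by (rule HOL.sym)
qed

text \<open>The inclusion of the summand \<open>f\<close> commutes with \<open>tunit\<close> and
  \<open>tid\<close>, which exhibits the word as the image of a word of shapes. This computes the
  operation underlying \<open>lift_id\<close>; the next lemma does the same for
  \<open>lift_comp\<close>.\<close>

lemma word_index_tid:
  assumes "f \<in> S" "\<theta> \<in> cells (Tfree one) k"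
  shows "word_index S (Suc k) (tid (copies S) k (tunit (copies S) k (f, \<theta>))) = f"
proof -
  note T = globular_Tfree[OF globular_one] globular_copies glob_map_copies[OF assms(1)]
  have "tid (copies S) k (tunit (copies S) k (f, \<theta>)) =
      tmap (copies S) (\<lambda>_ \<theta>. (f, \<theta>)) (Suc k) (tid (Tfree one) k (tunit (Tfree one) k \<theta>))"
    using assms by (simp add: tmap_tid[OF T] tmap_tunit[OF T] tunit_cell)
  then show ?thesis
    using assms by (simp add: word_index_tmap tid_cell tunit_cell)
qed

lemma word_index_tcomp:
  assumes "f \<in> S" "\<theta> \<in> cells (Tfree one) (Suc k)" "\<theta>' \<in> cells (Tfree one) (Suc k)"
    "src (Tfree one) k \<theta> = tgt (Tfree one) k \<theta>'"
  shows "word_index S (Suc k) (tcomp (copies S) (Suc k) k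
    (tunit (copies S) (Suc k) (f, \<theta>)) (tunit (copies S) (Suc k) (f, \<theta>'))) = f"
proof -
  note T = globular_Tfree[OF globular_one] globular_copies glob_map_copies[OF assms(1)]
  have s: "src (Tfree (Tfree one)) k (tunit (Tfree one) (Suc k) \<theta>) =
      tgt (Tfree (Tfree one)) k (tunit (Tfree one) (Suc k) \<theta>')"
    using assms by (simp add: tunit_bd[OF T(1)])
  have "tcomp (copies S) (Suc k) k (tunit (copies S) (Suc k) (f, \<theta>)) (tunit (copies S) (Suc k) (f, \<theta>')) =
      tmap (copies S) (\<lambda>_ \<theta>. (f, \<theta>)) (Suc k) (tcomp (Tfree one) (Suc k) k
        (tunit (Tfree one) (Suc k) \<theta>) (tunit (Tfree one) (Suc k) \<theta>'))"
    using assms by (simp add: tmap_tcomp[OF T _ _ s] tmap_tunit[OF T] tunit_cell)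
  then show ?thesis
    using assms by (simp add: word_index_tmap tcomp_cell(1)[OF T(1) _ _ s] tunit_cell)
qed

section \<open>Sums of unary operations\<close>

text \<open>The empty sum takes \<open>gzero\<close> at the arity of \<open>o1\<close>, because sums
  are fibre products over shapes and all summands must have one arity. Bracketing to the right
  matches the splitting by \<open>head_tail\<close>.\<close>

primrec sum_op :: "('e, 'z) gpro_scheme \<Rightarrow> nat \<Rightarrow> nat \<Rightarrow> 'e \<Rightarrow> 'e" where
  "sum_op E 0 k o1 = gzero E k (ar (gcol E 1 1) k o1)"
| "sum_op E (Suc n) k o1 = gadd E 1 1 n n k (o1, sum_op E n k o1)"

definition component :: "nat \<Rightarrow> pshape \<times> 'a list \<Rightarrow> pshape \<times> 'a list" where
  "component i = (\<lambda>(\<theta>, xs). (\<theta>, [xs ! i]))"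

text \<open>Inverse to \<open>pow_append\<close> on cells. The law \<open>action_sum\<close> speaks
  of words in a product of two powers, so a word in a power has to be pulled apart along this map
  first.\<close>

definition head_tail :: "pshape \<times> 'a list \<Rightarrow> (pshape \<times> 'a list) \<times> (pshape \<times> 'a list)" where
  "head_tail = (\<lambda>(\<theta>, xs). ((\<theta>, [hd xs]), (\<theta>, tl xs)))"

lemma component_simp [simp]: "component i (\<theta>, xs) = (\<theta>, [xs ! i])"
  by (simp add: component_def)

lemma glob_map_component:
  "i < n \<Longrightarrow> glob_map (pow_coll A n) (pow_coll A 1) (\<lambda>_. component i)"
  using globular_Tfree[OF globular_one]
  by (auto simp: glob_map_def Ball_pair pow_coll_cells component_def globular_set_def)

lemma glob_map_head_tail:
  "glob_map (pow_coll A (Suc n)) (prod_coll (pow_coll A 1) (pow_coll A n)) (\<lambda>_. head_tail)"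
  by (auto simp: glob_map_def Ball_pair pow_coll_cells prod_coll_cells head_tail_def length_Suc_conv)

lemma glob_map_pow_append:
  "glob_map (prod_coll (pow_coll A n) (pow_coll A r)) (pow_coll A (n + r)) pow_append"
  by (auto simp: glob_map_def Ball_pair pow_coll_cells prod_coll_cells pow_append_def)

locale weakening_action = PRO P + weakening_algebra E A \<Omega>
  for P :: "'p pro" and E :: "('p, 'e) weak_gpro" and A :: "'a coll" and \<Omega> +
  assumes weakening: "weakening P E"
begin

text \<open>Degrees \<open>1 + n\<close> produced by \<open>gadd\<close> should become
  \<open>Suc n\<close>, while the degree \<open>1\<close> of the unary operations should stay as it
  is.\<close>

declare One_nat_def [simp del] plus_1_eq_Suc [simp]

abbreviation "G \<equiv> gcol E"
abbreviation "Apow \<equiv> pow_coll A"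

lemma collG: "collection (G n m)"
  using weakening by (simp add: weakening_def sum_monoid_def)

lemmas globG = coll_glob[OF collG]
lemmas collPow = collection_pow_coll[OF carrier(1)]
lemmas globPow = coll_glob[OF collPow]

lemma proj_map: "coll_map (G n m) (copies (hom P n m)) (proj E n m)"
  using weakening by (simp add: weakening_def sum_monoid_map_def globularization_def)

lemma gcomp_map: "coll_map (box (G m r) (G n m)) (G n r) (gcomp E n m r)"
  using weakening by (simp add: weakening_def coll_category_def)

lemma gid_map: "coll_map unit_coll (G n n) (gid E n)"
  using weakening by (simp add: weakening_def coll_category_def)

lemma gadd_map: "coll_map (prod_coll (G n m) (G l r)) (G (n + l) (m + r)) (gadd E n m l r)"
  using weakening by (simp add: weakening_def sum_monoid_def)

lemma gzero_map: "coll_map terminal_coll (G 0 0) (gzero E)"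
  using weakening by (simp add: weakening_def sum_monoid_def)

lemma contr:
  assumes "parallel (G n m) k a b" "f \<in> hom P n m" "\<theta> \<in> cells (Tfree one) (Suc k)"
    "proj E n m k a = (f, src (Tfree one) k \<theta>)" "proj E n m k b = (f, tgt (Tfree one) k \<theta>)"
  defines "c \<equiv> contr E n m k (f, \<theta>) a b"
  shows "c \<in> cells (G n m) (Suc k)" "src (G n m) k c = a" "tgt (G n m) k c = b"
    "proj E n m (Suc k) c = (f, \<theta>)"
proof -
  have "contraction (G n m) (copies (hom P n m)) (proj E n m) (contr E n m)"
    using weakening by (simp add: weakening_def globularization_def)
  moreover have "(f, \<theta>) \<in> cells (copies (hom P n m)) (Suc k)"
    using assms by (simp add: copies_cells)
  moreover have "(a, b) \<in> Par (G n m) (copies (hom P n m)) (proj E n m) k (f, \<theta>)"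
    using assms by (simp add: Par_def)
  ultimately have "c \<in> cells (G n m) (Suc k) \<and> src (G n m) k c = a \<and> tgt (G n m) k c = b \<and>
      proj E n m (Suc k) c = (f, \<theta>)"
    unfolding contraction_def c_def by blast
  then show "c \<in> cells (G n m) (Suc k)" "src (G n m) k c = a" "tgt (G n m) k c = b"
    "proj E n m (Suc k) c = (f, \<theta>)" by simp_all
qed

lemma proj_gcomp:
  assumes "(x, w) \<in> cells (box (G m r) (G n m)) k"
  shows "fst (proj E n r k (gcomp E n m r k (x, w))) = pcomp P n m r (fst (proj E m r k x))
    (word_index (hom P n m) k (tmap (copies (hom P n m)) (proj E n m) k w))"
proof -
  have "coll_functor E (globularization P) (proj E)" using weakening by (simp add: weakening_def)
  then have "proj E n r k (gcomp E n m r k (x, w)) = gcomp (globularization P) n m r k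
      (box_map (gcol (globularization P) n m) (proj E m r) (proj E n m) k (x, w))"
    using assms unfolding coll_functor_def by blast
  then show ?thesis by (simp add: globularization_def box_map_def)
qed

lemma proj_gid: "proj E n n k (gid E n k ()) = (pid P n, tunit one k ())"
proof -
  have "coll_functor E (globularization P) (proj E)" using weakening by (simp add: weakening_def)
  then have "proj E n n k (gid E n k ()) = gid (globularization P) n k ()"
    unfolding coll_functor_def by blast
  then show ?thesis by (simp add: globularization_def unit_coll_def)
qed

lemma proj_gadd:
  assumes "(x, y) \<in> cells (prod_coll (G n m) (G l r)) k"
  shows "proj E (n + l) (m + r) k (gadd E n m l r k (x, y)) =
    (padd P n m l r (fst (proj E n m k x)) (fst (proj E l r k y)), ar (G n m) k x)"
proof -
  have "sum_monoid_map E (globularization P) (proj E)" using weakening by (simp add: weakening_def)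
  then have "proj E (n + l) (m + r) k (gadd E n m l r k (x, y)) =
      gadd (globularization P) n m l r k (proj E n m k x, proj E l r k y)"
    using assms unfolding sum_monoid_map_def by blast
  moreover have "snd (proj E n m k x) = ar (G n m) k x"
    using coll_mapD(3)[OF proj_map, of x n m k] assms
    by (cases "proj E n m k x") (simp add: prod_coll_cells)
  ultimately show ?thesis by (simp add: globularization_def split_beta)
qed

lemma proj_gzero:
  assumes "\<theta> \<in> cells (Tfree one) k"
  shows "proj E 0 0 k (gzero E k \<theta>) = (pid P 0, \<theta>)"
proof -
  have "sum_monoid_map E (globularization P) (proj E)" using weakening by (simp add: weakening_def)
  then have "proj E 0 0 k (gzero E k \<theta>) = gzero (globularization P) k \<theta>"
    using assms unfolding sum_monoid_map_def by blast
  then show ?thesis by (simp add: globularization_def)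
qed

text \<open>A collection map preserves arities, so the second component of \<open>proj\<close> is
  forced, and only the underlying operation has to be tracked.\<close>

lemma proj_ar: "x \<in> cells (G n m) k \<Longrightarrow> proj E n m k x = (fst (proj E n m k x), ar (G n m) k x)"
  using coll_mapD(3)[OF proj_map, of x n m k] by (cases "proj E n m k x") simp

lemma proj_hom: "x \<in> cells (G n m) k \<Longrightarrow> fst (proj E n m k x) \<in> hom P n m"
  using coll_mapD(2)[OF proj_map, of x n m k] by (cases "proj E n m k x") (simp add: copies_cells)

lemma proj_bd:
  assumes "x \<in> cells (G n m) (Suc k)"
  shows "proj E n m k (src (G n m) k x) = (fst (proj E n m (Suc k) x), src (Tfree one) k (ar (G n m) (Suc k) x))"
    "proj E n m k (tgt (G n m) k x) = (fst (proj E n m (Suc k) x), tgt (Tfree one) k (ar (G n m) (Suc k) x))"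
  using coll_mapD(4,5)[OF proj_map assms] proj_ar[OF assms]
  by (metis copies_simps(1), metis copies_simps(2))

lemma gid_cell: "gid E n k () \<in> cells (G n n) k"
  using coll_mapD(2)[OF gid_map, of "()" k n] by (simp add: unit_coll_def)

lemma sum_op_cell:
  assumes "o1 \<in> cells (G 1 1) k"
  shows "sum_op E n k o1 \<in> cells (G n n) k \<and> ar (G n n) k (sum_op E n k o1) = ar (G 1 1) k o1"
proof (induction n)
  case 0
  then show ?case
    using coll_mapD(2,3)[OF gzero_map, of "ar (G 1 1) k o1" k] ar_cell[OF collG assms]
    by (simp add: terminal_coll_def)
next
  case (Suc n)
  then have "(o1, sum_op E n k o1) \<in> cells (prod_coll (G 1 1) (G n n)) k"
    using assms by (simp add: prod_coll_cells)
  from coll_mapD(2,3)[OF gadd_map this] show ?case by simp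
qed

lemma sum_op_bd:
  assumes "o1 \<in> cells (G 1 1) (Suc k)"
  shows "src (G n n) k (sum_op E n (Suc k) o1) = sum_op E n k (src (G 1 1) k o1) \<and>
    tgt (G n n) k (sum_op E n (Suc k) o1) = sum_op E n k (tgt (G 1 1) k o1)"
proof (induction n)
  case 0
  have "ar (G 1 1) (Suc k) o1 \<in> cells terminal_coll (Suc k)"
    using ar_cell[OF collG assms] by (simp add: terminal_coll_def)
  from coll_mapD(4,5)[OF gzero_map this] show ?case
    by (simp add: terminal_coll_def ar_bd[OF collG assms])
next
  case (Suc n)
  have "(o1, sum_op E n (Suc k) o1) \<in> cells (prod_coll (G 1 1) (G n n)) (Suc k)"
    using assms sum_op_cell[OF assms] by (simp add: prod_coll_cells)
  from coll_mapD(4,5)[OF gadd_map this] Suc show ?case by simp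
qed

text \<open>In \<open>P\<close> a sum of identities is an identity (\<open>add_id\<close>). Hence
  composing with such a sum will not change the underlying operation.\<close>

lemma proj_sum_op:
  assumes "o1 \<in> cells (G 1 1) k" "fst (proj E 1 1 k o1) = pid P 1"
  shows "fst (proj E n n k (sum_op E n k o1)) = pid P n"
proof (induction n)
  case 0
  then show ?case using proj_gzero ar_cell[OF collG assms(1)] by simp
next
  case (Suc n)
  have "(o1, sum_op E n k o1) \<in> cells (prod_coll (G 1 1) (G n n)) k"
    using assms sum_op_cell[OF assms(1)] by (simp add: prod_coll_cells)
  from proj_gadd[OF this] Suc assms(2) add_id[of 1 n] show ?case by simp
qed

text \<open>The link between operations on a power and their entrywise definition: each use of
  \<open>action_sum\<close> splits off one entry. The function \<open>hd\<close> extracts the only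
  entry of a result in the first power.\<close>

lemma sum_op_action:
  assumes o1: "o1 \<in> cells (G 1 1) k"
  shows "V \<in> cells (Tfree (Apow n)) k \<Longrightarrow> shape k V = ar (G 1 1) k o1 \<Longrightarrow>
    snd (\<Omega> n n k (sum_op E n k o1, V)) =
    map (\<lambda>i. hd (snd (\<Omega> 1 1 k (o1, tmap (Apow 1) (\<lambda>_. component i) k V)))) [0..<n]"
proof (induction n arbitrary: V)
  case 0
  have "(sum_op E 0 k o1, V) \<in> cells (box (G 0 0) (Apow 0)) k"
    using 0 sum_op_cell[OF o1, of 0] by (simp add: box_cells)
  \<comment> \<open>The result lies in the zeroth power, whose cells carry the empty list.\<close>
  from coll_mapD(2)[OF action_map this] show ?case
    by (cases "\<Omega> 0 0 k (sum_op E 0 k o1, V)") (simp add: pow_coll_cells)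
next
  case (Suc n)
  let ?PP = "prod_coll (Apow 1) (Apow n)"
  let ?s = "sum_op E n k o1"
  let ?V = "tmap ?PP (\<lambda>_. head_tail) k V"
  note PP = globular_prod_coll[OF collPow collPow, of 1 n]
  note s = sum_op_cell[OF o1, of n]
  have V: "?V \<in> cells (Tfree ?PP) k"
    by (rule tmap_cell[OF globPow PP glob_map_head_tail Suc.prems(1)])
  have shapeV: "shape k ?V = ar (G 1 1) k o1"
    using shape_tmap[OF globPow PP glob_map_head_tail Suc.prems(1)] Suc.prems(2) by simp
  have d: "((o1, ?s), ?V) \<in> cells (box (prod_coll (G 1 1) (G n n)) ?PP) k"
    using o1 s V shapeV by (simp add: box_cells prod_coll_cells)
  \<comment> \<open>Splitting and appending cancel, so \<open>action_sum\<close> for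
    \<open>?V\<close> speaks about \<open>V\<close> itself.\<close>
  have "tmap (Apow (1 + n)) pow_append k ?V = tmap (Apow (1 + n)) (\<lambda>k x. pow_append k (head_tail x)) k V"
    using tmap_funcomp[OF globPow PP globPow glob_map_head_tail glob_map_pow_append Suc.prems(1)] .
  also have "\<dots> = V"
    using Suc.prems(1)
    by (intro tmap_ident globPow)
      (auto simp: pow_append_def head_tail_def pow_coll_cells length_Suc_conv split: prod.splits)
  finally have append: "tmap (Apow (Suc n)) pow_append k ?V = V" by simp
  have fst: "tmap (Apow 1) (\<lambda>_. fst) k ?V = tmap (Apow 1) (\<lambda>_. component 0) k V"
  proof -
    have "tmap (Apow 1) (\<lambda>_. fst) k ?V = tmap (Apow 1) (\<lambda>k x. fst (head_tail x)) k V"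
      by (rule tmap_funcomp[OF globPow PP globPow glob_map_head_tail glob_map_prod_fst Suc.prems(1)])
    also have "\<dots> = tmap (Apow 1) (\<lambda>_. component 0) k V"
    proof (rule tmap_cong[OF globPow globPow _ _ _ Suc.prems(1)])
      show "glob_map (Apow (Suc n)) (Apow 1) (\<lambda>k x. fst (head_tail x))"
        by (rule glob_map_comp[OF glob_map_head_tail glob_map_prod_fst])
      show "glob_map (Apow (Suc n)) (Apow 1) (\<lambda>_. component 0)"
        by (rule glob_map_component) simp
    qed (auto simp: head_tail_def component_def pow_coll_cells length_Suc_conv
        split: prod.splits)
    finally show ?thesis .
  qed
  have gsnd: "glob_map (Apow (Suc n)) (Apow n) (\<lambda>k x. snd (head_tail x))"
    by (rule glob_map_comp[OF glob_map_head_tail glob_map_prod_snd])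
  let ?W = "tmap (Apow n) (\<lambda>_. snd) k ?V"
  have W: "?W = tmap (Apow n) (\<lambda>k x. snd (head_tail x)) k V"
    by (rule tmap_funcomp[OF globPow PP globPow glob_map_head_tail glob_map_prod_snd Suc.prems(1)])
  have Wcell: "?W \<in> cells (Tfree (Apow n)) k" "shape k ?W = ar (G 1 1) k o1"
    unfolding W using tmap_cell[OF globPow globPow gsnd Suc.prems(1)]
      shape_tmap[OF globPow globPow gsnd Suc.prems(1)] Suc.prems(2) by simp_all
  have comp: "tmap (Apow 1) (\<lambda>_. component i) k ?W = tmap (Apow 1) (\<lambda>_. component (Suc i)) k V"
    if i: "i < n" for i
  proof -
    have "tmap (Apow 1) (\<lambda>_. component i) k ?W = tmap (Apow 1) (\<lambda>k x. component i (snd (head_tail x))) k V"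
      unfolding W by (rule tmap_funcomp[OF globPow globPow globPow gsnd glob_map_component[OF i] Suc.prems(1)])
    also have "\<dots> = tmap (Apow 1) (\<lambda>_. component (Suc i)) k V"
    proof (rule tmap_cong[OF globPow globPow _ _ _ Suc.prems(1)])
      show "glob_map (Apow (Suc n)) (Apow 1) (\<lambda>k x. component i (snd (head_tail x)))"
        by (rule glob_map_comp[OF gsnd glob_map_component[OF i]])
      show "glob_map (Apow (Suc n)) (Apow 1) (\<lambda>_. component (Suc i))"
        by (rule glob_map_component) (simp add: i)
    qed (use i in \<open>auto simp: head_tail_def component_def pow_coll_cells length_Suc_conv
        split: prod.splits\<close>)
    finally show ?thesis .
  qed
  \<comment> \<open>Without this, \<open>hd\<close> would lose information about the first
    summand.\<close>
  have len1: "length (snd (\<Omega> 1 1 k (o1, tmap (Apow 1) (\<lambda>_. component 0) k V))) = 1"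
  proof -
    have "(o1, tmap (Apow 1) (\<lambda>_. component 0) k V) \<in> cells (box (G 1 1) (Apow 1)) k"
      using o1 tmap_cell[OF globPow globPow glob_map_component Suc.prems(1), of 0]
        shape_tmap[OF globPow globPow glob_map_component Suc.prems(1), of 0] Suc.prems(2)
      by (simp add: box_cells)
    from coll_mapD(2)[OF action_map this] show ?thesis
      by (cases "\<Omega> 1 1 k (o1, tmap (Apow 1) (\<lambda>_. component 0) k V)") (simp add: pow_coll_cells)
  qed
  have "\<Omega> (Suc n) (Suc n) k (sum_op E (Suc n) k o1, V) =
      pow_append k (\<Omega> 1 1 k (o1, tmap (Apow 1) (\<lambda>_. component 0) k V), \<Omega> n n k (?s, ?W))"
    using action_sum[OF d] by (simp add: box_map_def box_interchange_def append fst)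
  then have "snd (\<Omega> (Suc n) (Suc n) k (sum_op E (Suc n) k o1, V)) =
      snd (\<Omega> 1 1 k (o1, tmap (Apow 1) (\<lambda>_. component 0) k V)) @ snd (\<Omega> n n k (?s, ?W))"
    by (simp add: pow_append_def split_beta)
  also have "\<dots> = hd (snd (\<Omega> 1 1 k (o1, tmap (Apow 1) (\<lambda>_. component 0) k V))) #
      map (\<lambda>i. hd (snd (\<Omega> 1 1 k (o1, tmap (Apow 1) (\<lambda>_. component (Suc i)) k V)))) [0..<n]"
  proof -
    obtain z where "snd (\<Omega> 1 1 k (o1, tmap (Apow 1) (\<lambda>_. component 0) k V)) = [z]"
      using len1 by (auto simp: length_Suc_conv One_nat_def)
    then show ?thesis unfolding Suc.IH[OF Wcell] by (simp add: comp)
  qed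
  also have "\<dots> = map (\<lambda>i. hd (snd (\<Omega> 1 1 k (o1, tmap (Apow 1) (\<lambda>_. component i) k V)))) [0..<Suc n]"
    by (simp add: upt_conv_Cons map_Suc_upt[symmetric] del: upt_Suc)
  finally show ?case .
qed

section \<open>Identities and composites\<close>

lemma parallel_refl: "x \<in> cells (G n m) k \<Longrightarrow> parallel (G n m) k x x"
  by (simp add: parallel_def split: nat.split)

lemma parallel_gid: "parallel (G n n) k (gid E n k ()) (gid E n k ())"
  by (rule parallel_refl[OF gid_cell])

lemma id_op:
  "id_op P E k \<in> cells (G 1 1) (Suc k)" "src (G 1 1) k (id_op P E k) = gid E 1 k ()"
  "tgt (G 1 1) k (id_op P E k) = gid E 1 k ()"
  "fst (proj E 1 1 (Suc k) (id_op P E k)) = pid P 1"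
  "ar (G 1 1) (Suc k) (id_op P E k) = tid one k (tunit one k ())"
proof -
  have u: "tunit one k () \<in> cells (Tfree one) k" by (simp add: tunit_cell)
  have p: "proj E 1 1 k (gid E 1 k ()) = (pid P 1, src (Tfree one) k (tid one k (tunit one k ())))"
    "proj E 1 1 k (gid E 1 k ()) = (pid P 1, tgt (Tfree one) k (tid one k (tunit one k ())))"
    by (simp_all add: proj_gid tid_bd[OF globular_one u])
  note c = contr[OF parallel_gid id_closed tid_cell[OF u] p, folded id_op_def]
  show "id_op P E k \<in> cells (G 1 1) (Suc k)" "src (G 1 1) k (id_op P E k) = gid E 1 k ()"
    "tgt (G 1 1) k (id_op P E k) = gid E 1 k ()"
    "fst (proj E 1 1 (Suc k) (id_op P E k)) = pid P 1"
    by (simp_all add: c)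
  show "ar (G 1 1) (Suc k) (id_op P E k) = tid one k (tunit one k ())"
    using proj_ar[OF c(1)] c(4) by simp
qed

text \<open>Source and target of the shape of two glued cells are both the generating cell, over
  which \<open>gid\<close> lies; so the contraction applies to two copies of
  \<open>gid\<close>.\<close>

lemma comp_op:
  defines "\<pi> \<equiv> \<lambda>k. tcomp one (Suc k) k (tunit one (Suc k) ()) (tunit one (Suc k) ())"
  shows "comp_op P E k \<in> cells (G 1 1) (Suc k)" "src (G 1 1) k (comp_op P E k) = gid E 1 k ()"
    "tgt (G 1 1) k (comp_op P E k) = gid E 1 k ()"
    "fst (proj E 1 1 (Suc k) (comp_op P E k)) = pid P 1"
    "ar (G 1 1) (Suc k) (comp_op P E k) = \<pi> k"
proof -
  have u: "tunit one (Suc k) () \<in> cells (Tfree one) (Suc k)" by (simp add: tunit_cell)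
  have st: "src (Tfree one) k (tunit one (Suc k) ()) = tunit one k ()"
    "tgt (Tfree one) k (tunit one (Suc k) ()) = tunit one k ()"
    by (simp_all add: tunit_bd[OF globular_one])
  have st': "src (Tfree one) k (tunit one (Suc k) ()) = tgt (Tfree one) k (tunit one (Suc k) ())"
    by (simp add: st)
  have t: "\<pi> k \<in> cells (Tfree one) (Suc k)" "src (Tfree one) k (\<pi> k) = tunit one k ()"
    "tgt (Tfree one) k (\<pi> k) = tunit one k ()"
    by (simp_all add: \<pi>_def tcomp_cell[OF globular_one u u st'] st)
  have p: "proj E 1 1 k (gid E 1 k ()) = (pid P 1, src (Tfree one) k (\<pi> k))"
    "proj E 1 1 k (gid E 1 k ()) = (pid P 1, tgt (Tfree one) k (\<pi> k))"
    by (simp_all add: proj_gid t)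
  have co: "comp_op P E k = contr E 1 1 k (pid P 1, \<pi> k) (gid E 1 k ()) (gid E 1 k ())"
    by (simp add: comp_op_def \<pi>_def)
  note c = contr[OF parallel_gid id_closed t(1) p, folded co]
  show "comp_op P E k \<in> cells (G 1 1) (Suc k)" "src (G 1 1) k (comp_op P E k) = gid E 1 k ()"
    "tgt (G 1 1) k (comp_op P E k) = gid E 1 k ()"
    "fst (proj E 1 1 (Suc k) (comp_op P E k)) = pid P 1"
    by (simp_all add: c)
  show "ar (G 1 1) (Suc k) (comp_op P E k) = \<pi> k"
    using proj_ar[OF c(1)] c(4) by simp
qed

section \<open>Unary operations applied to words of cells\<close>

text \<open>The cell of \<open>gcol E m n\<close> whose action first lets the letters of
  \<open>w\<close> act and then applies \<open>o1\<close> to the results in each entry.\<close>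

definition apply_op :: "nat \<Rightarrow> nat \<Rightarrow> nat \<Rightarrow> 'e \<Rightarrow> 'e sterm set \<Rightarrow> 'e" where
  "apply_op m n k o1 w = gcomp E m n n k (sum_op E n k o1, w)"

context
  fixes o1 w m n k
  assumes o1: "o1 \<in> cells (G 1 1) k" and w: "w \<in> cells (Tfree (G m n)) k"
    and shape: "shape k w = ar (G 1 1) k o1"
begin

lemma apply_op_in_box: "(sum_op E n k o1, w) \<in> cells (box (G n n) (G m n)) k"
  using w shape sum_op_cell[OF o1] by (simp add: box_cells)

lemma apply_op_cell: "apply_op m n k o1 w \<in> cells (G m n) k"
  "ar (G m n) k (apply_op m n k o1 w) = word_arity (G m n) k w"
  using coll_mapD(2,3)[OF gcomp_map apply_op_in_box] by (simp_all add: apply_op_def)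

lemma proj_apply_op:
  assumes "fst (proj E 1 1 k o1) = pid P 1"
    and "word_index (hom P m n) k (tmap (copies (hom P m n)) (proj E m n) k w) = f" "f \<in> hom P m n"
  shows "fst (proj E m n k (apply_op m n k o1 w)) = f"
  using proj_gcomp[OF apply_op_in_box] proj_sum_op[OF o1 assms(1)] assms
  by (simp add: apply_op_def comp_id_left)

end

lemma apply_op_bd:
  assumes "o1 \<in> cells (G 1 1) (Suc k)" "w \<in> cells (Tfree (G m n)) (Suc k)"
    "shape (Suc k) w = ar (G 1 1) (Suc k) o1"
  shows "src (G m n) k (apply_op m n (Suc k) o1 w) =
      apply_op m n k (src (G 1 1) k o1) (src (Tfree (G m n)) k w)"
    "tgt (G m n) k (apply_op m n (Suc k) o1 w) =
      apply_op m n k (tgt (G 1 1) k o1) (tgt (Tfree (G m n)) k w)"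
  using coll_mapD(4,5)[OF gcomp_map apply_op_in_box[OF assms]] sum_op_bd[OF assms(1), of n]
  by (simp_all add: apply_op_def)

text \<open>This is \<open>action_comp\<close> on a word \<open>W\<close> of pairs of a cell and a
  word. The first components form the word to compose with, the second ones are flattened to the
  word acted upon, and letting each pair act gives the right-hand side.\<close>

lemma apply_op_action:
  defines "B \<equiv> \<lambda>m n. box (G m n) (Apow m)"
  assumes o1: "o1 \<in> cells (G 1 1) k" and W: "W \<in> cells (Tfree (B m n)) k"
    and shape: "shape k W = ar (G 1 1) k o1"
  shows "\<Omega> m n k (apply_op m n k o1 (tmap (G m n) (\<lambda>_. fst) k W),
      tmult (Apow m) k (tmap (Tfree (Apow m)) (\<lambda>_. snd) k W)) =
    \<Omega> n n k (sum_op E n k o1, tmap (Apow n) (\<Omega> m n) k W)"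
proof -
  have gB: "globular_set (B m n)" unfolding B_def by (rule globular_box[OF collG globPow])
  have "(sum_op E n k o1, W) \<in> cells (box (G n n) (box (G m n) (Apow m))) k"
    using sum_op_cell[OF o1] W shape by (simp add: box_cells B_def)
  from action_comp[OF this]
  have "\<Omega> n n k (sum_op E n k o1, tmap (Apow n) (\<Omega> m n) k W) =
      \<Omega> m n k (apply_op m n k o1 (tmap (G m n) (\<lambda>_. fst) k W),
        tmap (Apow m) (\<lambda>_ x. x) k (tmult (Apow m) k (tmap (Tfree (Apow m)) (\<lambda>_. snd) k W)))"
    by (simp add: box_map_def box_assoc_def apply_op_def)
  moreover have "tmap (Tfree (Apow m)) (\<lambda>_. snd) k W \<in> cells (Tfree (Tfree (Apow m))) k"
    using W unfolding B_def
    by (intro tmap_cell[OF globular_box[OF collG globPow] globular_Tfree[OF globPow] glob_map_box_snd])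
  then have "tmap (Apow m) (\<lambda>_ x. x) k (tmult (Apow m) k (tmap (Tfree (Apow m)) (\<lambda>_. snd) k W)) =
      tmult (Apow m) k (tmap (Tfree (Apow m)) (\<lambda>_. snd) k W)"
    by (intro tmap_ident[OF globPow] tmult_cell[OF globPow]) simp_all
  ultimately show ?thesis by simp
qed

lemma action_arity:
  assumes "(x, w) \<in> cells (box (G m n) (Apow m)) k"
  shows "fst (\<Omega> m n k (x, w)) = word_arity (Apow m) k w"
  using coll_mapD(3)[OF action_map assms] by (cases "\<Omega> m n k (x, w)") simp

lemma sum_op_action_arity:
  assumes "o1 \<in> cells (G 1 1) k" "V \<in> cells (Tfree (Apow n)) k" "shape k V = ar (G 1 1) k o1"
  shows "\<Omega> n n k (sum_op E n k o1, V) = (word_arity (Apow n) k V,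
    map (\<lambda>i. hd (snd (\<Omega> 1 1 k (o1, tmap (Apow 1) (\<lambda>_. component i) k V)))) [0..<n])"
proof -
  have "(sum_op E n k o1, V) \<in> cells (box (G n n) (Apow n)) k"
    using assms sum_op_cell[OF assms(1)] by (simp add: box_cells)
  from action_arity[OF this] sum_op_action[OF assms] show ?thesis
    by (metis prod.collapse)
qed

text \<open>This cell and \<open>lift_comp\<close> are built so that their actions are
  \<open>wid\<close> and \<open>wcomp\<close> of the given actions, while they live in
  \<open>gcol E m n\<close>, where the contraction can connect them.\<close>

definition lift_id :: "nat \<Rightarrow> nat \<Rightarrow> nat \<Rightarrow> 'e \<Rightarrow> 'e" where
  "lift_id m n k x = apply_op m n (Suc k) (id_op P E k) (tid (G m n) k (tunit (G m n) k x))"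

definition lift_comp :: "nat \<Rightarrow> nat \<Rightarrow> nat \<Rightarrow> 'e \<Rightarrow> 'e \<Rightarrow> 'e" where
  "lift_comp m n k h g = apply_op m n (Suc k) (comp_op P E k)
     (tcomp (G m n) (Suc k) k (tunit (G m n) (Suc k) h) (tunit (G m n) (Suc k) g))"

text \<open>Nothing forces the sum of \<open>n\<close> identities on \<open>1\<close> to be the identity on \<open>n\<close>, so \<open>lift_id m n k x\<close>
  runs from \<open>lift_gid m n k x\<close> to itself and not from \<open>x\<close> to \<open>x\<close>; the composite of \<open>h\<close> and \<open>g\<close> is
  shifted in the same way, and therefore the two can still be parallel.\<close>

definition lift_gid :: "nat \<Rightarrow> nat \<Rightarrow> nat \<Rightarrow> 'e \<Rightarrow> 'e" where
  "lift_gid m n k x = apply_op m n k (gid E 1 k ()) (tunit (G m n) k x)"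

text \<open>The underlying operation is unchanged because the sum of the unary operations lies over
  an identity of \<open>P\<close>; the arity is read off from the word.\<close>

lemma lift_id:
  assumes x: "x \<in> cells (G m n) k"
  shows "lift_id m n k x \<in> cells (G m n) (Suc k)"
    "src (G m n) k (lift_id m n k x) = lift_gid m n k x" "tgt (G m n) k (lift_id m n k x) = lift_gid m n k x"
    "proj E m n (Suc k) (lift_id m n k x) = (fst (proj E m n k x), tid one k (ar (G m n) k x))"
proof -
  have u: "tunit (G m n) k x \<in> cells (Tfree (G m n)) k" by (rule tunit_cell[OF x])
  have s: "shape (Suc k) (tid (G m n) k (tunit (G m n) k x)) = ar (G 1 1) (Suc k) (id_op P E k)"
    by (simp add: shape_tid[OF globG u] shape_tunit[OF globG x] id_op(5))
  note w = id_op(1) tid_cell[OF u] s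
  show c: "lift_id m n k x \<in> cells (G m n) (Suc k)"
    unfolding lift_id_def by (rule apply_op_cell(1)[OF w])
  show "src (G m n) k (lift_id m n k x) = lift_gid m n k x" "tgt (G m n) k (lift_id m n k x) = lift_gid m n k x"
    by (simp_all add: lift_id_def lift_gid_def apply_op_bd[OF w] id_op tid_bd[OF globG u])
  have "proj E m n k x = (fst (proj E m n k x), ar (G m n) k x)" by (rule proj_ar[OF x])
  then have "word_index (hom P m n) (Suc k) (tmap (copies (hom P m n)) (proj E m n) (Suc k)
      (tid (G m n) k (tunit (G m n) k x))) = fst (proj E m n k x)"
    using word_index_tid[OF proj_hom[OF x] ar_cell[OF collG x]]
    by (simp add: tmap_tid[OF globG globular_copies coll_mapD(1)[OF proj_map] u]
        tmap_tunit[OF globG globular_copies coll_mapD(1)[OF proj_map] x])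
  then have "fst (proj E m n (Suc k) (lift_id m n k x)) = fst (proj E m n k x)"
    unfolding lift_id_def by (rule proj_apply_op[OF w id_op(4) _ proj_hom[OF x]])
  moreover have "ar (G m n) (Suc k) (lift_id m n k x) = tid one k (ar (G m n) k x)"
    by (simp add: lift_id_def apply_op_cell(2)[OF w] word_arity_tid[OF collG u] word_arity_tunit[OF collG x])
  ultimately show "proj E m n (Suc k) (lift_id m n k x) = (fst (proj E m n k x), tid one k (ar (G m n) k x))"
    using proj_ar[OF c] by simp
qed

lemma lift_comp:
  assumes h: "h \<in> cells (G m n) (Suc k)" and g: "g \<in> cells (G m n) (Suc k)"
    and hg: "src (G m n) k h = tgt (G m n) k g"
    and f: "fst (proj E m n (Suc k) h) = fst (proj E m n (Suc k) g)"
  shows "lift_comp m n k h g \<in> cells (G m n) (Suc k)"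
    "src (G m n) k (lift_comp m n k h g) = lift_gid m n k (src (G m n) k g)"
    "tgt (G m n) k (lift_comp m n k h g) = lift_gid m n k (tgt (G m n) k h)"
    "proj E m n (Suc k) (lift_comp m n k h g) = (fst (proj E m n (Suc k) g),
       tcomp one (Suc k) k (ar (G m n) (Suc k) h) (ar (G m n) (Suc k) g))"
proof -
  let ?h = "tunit (G m n) (Suc k) h" and ?g = "tunit (G m n) (Suc k) g"
  have u: "?h \<in> cells (Tfree (G m n)) (Suc k)" "?g \<in> cells (Tfree (G m n)) (Suc k)"
    by (rule tunit_cell[OF h], rule tunit_cell[OF g])
  have st: "src (Tfree (G m n)) k ?h = tgt (Tfree (G m n)) k ?g"
    by (simp add: tunit_bd[OF globG] h g hg)
  note t = tcomp_cell[OF globG u st]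
  have s: "shape (Suc k) (tcomp (G m n) (Suc k) k ?h ?g) = ar (G 1 1) (Suc k) (comp_op P E k)"
    by (simp add: shape_tcomp[OF globG u st] shape_tunit[OF globG h] shape_tunit[OF globG g] comp_op(5))
  note w = comp_op(1) t(1) s
  show c: "lift_comp m n k h g \<in> cells (G m n) (Suc k)"
    unfolding lift_comp_def by (rule apply_op_cell(1)[OF w])
  show "src (G m n) k (lift_comp m n k h g) = lift_gid m n k (src (G m n) k g)"
    "tgt (G m n) k (lift_comp m n k h g) = lift_gid m n k (tgt (G m n) k h)"
    by (simp_all add: lift_comp_def lift_gid_def apply_op_bd[OF w] comp_op t tunit_bd[OF globG] h g)
  let ?f = "fst (proj E m n (Suc k) g)" and ?a = "ar (G m n) (Suc k)"
  have p: "proj E m n (Suc k) h = (?f, ?a h)" "proj E m n (Suc k) g = (?f, ?a g)"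
    using proj_ar[OF h] proj_ar[OF g] f by simp_all
  have a: "src (Tfree one) k (?a h) = tgt (Tfree one) k (?a g)"
    using hg by (simp flip: ar_bd[OF collG h] ar_bd[OF collG g])
  note pm = globG globular_copies coll_mapD(1)[OF proj_map]
  have "tmap (copies (hom P m n)) (proj E m n) (Suc k) (tcomp (G m n) (Suc k) k ?h ?g) =
      tcomp (copies (hom P m n)) (Suc k) k (tunit (copies (hom P m n)) (Suc k) (?f, ?a h))
        (tunit (copies (hom P m n)) (Suc k) (?f, ?a g))"
    unfolding tmap_tcomp[OF pm u st] tmap_tunit[OF pm h] tmap_tunit[OF pm g] p(1)
    using p(2) by simp
  then have "word_index (hom P m n) (Suc k) (tmap (copies (hom P m n)) (proj E m n) (Suc k)
      (tcomp (G m n) (Suc k) k ?h ?g)) = ?f"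
    using word_index_tcomp[OF proj_hom[OF g] ar_cell[OF collG h] ar_cell[OF collG g] a] by simp
  then have "fst (proj E m n (Suc k) (lift_comp m n k h g)) = ?f"
    unfolding lift_comp_def by (rule proj_apply_op[OF w comp_op(4) _ proj_hom[OF g]])
  moreover have "?a (lift_comp m n k h g) = tcomp one (Suc k) k (?a h) (?a g)"
    by (simp add: lift_comp_def apply_op_cell(2)[OF w] word_arity_tcomp[OF collG u st]
        word_arity_tunit[OF collG h] word_arity_tunit[OF collG g])
  ultimately show "proj E m n (Suc k) (lift_comp m n k h g) = (?f, tcomp one (Suc k) k (?a h) (?a g))"
    using proj_ar[OF c] by simp
qed

lemma lift_id_action:
  assumes xv: "(x, v) \<in> cells (box (G m n) (Apow m)) k"
  shows "\<Omega> m n (Suc k) (lift_id m n k x, tid (Apow m) k v) =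
    wid (pow_wcat P E A \<Omega> n) k (\<Omega> m n k (x, v))"
proof -
  let ?B = "box (G m n) (Apow m)"
  note gB = globular_box[OF collG globPow, of m n m]
  \<comment> \<open>The identity on the one-letter word \<open>(x, v)\<close>. Facts
    \<open>1\<close>, \<open>2\<close> and \<open>3\<close> below compute the three images of it
    that occur in \<open>apply_op_action\<close>.\<close>
  let ?W = "tid ?B k (tunit ?B k (x, v))"
  have u: "tunit ?B k (x, v) \<in> cells (Tfree ?B) k" by (rule tunit_cell[OF xv])
  have W: "?W \<in> cells (Tfree ?B) (Suc k)" by (rule tid_cell[OF u])
  have s: "shape (Suc k) ?W = ar (G 1 1) (Suc k) (id_op P E k)"
    by (simp add: shape_tid[OF gB u] shape_tunit[OF gB xv] id_op(5))
  have v: "v \<in> cells (Tfree (Apow m)) k" using xv by (simp add: box_cells)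
  have 1: "tmap (G m n) (\<lambda>_. fst) (Suc k) ?W = tid (G m n) k (tunit (G m n) k x)"
    by (simp add: tmap_tid[OF gB globG glob_map_box_fst u] tmap_tunit[OF gB globG glob_map_box_fst xv])
  have 2: "tmult (Apow m) (Suc k) (tmap (Tfree (Apow m)) (\<lambda>_. snd) (Suc k) ?W) = tid (Apow m) k v"
    by (simp add: tmap_tid[OF gB globular_Tfree[OF globPow] glob_map_box_snd u]
        tmap_tunit[OF gB globular_Tfree[OF globPow] glob_map_box_snd xv]
        tmult_tid[OF globPow tunit_cell[OF v]] tmult_tunit[OF globPow v])
  obtain \<theta> xs where X: "\<Omega> m n k (x, v) = (\<theta>, xs)" by (cases "\<Omega> m n k (x, v)")
  have Xc: "(\<theta>, xs) \<in> cells (Apow n) k" using coll_mapD(2)[OF action_map xv] by (simp add: X)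
  let ?X = "tunit (Apow n) k (\<theta>, xs)"
  have 3: "tmap (Apow n) (\<Omega> m n) (Suc k) ?W = tid (Apow n) k ?X"
    by (simp add: tmap_tid[OF gB globPow coll_mapD(1)[OF action_map] u]
        tmap_tunit[OF gB globPow coll_mapD(1)[OF action_map] xv] X)
  have uX: "?X \<in> cells (Tfree (Apow n)) k" by (rule tunit_cell[OF Xc])
  have sX: "shape (Suc k) (tid (Apow n) k ?X) = ar (G 1 1) (Suc k) (id_op P E k)"
    by (simp add: shape_tid[OF globPow uX] shape_tunit[OF globPow Xc] id_op(5))
  have "\<Omega> m n (Suc k) (lift_id m n k x, tid (Apow m) k v) =
      \<Omega> n n (Suc k) (sum_op E n (Suc k) (id_op P E k), tid (Apow n) k ?X)"
    using apply_op_action[OF id_op(1) W s] by (simp only: 1 2 3 lift_id_def)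
  also have "\<dots> = (word_arity (Apow n) (Suc k) (tid (Apow n) k ?X), map (\<lambda>i. hd (snd (\<Omega> 1 1 (Suc k)
      (id_op P E k, tmap (Apow 1) (\<lambda>_. component i) (Suc k) (tid (Apow n) k ?X))))) [0..<n])"
    by (rule sum_op_action_arity[OF id_op(1) tid_cell[OF uX] sX])
  also have "word_arity (Apow n) (Suc k) (tid (Apow n) k ?X) = tid one k \<theta>"
    by (simp add: word_arity_tid[OF collPow uX] word_arity_tunit[OF collPow Xc])
  also have "map (\<lambda>i. hd (snd (\<Omega> 1 1 (Suc k)
      (id_op P E k, tmap (Apow 1) (\<lambda>_. component i) (Suc k) (tid (Apow n) k ?X))))) [0..<n] =
      map (alg_id P E A \<Omega> k) xs"
  proof (rule nth_equalityI)
    fix i assume "i < length (map (\<lambda>i. hd (snd (\<Omega> 1 1 (Suc k)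
      (id_op P E k, tmap (Apow 1) (\<lambda>_. component i) (Suc k) (tid (Apow n) k ?X))))) [0..<n])"
    then have i: "i < n" "i < length xs" using Xc by (simp_all add: pow_coll_cells)
    \<comment> \<open>The word \<open>cell_word\<close> records the arity of its entry, which has to
      be the common shape \<open>\<theta>\<close> of all entries.\<close>
    then have "ar A k (xs ! i) = \<theta>" using Xc by (simp add: pow_coll_cells)
    then have "tmap (Apow 1) (\<lambda>_. component i) (Suc k) (tid (Apow n) k ?X) =
        tid (Apow 1) k (cell_word A k (xs ! i))"
      by (simp add: tmap_tid[OF globPow globPow glob_map_component[OF i(1)] uX]
          tmap_tunit[OF globPow globPow glob_map_component[OF i(1)] Xc] cell_word_def)
    then show "map (\<lambda>i. hd (snd (\<Omega> 1 1 (Suc k)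
      (id_op P E k, tmap (Apow 1) (\<lambda>_. component i) (Suc k) (tid (Apow n) k ?X))))) [0..<n] ! i =
      map (alg_id P E A \<Omega> k) xs ! i"
      using i by (simp add: alg_id_def)
  qed (use Xc in \<open>simp add: pow_coll_cells\<close>)
  finally show ?thesis by (simp add: X pow_wcat_def)
qed

lemma lift_comp_action:
  assumes h: "(h, v') \<in> cells (box (G m n) (Apow m)) (Suc k)"
    and g: "(g, v) \<in> cells (box (G m n) (Apow m)) (Suc k)"
    and hg: "src (G m n) k h = tgt (G m n) k g" and vv: "src (Tfree (Apow m)) k v' = tgt (Tfree (Apow m)) k v"
  shows "\<Omega> m n (Suc k) (lift_comp m n k h g, tcomp (Apow m) (Suc k) k v' v) =
    wcomp (pow_wcat P E A \<Omega> n) k (\<Omega> m n (Suc k) (h, v')) (\<Omega> m n (Suc k) (g, v))"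
proof -
  let ?B = "box (G m n) (Apow m)"
  note gB = globular_box[OF collG globPow, of m n m]
  let ?h = "tunit ?B (Suc k) (h, v')" and ?g = "tunit ?B (Suc k) (g, v)"
  let ?W = "tcomp ?B (Suc k) k ?h ?g"
  have u: "?h \<in> cells (Tfree ?B) (Suc k)" "?g \<in> cells (Tfree ?B) (Suc k)"
    by (rule tunit_cell[OF h], rule tunit_cell[OF g])
  have st: "src (Tfree ?B) k ?h = tgt (Tfree ?B) k ?g"
    by (simp add: tunit_bd[OF gB] h g hg vv)
  have W: "?W \<in> cells (Tfree ?B) (Suc k)" by (rule tcomp_cell(1)[OF gB u st])
  have s: "shape (Suc k) ?W = ar (G 1 1) (Suc k) (comp_op P E k)"
    by (simp add: shape_tcomp[OF gB u st] shape_tunit[OF gB h] shape_tunit[OF gB g] comp_op(5))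
  have v: "v \<in> cells (Tfree (Apow m)) (Suc k)" "v' \<in> cells (Tfree (Apow m)) (Suc k)"
    using h g by (simp_all add: box_cells)
  have 1: "tmap (G m n) (\<lambda>_. fst) (Suc k) ?W =
      tcomp (G m n) (Suc k) k (tunit (G m n) (Suc k) h) (tunit (G m n) (Suc k) g)"
    by (simp add: tmap_tcomp[OF gB globG glob_map_box_fst u st]
        tmap_tunit[OF gB globG glob_map_box_fst h] tmap_tunit[OF gB globG glob_map_box_fst g])
  have st2: "src (Tfree (Tfree (Apow m))) k (tunit (Tfree (Apow m)) (Suc k) v') =
      tgt (Tfree (Tfree (Apow m))) k (tunit (Tfree (Apow m)) (Suc k) v)"
    by (simp add: tunit_bd[OF globular_Tfree[OF globPow]] v vv)
  have 2: "tmult (Apow m) (Suc k) (tmap (Tfree (Apow m)) (\<lambda>_. snd) (Suc k) ?W) =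
      tcomp (Apow m) (Suc k) k v' v"
    by (simp add: tmap_tcomp[OF gB globular_Tfree[OF globPow] glob_map_box_snd u st]
        tmap_tunit[OF gB globular_Tfree[OF globPow] glob_map_box_snd h]
        tmap_tunit[OF gB globular_Tfree[OF globPow] glob_map_box_snd g]
        tmult_tcomp[OF globPow tunit_cell tunit_cell st2] tmult_tunit[OF globPow] v)
  obtain \<theta> hs where H: "\<Omega> m n (Suc k) (h, v') = (\<theta>, hs)" by (cases "\<Omega> m n (Suc k) (h, v')")
  obtain \<theta>' gs where G': "\<Omega> m n (Suc k) (g, v) = (\<theta>', gs)" by (cases "\<Omega> m n (Suc k) (g, v)")
  have Hc: "(\<theta>, hs) \<in> cells (Apow n) (Suc k)" using coll_mapD(2)[OF action_map h] by (simp add: H)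
  have Gc: "(\<theta>', gs) \<in> cells (Apow n) (Suc k)" using coll_mapD(2)[OF action_map g] by (simp add: G')
  let ?H = "tunit (Apow n) (Suc k) (\<theta>, hs)" and ?G = "tunit (Apow n) (Suc k) (\<theta>', gs)"
  have 3: "tmap (Apow n) (\<Omega> m n) (Suc k) ?W = tcomp (Apow n) (Suc k) k ?H ?G"
    by (simp add: tmap_tcomp[OF gB globPow coll_mapD(1)[OF action_map] u st] H G'
        tmap_tunit[OF gB globPow coll_mapD(1)[OF action_map] h]
        tmap_tunit[OF gB globPow coll_mapD(1)[OF action_map] g])
  have U: "?H \<in> cells (Tfree (Apow n)) (Suc k)" "?G \<in> cells (Tfree (Apow n)) (Suc k)"
    by (rule tunit_cell[OF Hc], rule tunit_cell[OF Gc])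
  \<comment> \<open>The results are composable because the action respects boundaries and the
    letters \<open>?h\<close> and \<open>?g\<close> are composable.\<close>
  have st3: "src (Tfree (Apow n)) k ?H = tgt (Tfree (Apow n)) k ?G"
    using tmap_bd(1)[OF gB globPow coll_mapD(1)[OF action_map] u(1)]
      tmap_bd(2)[OF gB globPow coll_mapD(1)[OF action_map] u(2)] st
    by (simp add: H G' tmap_tunit[OF gB globPow coll_mapD(1)[OF action_map] h]
        tmap_tunit[OF gB globPow coll_mapD(1)[OF action_map] g])
  note T = tcomp_cell(1)[OF globPow U st3]
  have sT: "shape (Suc k) (tcomp (Apow n) (Suc k) k ?H ?G) = ar (G 1 1) (Suc k) (comp_op P E k)"
    by (simp add: shape_tcomp[OF globPow U st3] shape_tunit[OF globPow Hc]
        shape_tunit[OF globPow Gc] comp_op(5))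
  have "\<Omega> m n (Suc k) (lift_comp m n k h g, tcomp (Apow m) (Suc k) k v' v) =
      \<Omega> n n (Suc k) (sum_op E n (Suc k) (comp_op P E k), tcomp (Apow n) (Suc k) k ?H ?G)"
    using apply_op_action[OF comp_op(1) W s] by (simp only: 1 2 3 lift_comp_def)
  also have "\<dots> = (word_arity (Apow n) (Suc k) (tcomp (Apow n) (Suc k) k ?H ?G),
      map (\<lambda>i. hd (snd (\<Omega> 1 1 (Suc k) (comp_op P E k,
        tmap (Apow 1) (\<lambda>_. component i) (Suc k) (tcomp (Apow n) (Suc k) k ?H ?G))))) [0..<n])"
    by (rule sum_op_action_arity[OF comp_op(1) T sT])
  also have "word_arity (Apow n) (Suc k) (tcomp (Apow n) (Suc k) k ?H ?G) = tcomp one (Suc k) k \<theta> \<theta>'"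
    by (simp add: word_arity_tcomp[OF collPow U st3] word_arity_tunit[OF collPow Hc]
        word_arity_tunit[OF collPow Gc])
  also have "map (\<lambda>i. hd (snd (\<Omega> 1 1 (Suc k) (comp_op P E k,
        tmap (Apow 1) (\<lambda>_. component i) (Suc k) (tcomp (Apow n) (Suc k) k ?H ?G))))) [0..<n] =
      map2 (alg_comp P E A \<Omega> k) hs gs"
  proof (rule nth_equalityI)
    fix i assume "i < length (map (\<lambda>i. hd (snd (\<Omega> 1 1 (Suc k) (comp_op P E k,
        tmap (Apow 1) (\<lambda>_. component i) (Suc k) (tcomp (Apow n) (Suc k) k ?H ?G))))) [0..<n])"
    then have i: "i < n" "i < length hs" "i < length gs"
      using Hc Gc by (simp_all add: pow_coll_cells)
    then have "ar A (Suc k) (hs ! i) = \<theta>" "ar A (Suc k) (gs ! i) = \<theta>'"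
      using Hc Gc by (simp_all add: pow_coll_cells)
    then have "tmap (Apow 1) (\<lambda>_. component i) (Suc k) (tcomp (Apow n) (Suc k) k ?H ?G) =
        tcomp (Apow 1) (Suc k) k (cell_word A (Suc k) (hs ! i)) (cell_word A (Suc k) (gs ! i))"
      by (simp add: tmap_tcomp[OF globPow globPow glob_map_component[OF i(1)] U st3]
          tmap_tunit[OF globPow globPow glob_map_component[OF i(1)] Hc]
          tmap_tunit[OF globPow globPow glob_map_component[OF i(1)] Gc] cell_word_def)
    then show "map (\<lambda>i. hd (snd (\<Omega> 1 1 (Suc k) (comp_op P E k,
        tmap (Apow 1) (\<lambda>_. component i) (Suc k) (tcomp (Apow n) (Suc k) k ?H ?G))))) [0..<n] ! i =
      map2 (alg_comp P E A \<Omega> k) hs gs ! i"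
      using i by (simp add: alg_comp_def)
  qed (use Hc Gc in \<open>simp add: pow_coll_cells\<close>)
  finally show ?thesis by (simp add: H G' pow_wcat_def)
qed

section \<open>Weak equivalences\<close>

lemma parallel_bd:
  assumes "g \<in> cells (G m n) (Suc k)"
  shows "parallel (G m n) k (src (G m n) k g) (tgt (G m n) k g)"
    "parallel (G m n) k (tgt (G m n) k g) (src (G m n) k g)"
  using globG[of m n] assms by (auto simp: parallel_def globular_set_def split: nat.split)

lemma action_cell:
  assumes "(x, v) \<in> cells (box (G m n) (Apow m)) k"
  shows "\<Omega> m n k (x, v) \<in> cells (Apow n) k"
  by (rule coll_mapD(2)[OF action_map assms])

lemma action_bd:
  assumes "(x, v) \<in> cells (box (G m n) (Apow m)) (Suc k)"
  shows "src (Apow n) k (\<Omega> m n (Suc k) (x, v)) = \<Omega> m n k (src (G m n) k x, src (Tfree (Apow m)) k v)"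
    "tgt (Apow n) k (\<Omega> m n (Suc k) (x, v)) = \<Omega> m n k (tgt (G m n) k x, tgt (Tfree (Apow m)) k v)"
  using coll_mapD(4,5)[OF action_map assms, symmetric] by simp_all

lemma in_box_tid:
  assumes v: "v \<in> cells (Tfree (Apow m)) k" and x: "x \<in> cells (G m n) (Suc k)"
    and p: "proj E m n (Suc k) x = (f, tid one k (shape k v))"
  shows "(x, tid (Apow m) k v) \<in> cells (box (G m n) (Apow m)) (Suc k)"
  using proj_ar[OF x] x p tid_cell[OF v] by (simp add: box_cells shape_tid[OF globPow v])

text \<open>One round of the witness condition. The cells obtained lie again over identities, one
  dimension up for the unit and counit, so the round can be repeated forever.\<close>

lemma weak_inverse:
  fixes m n k v f
  defines "C \<equiv> pow_wcat P E A \<Omega> n" and "\<theta> \<equiv> tid one k (shape k v)"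
    and "v1 \<equiv> tid (Apow m) k v"
  defines "act \<equiv> \<lambda>g. \<Omega> m n (Suc k) (g, v1)"
    and "act' \<equiv> \<lambda>g. \<Omega> m n (Suc (Suc k)) (g, tid (Apow m) (Suc k) v1)"
  assumes v: "v \<in> cells (Tfree (Apow m)) k" and f: "f \<in> hom P m n"
    and g: "g \<in> cells (G m n) (Suc k)" and pg: "proj E m n (Suc k) g = (f, \<theta>)"
  obtains g' i e where "g' \<in> cells (G m n) (Suc k)" "proj E m n (Suc k) g' = (f, \<theta>)"
    "i \<in> cells (G m n) (Suc (Suc k))" "proj E m n (Suc (Suc k)) i = (f, tid one (Suc k) \<theta>)"
    "e \<in> cells (G m n) (Suc (Suc k))" "proj E m n (Suc (Suc k)) e = (f, tid one (Suc k) \<theta>)"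
    "src C k (act g') = tgt C k (act g)" "tgt C k (act g') = src C k (act g)"
    "src C (Suc k) (act' i) = wid C k (src C k (act g))"
    "tgt C (Suc k) (act' i) = wcomp C k (act g') (act g)"
    "src C (Suc k) (act' e) = wcomp C k (act g) (act g')"
    "tgt C (Suc k) (act' e) = wid C k (tgt C k (act g))"
proof -
  let ?s = "shape k v" and ?x = "src (G m n) k g" and ?y = "tgt (G m n) k g"
  have s: "?s \<in> cells (Tfree one) k" by (rule shape_cell[OF globPow v])
  have \<theta>: "\<theta> \<in> cells (Tfree one) (Suc k)" "src (Tfree one) k \<theta> = ?s" "tgt (Tfree one) k \<theta> = ?s"
    unfolding \<theta>_def by (rule tid_cell[OF s], (rule tid_bd[OF globular_one s])+)
  have \<theta>': "tid one (Suc k) \<theta> \<in> cells (Tfree one) (Suc (Suc k))"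
    "src (Tfree one) (Suc k) (tid one (Suc k) \<theta>) = \<theta>" "tgt (Tfree one) (Suc k) (tid one (Suc k) \<theta>) = \<theta>"
    by (rule tid_cell[OF \<theta>(1)], (rule tid_bd[OF globular_one \<theta>(1)])+)
  have ag: "ar (G m n) (Suc k) g = \<theta>" using proj_ar[OF g] pg by simp
  have xy: "?x \<in> cells (G m n) k" "?y \<in> cells (G m n) k" by (rule bd_cell[OF collG g])+
  have pxy: "proj E m n k ?x = (f, ?s)" "proj E m n k ?y = (f, ?s)"
    using proj_bd[OF g] by (simp_all add: ag pg \<theta>)
  have axy: "ar (G m n) k ?x = ?s" "ar (G m n) k ?y = ?s"
    using proj_ar[OF xy(1)] proj_ar[OF xy(2)] pxy by simp_all
  \<comment> \<open>The shape \<open>\<theta>\<close> is an identity and both ends of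
    \<open>g\<close> lie over the same cell, so the contraction may be applied with the ends
    exchanged.\<close>
  define g' where "g' = contr E m n k (f, \<theta>) ?y ?x"
  note g' = contr[OF parallel_bd(2)[OF g] f \<theta>(1), unfolded \<theta>, OF pxy(2,1), folded g'_def]
  have ag': "ar (G m n) (Suc k) g' = \<theta>" using proj_ar[OF g'(1)] g'(4) by simp
  have tt: "tcomp one (Suc k) k \<theta> \<theta> = \<theta>" unfolding \<theta>_def by (rule tcomp_tid_tid[OF globular_one s])
  note c1 = lift_comp[OF g'(1) g g'(2), unfolded pg g'(4), OF refl, unfolded ag ag' tt fst_conv]
  note c2 = lift_comp[OF g g'(1) g'(3)[symmetric], unfolded pg g'(4), OF refl, unfolded ag ag' tt fst_conv]
  note ix = lift_id[OF xy(1), unfolded pxy axy fst_conv, folded \<theta>_def]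
  note iy = lift_id[OF xy(2), unfolded pxy axy fst_conv, folded \<theta>_def]
  \<comment> \<open>Both cells run from \<open>lift_gid m n k ?x\<close> to itself; the shift caused
    by summing identities is the same on both sides.\<close>
  have "parallel (G m n) (Suc k) (lift_id m n k ?x) (lift_comp m n k g' g)"
    by (simp add: parallel_def ix c1 g'(3))
  then have "\<exists>i. i \<in> cells (G m n) (Suc (Suc k)) \<and> src (G m n) (Suc k) i = lift_id m n k ?x \<and>
      tgt (G m n) (Suc k) i = lift_comp m n k g' g \<and> proj E m n (Suc (Suc k)) i = (f, tid one (Suc k) \<theta>)"
    using contr[of m n "Suc k" _ _ f "tid one (Suc k) \<theta>"] f \<theta>' ix(4) c1(4) by metis
  then obtain i where i: "i \<in> cells (G m n) (Suc (Suc k))" "src (G m n) (Suc k) i = lift_id m n k ?x"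
      "tgt (G m n) (Suc k) i = lift_comp m n k g' g" "proj E m n (Suc (Suc k)) i = (f, tid one (Suc k) \<theta>)"
    by blast
  have "parallel (G m n) (Suc k) (lift_comp m n k g g') (lift_id m n k ?y)"
    by (simp add: parallel_def iy c2 g'(2))
  then have "\<exists>e. e \<in> cells (G m n) (Suc (Suc k)) \<and> src (G m n) (Suc k) e = lift_comp m n k g g' \<and>
      tgt (G m n) (Suc k) e = lift_id m n k ?y \<and> proj E m n (Suc (Suc k)) e = (f, tid one (Suc k) \<theta>)"
    using contr[of m n "Suc k" _ _ f "tid one (Suc k) \<theta>"] f \<theta>' iy(4) c2(4) by metis
  then obtain e where e: "e \<in> cells (G m n) (Suc (Suc k))" "src (G m n) (Suc k) e = lift_comp m n k g g'"
      "tgt (G m n) (Suc k) e = lift_id m n k ?y" "proj E m n (Suc (Suc k)) e = (f, tid one (Suc k) \<theta>)"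
    by blast
  have C: "src C = src (Apow n)" "tgt C = tgt (Apow n)" by (simp_all add: C_def pow_wcat_def)
  have v1: "v1 \<in> cells (Tfree (Apow m)) (Suc k)" "src (Tfree (Apow m)) k v1 = v"
    "tgt (Tfree (Apow m)) k v1 = v"
    unfolding v1_def by (rule tid_cell[OF v], (rule tid_bd[OF globPow v])+)
  have sv1: "shape (Suc k) v1 = \<theta>" unfolding v1_def \<theta>_def by (rule shape_tid[OF globPow v])
  \<comment> \<open>The composite of actions is the action of \<open>lift_comp\<close> on the
    composite word. As this word is \<open>v1\<close> again, it is a boundary of what
    \<open>act'\<close> produces.\<close>
  have v11: "tcomp (Apow m) (Suc k) k v1 v1 = v1" unfolding v1_def by (rule tcomp_tid_tid[OF globPow v])
  have bx: "(?x, v) \<in> cells (box (G m n) (Apow m)) k" "(?y, v) \<in> cells (box (G m n) (Apow m)) k"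
    using xy axy v by (simp_all add: box_cells)
  have bg: "(h, v1) \<in> cells (box (G m n) (Apow m)) (Suc k)"
    if "h \<in> cells (G m n) (Suc k)" "ar (G m n) (Suc k) h = \<theta>" for h
    using that v1 by (simp add: box_cells sv1)
  note bgg = bg[OF g ag] bg[OF g'(1) ag']
  have v2: "src (Tfree (Apow m)) (Suc k) (tid (Apow m) (Suc k) v1) = v1"
    "tgt (Tfree (Apow m)) (Suc k) (tid (Apow m) (Suc k) v1) = v1"
    by (rule tid_bd[OF globPow v1(1)])+
  note bi = in_box_tid[OF v1(1) i(1), unfolded sv1, OF i(4)]
  note be = in_box_tid[OF v1(1) e(1), unfolded sv1, OF e(4)]
  have vv: "src (Tfree (Apow m)) k v1 = tgt (Tfree (Apow m)) k v1" by (simp add: v1)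
  have act_bd: "src C k (act g) = \<Omega> m n k (?x, v)" "tgt C k (act g) = \<Omega> m n k (?y, v)"
    by (simp_all add: C act_def action_bd[OF bgg(1)] v1)
  show thesis
  proof (rule that[OF g'(1,4) i(1,4) e(1,4)])
    show "src C k (act g') = tgt C k (act g)" "tgt C k (act g') = src C k (act g)"
      unfolding act_bd by (simp_all add: C act_def action_bd[OF bgg(2)] v1 g')
    show "src C (Suc k) (act' i) = wid C k (src C k (act g))"
      unfolding act_bd using lift_id_action[OF bx(1), folded v1_def C_def]
      by (simp add: C act'_def action_bd[OF bi] v2 i)
    show "tgt C (Suc k) (act' i) = wcomp C k (act g') (act g)"
      using lift_comp_action[OF bgg(2,1) g'(2) vv, folded C_def]
      by (simp add: C act'_def act_def action_bd[OF bi] v2 i v11)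
    show "src C (Suc k) (act' e) = wcomp C k (act g) (act g')"
      using lift_comp_action[OF bgg(1,2) g'(3)[symmetric] vv, folded C_def]
      by (simp add: C act'_def act_def action_bd[OF be] v2 e v11)
    show "tgt C (Suc k) (act' e) = wid C k (tgt C k (act g))"
      unfolding act_bd using lift_id_action[OF bx(2), folded v1_def C_def]
      by (simp add: C act'_def action_bd[OF be] v2 e)
  qed
qed

section \<open>The witness sets\<close>

primrec id_word :: "nat \<Rightarrow> nat \<Rightarrow> (pshape \<times> 'a list) sterm set \<Rightarrow> nat \<Rightarrow> (pshape \<times> 'a list) sterm set" where
  "id_word m k w 0 = w"
| "id_word m k w (Suc j) = tid (Apow m) (k + j) (id_word m k w j)"

lemma id_word_cell:
  "w \<in> cells (Tfree (Apow m)) k \<Longrightarrow> id_word m k w j \<in> cells (Tfree (Apow m)) (k + j)"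
  by (induction j) (simp_all add: tid_cell)

lemma pseudo_invertible_action:
  assumes w: "w \<in> cells (Tfree (Apow m)) k" and f: "f \<in> hom P m n"
    and g: "g \<in> cells (G m n) (Suc k)" and pg: "proj E m n (Suc k) g = (f, tid one k (shape k w))"
  shows "pseudo_invertible (pow_wcat P E A \<Omega> n) (k + 1) (\<Omega> m n (Suc k) (g, tid (Apow m) k w))"
proof -
  let ?C = "pow_wcat P E A \<Omega> n" and ?w = "id_word m k w"
  \<comment> \<open>Elements of \<open>W j\<close> have dimension \<open>k + 1 + j\<close>, hence
    the word with \<open>Suc j\<close> identities. Membership only asks that the acting cell lie
    over the identity on the preceding shape, the condition reproduced by
    \<open>weak_inverse\<close>.\<close>
  define W where "W j = {\<Omega> m n (Suc (k + j)) (g, ?w (Suc j)) | g. g \<in> cells (G m n) (Suc (k + j)) \<and>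
      proj E m n (Suc (k + j)) g = (f, tid one (k + j) (shape (k + j) (?w j)))}" for j
  note wj = id_word_cell[OF w]
  have dim: "k + 1 + j = Suc (k + j)" for j by linarith
  have "W j \<subseteq> cells ?C (k + 1 + j)" for j
  proof
    fix c assume "c \<in> W j"
    then obtain h where "c = \<Omega> m n (Suc (k + j)) (h, ?w (Suc j))" "h \<in> cells (G m n) (Suc (k + j))"
      "proj E m n (Suc (k + j)) h = (f, tid one (k + j) (shape (k + j) (?w j)))"
      by (auto simp: W_def)
    then show "c \<in> cells ?C (k + 1 + j)"
      using action_cell[OF in_box_tid[OF wj]] by (simp add: pow_wcat_def dim)
  qed
  moreover have "\<Omega> m n (Suc k) (g, tid (Apow m) k w) \<in> W 0"
    unfolding W_def using g pg by auto
  moreover have "\<exists>c' \<in> W j. \<exists>i \<in> W (j + 1). \<exists>e \<in> W (j + 1).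
      src ?C (k + 1 + j - 1) c' = tgt ?C (k + 1 + j - 1) c \<and>
      tgt ?C (k + 1 + j - 1) c' = src ?C (k + 1 + j - 1) c \<and>
      src ?C (k + 1 + j) i = wid ?C (k + 1 + j - 1) (src ?C (k + 1 + j - 1) c) \<and>
      tgt ?C (k + 1 + j) i = wcomp ?C (k + 1 + j - 1) c' c \<and>
      src ?C (k + 1 + j) e = wcomp ?C (k + 1 + j - 1) c c' \<and>
      tgt ?C (k + 1 + j) e = wid ?C (k + 1 + j - 1) (tgt ?C (k + 1 + j - 1) c)"
    if c: "c \<in> W j" for c j
  proof -
    obtain h where h: "c = \<Omega> m n (Suc (k + j)) (h, ?w (Suc j))" "h \<in> cells (G m n) (Suc (k + j))"
      "proj E m n (Suc (k + j)) h = (f, tid one (k + j) (shape (k + j) (?w j)))"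
      using c by (auto simp: W_def)
    obtain h' i e where
      h': "h' \<in> cells (G m n) (Suc (k + j))"
        "proj E m n (Suc (k + j)) h' = (f, tid one (k + j) (shape (k + j) (?w j)))"
      and i: "i \<in> cells (G m n) (Suc (Suc (k + j)))"
        "proj E m n (Suc (Suc (k + j))) i = (f, tid one (Suc (k + j)) (tid one (k + j) (shape (k + j) (?w j))))"
      and e: "e \<in> cells (G m n) (Suc (Suc (k + j)))"
        "proj E m n (Suc (Suc (k + j))) e = (f, tid one (Suc (k + j)) (tid one (k + j) (shape (k + j) (?w j))))"
      and eqs: "src ?C (k + j) (\<Omega> m n (Suc (k + j)) (h', ?w (Suc j))) = tgt ?C (k + j) c"
        "tgt ?C (k + j) (\<Omega> m n (Suc (k + j)) (h', ?w (Suc j))) = src ?C (k + j) c"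
        "src ?C (Suc (k + j)) (\<Omega> m n (Suc (Suc (k + j))) (i, ?w (Suc (Suc j)))) = wid ?C (k + j) (src ?C (k + j) c)"
        "tgt ?C (Suc (k + j)) (\<Omega> m n (Suc (Suc (k + j))) (i, ?w (Suc (Suc j)))) =
          wcomp ?C (k + j) (\<Omega> m n (Suc (k + j)) (h', ?w (Suc j))) c"
        "src ?C (Suc (k + j)) (\<Omega> m n (Suc (Suc (k + j))) (e, ?w (Suc (Suc j)))) =
          wcomp ?C (k + j) c (\<Omega> m n (Suc (k + j)) (h', ?w (Suc j)))"
        "tgt ?C (Suc (k + j)) (\<Omega> m n (Suc (Suc (k + j))) (e, ?w (Suc (Suc j)))) = wid ?C (k + j) (tgt ?C (k + j) c)"
      using weak_inverse[OF wj[of j] f h(2,3)] unfolding h(1) id_word.simps add_Suc_right by blast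
    have sw: "shape (Suc (k + j)) (?w (Suc j)) = tid one (k + j) (shape (k + j) (?w j))"
      by (simp add: shape_tid[OF globPow wj])
    have "\<Omega> m n (Suc (k + j)) (h', ?w (Suc j)) \<in> W j"
      unfolding W_def using h' by blast
    moreover have "\<Omega> m n (Suc (Suc (k + j))) (i, ?w (Suc (Suc j))) \<in> W (j + 1)"
      "\<Omega> m n (Suc (Suc (k + j))) (e, ?w (Suc (Suc j))) \<in> W (j + 1)"
      unfolding W_def Suc_eq_plus1[symmetric] add_Suc_right sw using i e by blast+
    moreover have "k + 1 + j - 1 = k + j" by linarith
    ultimately show ?thesis using eqs unfolding dim by (metis diff_Suc_1)
  qed
  ultimately show ?thesis
    unfolding pseudo_invertible_def by (intro conjI exI[of _ W]) auto
qed

theorem weakly_equivalent_actions: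
  assumes xy: "parallel (G m n) k x y" "proj E m n k x = proj E m n k y"
    and b: "(x, w) \<in> cells (box (G m n) (Apow m)) k" "(y, w) \<in> cells (box (G m n) (Apow m)) k"
  shows "weakly_equivalent (pow_wcat P E A \<Omega> n) k (\<Omega> m n k (x, w)) (\<Omega> m n k (y, w))"
proof -
  let ?f = "fst (proj E m n k x)" and ?\<theta> = "tid one k (shape k w)"
  have x: "x \<in> cells (G m n) k" and w: "w \<in> cells (Tfree (Apow m)) k"
    and a: "ar (G m n) k x = shape k w"
    using b by (simp_all add: box_cells)
  have s: "shape k w \<in> cells (Tfree one) k" by (rule shape_cell[OF globPow w])
  \<comment> \<open>The arity of \<open>x\<close> is the shape of \<open>w\<close>, so the identity
    on this shape starts and ends at the common projection of \<open>x\<close> and \<open>y\<close>,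
    and the contraction yields a cell from \<open>x\<close> to \<open>y\<close>.\<close>
  have "proj E m n k x = (?f, src (Tfree one) k ?\<theta>)" "proj E m n k y = (?f, tgt (Tfree one) k ?\<theta>)"
    using proj_ar[OF x] xy(2) a by (simp_all add: tid_bd[OF globular_one s])
  note c = contr[OF xy(1) proj_hom[OF x] tid_cell[OF s] this]
  note bc = in_box_tid[OF w c(1,4)]
  show ?thesis
    unfolding weakly_equivalent_def
    using action_cell[OF b(1)] action_cell[OF b(2)] action_cell[OF bc] action_bd[OF bc]
      pseudo_invertible_action[OF w proj_hom[OF x] c(1,4)] tid_bd[OF globPow w] c(2,3)
    by (intro conjI bexI[of _ "\<Omega> m n (Suc k) (contr E m n k (?f, ?\<theta>) x y, tid (Apow m) k w)"])
      (simp_all add: pow_wcat_def One_nat_def)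
qed

end

theorem theorem16p3:
  fixes P :: "'p pro"
    and E :: "('p, 'e) weak_gpro"
    and A :: "'a coll"
    and \<Omega> :: "nat \<Rightarrow> nat \<Rightarrow> nat \<Rightarrow> 'e \<times> (pshape \<times> 'a list) sterm set \<Rightarrow> pshape \<times> 'a list"
  assumes "PRO P"
    and "initial_weakening P E"
    and "weakening_algebra E A \<Omega>"
  shows "(\<forall>m n k x y w.
      parallel (gcol E m n) k x y \<and>
      proj E m n k x = proj E m n k y \<and>
      (x, w) \<in> cells (box (gcol E m n) (pow_coll A m)) k \<and>
      (y, w) \<in> cells (box (gcol E m n) (pow_coll A m)) k \<longrightarrow>
      weakly_equivalent (pow_wcat P E A \<Omega> n) k (\<Omega> m n k (x, w)) (\<Omega> m n k (y, w))) \<and>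
    (\<forall>m n f g x y w.
      f \<in> hom P m n \<and> g \<in> hom P m n \<and> f = g \<and>
      x \<in> cells (gcol E m n) 0 \<and> fst (proj E m n 0 x) = f \<and>
      y \<in> cells (gcol E m n) 0 \<and> fst (proj E m n 0 y) = g \<and>
      w \<in> cells (pow_coll A m) 0 \<longrightarrow>
      weakly_equivalent (pow_wcat P E A \<Omega> n) 0
        (\<Omega> m n 0 (x, tunit (pow_coll A m) 0 w)) (\<Omega> m n 0 (y, tunit (pow_coll A m) 0 w)))"
proof -
  interpret PRO P by (rule assms)
  interpret weakening_algebra E A \<Omega> by (rule assms)
  interpret weakening_action P E A \<Omega>
    by unfold_locales (use assms(2) in \<open>simp add: initial_weakening_def\<close>)
  have "weakly_equivalent (pow_wcat P E A \<Omega> n) 0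
      (\<Omega> m n 0 (x, tunit (Apow m) 0 w)) (\<Omega> m n 0 (y, tunit (Apow m) 0 w))"
    if x: "x \<in> cells (G m n) 0" and y: "y \<in> cells (G m n) 0"
      and xy: "fst (proj E m n 0 x) = fst (proj E m n 0 y)" and w: "w \<in> cells (Apow m) 0" for m n x y w
  proof (rule weakly_equivalent_actions)
    \<comment> \<open>There is only one \<open>0\<close>-dimensional shape, so equality of the
      underlying operations already means lying over the same cell.\<close>
    have u: "\<theta> = tunit one 0 ()" if "\<theta> \<in> cells (Tfree one) 0" for \<theta>
      using Tfree_cells_0[OF that] by auto
    show "parallel (G m n) 0 x y" using x y by (simp add: parallel_def)
    show "proj E m n 0 x = proj E m n 0 y"
      using proj_ar[OF x] proj_ar[OF y] xy u[OF ar_cell[OF collG x]] u[OF ar_cell[OF collG y]] by simp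
    show "(x, tunit (Apow m) 0 w) \<in> cells (box (G m n) (Apow m)) 0"
      "(y, tunit (Apow m) 0 w) \<in> cells (box (G m n) (Apow m)) 0"
      using x y u[OF ar_cell[OF collG x]] u[OF ar_cell[OF collG y]]
      by (simp_all add: box_cells tunit_cell[OF w] shape_tunit[OF globPow w])
  qed
  then show ?thesis using weakly_equivalent_actions by auto
qed

end
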